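(* Let $\rho$ be a critical radius function on $\mathbb{R}^d$, $u\in A_1^\rho$ and $v\in A_\infty^\rho$. Then there exist $\sigma\geq0$ and $C>0$ such that \[uv\left(\left\{x\in\mathbb{R}^d:\frac{M^{\rho,\sigma}(fv)(x)}{v(x)}>t\right\}\right)\leq\frac{C}{t}\int_{\mathbb{R}^d}|f(x)|u(x)v(x)\,dx\] for every $t>0$ and every function $f$ (for which $fv$ is locally integrable).
   Context: A critical radius function is a function $\rho:\mathbb{R}^d\to(0,\infty)$ for which there exist constants $C_0>0$, $N_0\geq 1$ with $C_0^{-1}\rho(x)\left(1+\frac{|x-y|}{\rho(x)}\right)^{-N_0}\leq\rho(y)\leq C_0\rho(x)\left(1+\frac{|x-y|}{\rho(x)}\right)^{N_0/(N_0+1)}$ for all $x,y\in\mathbb{R}^d$. Cubes have sides parallel to the axes; $Q(x,r)$ denotes the cube with center $x$ and "radius" $r=\sqrt{d}\,\ell(Q)/2$. For $\theta\geq0$: $w\in A_1^{\rho,\theta}$ if there is $C$ with $\frac{1}{|Q|}\int_Q w\leq C(1+r/\rho(x))^\theta\inf_Q w$ for every cube $Q=Q(x,r)$; $w\in A_\infty^{\rho,\theta}$ if $\left(\frac{1}{|Q|}\int_Q w\right)\exp\left(\frac{1}{|Q|}\int_Q\log w^{-1}\right)\leq C(1+r/\rho(x))^\theta$ for all $Q=Q(x,r)$. $A_1^\rho=\bigcup_{\theta\geq0}A_1^{\rho,\theta}$, $A_\infty^\rho=\bigcup_{\theta\geq0}A_\infty^{\rho,\theta}$. For $\sigma\geq0$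 and $h\in L^1_{loc}$, $M^{\rho,\sigma}h(x)=\sup_{Q(x_0,r_0)\ni x}\left(1+\frac{r_0}{\rho(x_0)}\right)^{-\sigma}\frac{1}{|Q(x_0,r_0)|}\int_{Q(x_0,r_0)}|h(y)|\,dy$. $uv(E)=\int_E u v$. *)

theory Defs
  imports "HOL-Analysis.Analysis"
begin

definition critical_radius :: "('a::euclidean_space \<Rightarrow> real) \<Rightarrow> bool" where
  "critical_radius \<rho> \<longleftrightarrow> (\<forall>x. 0 < \<rho> x) \<and>
     (\<exists>C0 N0. C0 > 0 \<and> N0 \<ge> 1 \<and> (\<forall>x y.
        inverse C0 * \<rho> x * (1 + norm (x - y) / \<rho> x) powr (- N0) \<le> \<rho> y \<and>
        \<rho> y \<le> C0 * \<rho> x * (1 + norm (x - y) / \<rho> x) powr (N0 / (N0 + 1))))"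

text \<open>The closed cube Q(x,r) with centre x, sides parallel to the axes and
  "radius" r = sqrt d * side / 2, i.e. half-side r / sqrt d.\<close>
definition cube :: "'a::euclidean_space \<Rightarrow> real \<Rightarrow> 'a set" where
  "cube x r = cbox (x - (r / sqrt (real DIM('a))) *\<^sub>R One) (x + (r / sqrt (real DIM('a))) *\<^sub>R One)"

definition weight :: "('a::euclidean_space \<Rightarrow> real) \<Rightarrow> bool" where
  "weight w \<longleftrightarrow> w \<in> borel_measurable lebesgue \<and> (\<forall>x. 0 \<le> w x) \<and>
     (AE x in lebesgue. 0 < w x) \<and> (\<forall>K. compact K \<longrightarrow> set_integrable lebesgue K w)"

definition avg :: "'a::euclidean_space set \<Rightarrow> ('a \<Rightarrow> real) \<Rightarrow> real" where
  "avg Q w = (\<integral>y\<in>Q. w y \<partial>lebesgue) / measure lebesgue Q"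

text \<open>A_1^{\<rho>,\<theta>}: the infimum in the definition is the essential infimum,
  written out as an almost-everywhere inequality.\<close>
definition A1_rho_theta :: "('a::euclidean_space \<Rightarrow> real) \<Rightarrow> real \<Rightarrow> ('a \<Rightarrow> real) set" where
  "A1_rho_theta \<rho> \<theta> = {w. weight w \<and> (\<exists>C. \<forall>x r. 0 < r \<longrightarrow>
      (AE y in lebesgue. y \<in> cube x r \<longrightarrow>
         avg (cube x r) w \<le> C * (1 + r / \<rho> x) powr \<theta> * w y))}"

definition Ainf_rho_theta :: "('a::euclidean_space \<Rightarrow> real) \<Rightarrow> real \<Rightarrow> ('a \<Rightarrow> real) set" where
  "Ainf_rho_theta \<rho> \<theta> = {w. weight w \<and> (\<exists>C. \<forall>x r. 0 < r \<longrightarrow>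
      set_integrable lebesgue (cube x r) (\<lambda>y. ln (inverse (w y))) \<and>
      avg (cube x r) w * exp (avg (cube x r) (\<lambda>y. ln (inverse (w y))))
         \<le> C * (1 + r / \<rho> x) powr \<theta>)}"

definition A1_rho :: "('a::euclidean_space \<Rightarrow> real) \<Rightarrow> ('a \<Rightarrow> real) set" where
  "A1_rho \<rho> = (\<Union>\<theta>\<in>{0..}. A1_rho_theta \<rho> \<theta>)"

definition Ainf_rho :: "('a::euclidean_space \<Rightarrow> real) \<Rightarrow> ('a \<Rightarrow> real) set" where
  "Ainf_rho \<rho> = (\<Union>\<theta>\<in>{0..}. Ainf_rho_theta \<rho> \<theta>)"

definition M_rho :: "('a::euclidean_space \<Rightarrow> real) \<Rightarrow> real \<Rightarrow> ('a \<Rightarrow> real) \<Rightarrow> 'a \<Rightarrow> ennreal" where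
  "M_rho \<rho> \<sigma> h x = (SUP p\<in>{(x0, r0). 0 < r0 \<and> x \<in> cube x0 r0}.
      ennreal ((1 + snd p / \<rho> (fst p)) powr (- \<sigma>)) *
      ((\<integral>\<^sup>+ y\<in>cube (fst p) (snd p). ennreal \<bar>h y\<bar> \<partial>lebesgue) / emeasure lebesgue (cube (fst p) (snd p))))"

end

(* Cubes whose radius exceeds a fixed multiple of rho at their centre are controlled by an integral
   operator with a kernel that decays in |x - y| / rho(y), provided sigma is large; by Tonelli and the
   pointwise A_1 bound for u this operator satisfies even a strong type estimate, in which v cancels.

   Smaller cubes lie, by the one-third trick, in cells of finitely many shifted dyadic grids restricted
   to cells of side at most rho, where both weights satisfy uniform A_infinity estimates.  There, a
   point x with a^k < v(x) <= a^(k+1) below the maximal function of g lies in a maximal cell J with mean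
   of g above a^k (cells without ancestors are trivial).  Group these J by the sizes a^(k+l) and 2^i of
   the means of v and u.  The part of J where v is about a^k has u-measure at most C beta^|l| u(J)
   with beta < 1, by Chebyshev's inequality for l < 0 and by A_infinity of v for l >= 0, and A_infinity
   of u.  For fixed l and i, a^k u(J) is at most a constant times 2^i a^(-l) v(J), and sparseness
   bounds the sum of the v(J) by the v-measure of the maximal ones, each about a^l times the integral
   of g.  Summing 2^i over those i for which 2^i <= C u(x) gives a multiple of u(x), as u is in A_1. *)
theory Submission
  imports Defs
begin

section \<open>Dyadic families of sets\<close>

text \<open>The obstacle is that \<open>v\<close> stands on both sides, so the height at which the
  maximal function is cut varies with the point, and the stopping cells of all heights have to be
  summed. Packing of these cells is available for \<open>v\<close> only, while the measure to be
  estimated carries \<open>u\<close>. Freezing the means of both weights on a class trades u(J) for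
  v(J); the price is a sum over classes. Over \<open>l\<close> it converges by decay. Over
  \<open>i\<close> there is no decay, and the sum is recovered pointwise under the integral of
  \<open>g\<close>; this is why each estimate inside a class keeps the union of the class as domain
  of integration.

  The weight conditions carry the factor \<open>(1 + r / \<rho> x) powr \<theta>\<close>, which is
  under control only while \<open>r\<close> is at most a multiple of \<open>\<rho> x\<close>. Hence
  the grids are cut off at that size. Every cell then has finitely many ancestors, and maximal cells
  exist without any decay of the means of \<open>g\<close> at infinity.\<close>

abbreviation vol :: "'a::euclidean_space set \<Rightarrow> real" where
  "vol \<equiv> measure lebesgue"

lemma emeasure_UN_le_count_space:
  assumes "countable I" and [measurable]: "\<And>i. i \<in> I \<Longrightarrow> X i \<in> sets M"
  shows "emeasure M (\<Union>i\<in>I. X i) \<le> (\<integral>\<^sup>+i. emeasure M (X i) \<partial>count_space I)"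
proof -
  have [measurable]: "(\<Union>i\<in>I. X i) \<in> sets M"
    using assms by (intro sets.countable_UN') auto
  have "indicator (\<Union>i\<in>I. X i) x \<le> (\<integral>\<^sup>+i. (indicator (X i) x :: ennreal) \<partial>count_space I)" for x
  proof (cases "x \<in> (\<Union>i\<in>I. X i)")
    case True
    then obtain i where "i \<in> I" "x \<in> X i" by blast
    then show ?thesis
      using nn_integral_ge_point[of i I "\<lambda>i. indicator (X i) x"] by (auto simp: indicator_def)
  qed simp
  then have "emeasure M (\<Union>i\<in>I. X i) \<le> (\<integral>\<^sup>+x. \<integral>\<^sup>+i. indicator (X i) x \<partial>count_space I \<partial>M)"
    by (subst nn_integral_indicator[symmetric]; (rule nn_integral_mono)?) simp_all
  also have "\<dots> = (\<integral>\<^sup>+i. \<integral>\<^sup>+x. indicator (X i) x \<partial>M \<partial>count_space I)"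
    using assms by (intro nn_integral_count_space_nn_integral) auto
  also have "\<dots> = (\<integral>\<^sup>+i. emeasure M (X i) \<partial>count_space I)"
    by (intro nn_integral_cong) auto
  finally show ?thesis .
qed

text \<open>The sets decrease so that continuity from above applies to any measure that is finite on
  a cell: this passes outer regularity from Lebesgue measure to every measure absolutely continuous
  with respect to it.\<close>

lemma lebesgue_outer_open_Inter:
  assumes "N \<in> sets lebesgue"
  obtains W :: "nat \<Rightarrow> 'a::euclidean_space set"
  where "\<And>n. open (W n)" "\<And>n. N \<subseteq> W n" "decseq W" "(\<Inter>n. W n) - N \<in> null_sets lebesgue"
proof -
  have "\<forall>n. \<exists>T. open T \<and> N \<subseteq> T \<and> T - N \<in> lmeasurable \<and>
      emeasure lebesgue (T - N) < ennreal (1 / real (Suc n))"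
  proof
    fix n
    show "\<exists>T. open T \<and> N \<subseteq> T \<and> T - N \<in> lmeasurable \<and>
        emeasure lebesgue (T - N) < ennreal (1 / real (Suc n))"
      by (rule sets_lebesgue_outer_open[OF assms, of "1 / real (Suc n)"]) auto
  qed
  from choice[OF this] obtain T where "\<forall>n. open (T n) \<and> N \<subseteq> T n \<and> T n - N \<in> lmeasurable \<and>
      emeasure lebesgue (T n - N) < ennreal (1 / real (Suc n))" ..
  then have T: "\<And>n. open (T n)" "\<And>n. N \<subseteq> T n" "\<And>n. T n - N \<in> lmeasurable"
      "\<And>n. emeasure lebesgue (T n - N) < ennreal (1 / real (Suc n))" by auto
  define W where "W n = (\<Inter>i\<le>n. T i)" for n
  show ?thesis
  proof
    show "open (W n)" for n unfolding W_def using T(1) by (intro open_INT) auto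
    show "N \<subseteq> W n" for n unfolding W_def using T(2) by auto
    show "decseq W" unfolding W_def decseq_def by auto
    have meas: "(\<Inter>n. W n) - N \<in> sets lebesgue"
      using assms \<open>\<And>n. open (W n)\<close> by (intro sets.Diff sets.countable_INT') auto
    have "emeasure lebesgue ((\<Inter>n. W n) - N) \<le> 0 + ennreal e" if "e > 0" for e
    proof -
      obtain n where n: "1 / real (Suc n) < e" using nat_approx_posE[OF \<open>e > 0\<close>] by auto
      have "emeasure lebesgue ((\<Inter>n. W n) - N) \<le> emeasure lebesgue (T n - N)"
        using T(3)[of n] by (intro emeasure_mono) (auto simp: W_def fmeasurable_def)
      also have "\<dots> \<le> ennreal (1 / real (Suc n))" using T(4)[of n] by simp
      also have "\<dots> \<le> ennreal e" using n by (intro ennreal_leI) simp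
      finally show ?thesis by simp
    qed
    then have "emeasure lebesgue ((\<Inter>n. W n) - N) \<le> 0" using ennreal_le_epsilon[of 0] by blast
    then have "emeasure lebesgue ((\<Inter>n. W n) - N) = 0" by (simp only: le_zero_eq)
    with meas show "(\<Inter>n. W n) - N \<in> null_sets lebesgue" by (intro null_setsI)
  qed
qed

section \<open>Maximal cells and densities in nested families\<close>

definition maximal :: "'a set set \<Rightarrow> 'a set set" where
  "maximal S = {J \<in> S. \<forall>J'\<in>S. J \<subseteq> J' \<longrightarrow> J' = J}"

lemma maximal_subset: "maximal S \<subseteq> S"
  by (auto simp: maximal_def)

text \<open>Generations are replaced by nesting and finiteness of ancestors, because the local grids
  have maximal cells of varying size. For the same reason a parent is demanded only for a cell that
  lies strictly inside another one. \<open>small_cell\<close> is what allows differentiation: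
  arbitrarily small cells exist around each point, also inside a given cell.\<close>

locale dyadic_family =
  fixes \<D> :: "'a::euclidean_space set set" and D :: real
  assumes countable_family: "countable \<D>"
    and cell_lmeasurable: "I \<in> \<D> \<Longrightarrow> I \<in> lmeasurable"
    and cell_pos: "I \<in> \<D> \<Longrightarrow> 0 < vol I"
    and nested: "I \<in> \<D> \<Longrightarrow> J \<in> \<D> \<Longrightarrow> I \<inter> J \<noteq> {} \<Longrightarrow> I \<subseteq> J \<or> J \<subseteq> I"
    and finite_ancestors: "I \<in> \<D> \<Longrightarrow> finite {J \<in> \<D>. I \<subseteq> J}"
    and parent: "J \<in> \<D> \<Longrightarrow> I \<in> \<D> \<Longrightarrow> J \<subset> I \<Longrightarrow>
      \<exists>J'\<in>\<D>. J \<subset> J' \<and> J' \<subseteq> I \<and> vol J' \<le> D * vol J"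
    and D_ge: "1 \<le> D"
    and small_cell: "I \<in> \<D> \<Longrightarrow> open W \<Longrightarrow> x \<in> I \<Longrightarrow> x \<in> W \<Longrightarrow> \<exists>J\<in>\<D>. x \<in> J \<and> J \<subseteq> I \<and> J \<subseteq> W"
begin

lemma cell_sets: "I \<in> \<D> \<Longrightarrow> I \<in> sets lebesgue"
  using cell_lmeasurable by auto

lemma Union_sets: "S \<subseteq> \<D> \<Longrightarrow> \<Union>S \<in> sets lebesgue"
  using cell_sets countable_family by (intro sets.countable_Union) (auto intro: countable_subset)

lemma maximal_above:
  assumes "S \<subseteq> \<D>" "J \<in> S"
  shows "\<exists>J'\<in>maximal S. J \<subseteq> J'"
proof -
  have "finite {J'\<in>S. J \<subseteq> J'}"
    using assms by (intro finite_subset[OF _ finite_ancestors[of J]]) auto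
  from finite_has_maximal2[OF this, of J] assms(2)
  obtain M where M: "M \<in> S" "J \<subseteq> M" "\<forall>b\<in>{J'\<in>S. J \<subseteq> J'}. M \<subseteq> b \<longrightarrow> M = b"
    by auto
  have "J' = M" if "J' \<in> S" "M \<subseteq> J'" for J'
  proof -
    have "J' \<in> {J'\<in>S. J \<subseteq> J'}" using M(2) that by simp
    from bspec[OF M(3) this] that(2) show ?thesis by simp
  qed
  with M(1) have "M \<in> maximal S" by (simp add: maximal_def)
  with M show ?thesis by blast
qed

lemma Union_maximal:
  assumes "S \<subseteq> \<D>"
  shows "\<Union>(maximal S) = \<Union>S"
proof
  show "\<Union>S \<subseteq> \<Union>(maximal S)"
  proof
    fix x assume "x \<in> \<Union>S"
    then obtain J where "J \<in> S" "x \<in> J" by blast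
    with maximal_above[OF assms \<open>J \<in> S\<close>] show "x \<in> \<Union>(maximal S)" by blast
  qed
qed (intro Union_mono maximal_subset)

lemma disjoint_maximal:
  assumes "S \<subseteq> \<D>"
  shows "disjoint_family_on (\<lambda>J. J) (maximal S)"
  unfolding disjoint_family_on_def
proof (intro ballI impI)
  fix J J' assume J: "J \<in> maximal S" "J' \<in> maximal S" "J \<noteq> J'"
  then have "J \<in> \<D>" "J' \<in> \<D>" using assms maximal_subset[of S] by auto
  with nested[of J J'] J show "J \<inter> J' = {}" unfolding maximal_def by blast
qed

text \<open>Nested cells need no covering lemma: the maximal ones are disjoint and have the same
  union, so every measure splits over them exactly.\<close>

lemma emeasure_Union_maximal:
  assumes "S \<subseteq> \<D>" "sets \<mu> = sets lebesgue" "E \<in> sets lebesgue"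
  shows "emeasure \<mu> (E \<inter> \<Union>S) = (\<integral>\<^sup>+J. emeasure \<mu> (E \<inter> J) \<partial>count_space (maximal S))"
proof -
  have "emeasure \<mu> (\<Union>J\<in>maximal S. E \<inter> J) = (\<integral>\<^sup>+J. emeasure \<mu> (E \<inter> J) \<partial>count_space (maximal S))"
  proof (rule emeasure_UN_countable)
    show "E \<inter> J \<in> sets \<mu>" if "J \<in> maximal S" for J
      using that assms cell_sets maximal_subset by blast
    show "countable (maximal S)"
      using assms(1) countable_family maximal_subset by (meson countable_subset order_trans)
    show "disjoint_family_on (\<lambda>J. E \<inter> J) (maximal S)"
      using disjoint_maximal[OF assms(1)] unfolding disjoint_family_on_def by blast
  qed
  moreover have "(\<Union>J\<in>maximal S. E \<inter> J) = E \<inter> \<Union>S"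
    using Union_maximal[OF assms(1)] by blast
  ultimately show ?thesis by simp
qed

lemma emeasure_Union_maximal':
  assumes "S \<subseteq> \<D>" "sets \<mu> = sets lebesgue"
  shows "emeasure \<mu> (\<Union>S) = (\<integral>\<^sup>+J. emeasure \<mu> J \<partial>count_space (maximal S))"
  using emeasure_Union_maximal[OF assms, of UNIV] by simp

text \<open>A one-sided density theorem for general measures. The set \<open>N\<close> of thin
  points is covered, inside any open set around it, by disjoint cells that meet \<open>N\<close> and
  hence carry at most the fraction \<open>c\<close> of \<open>E\<close>. Shrinking the open sets
  gives \<open>\<mu> N \<le> c * \<mu> N\<close>.\<close>

lemma density_point_null:
  assumes sets: "sets \<mu> = sets lebesgue" and ac: "absolutely_continuous lebesgue \<mu>"
    and I: "I \<in> \<D>" and fin: "emeasure \<mu> I < \<infinity>"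
    and E: "E \<in> sets lebesgue" "E \<subseteq> I" and c: "c < (1::real)"
  shows "emeasure \<mu> {x\<in>E. \<forall>J\<in>\<D>. x \<in> J \<longrightarrow> J \<subseteq> I \<longrightarrow> emeasure \<mu> (E \<inter> J) \<le> ennreal c * emeasure \<mu> J} = 0"
    (is "emeasure \<mu> ?N = 0")
proof -
  define T where "T = {J\<in>\<D>. J \<subseteq> I \<and> \<not> emeasure \<mu> (E \<inter> J) \<le> ennreal c * emeasure \<mu> J}"
  define N where "N = E - \<Union>T"
  have N_eq: "?N = N" unfolding T_def N_def using E by blast
  have N_le: "emeasure \<mu> (E \<inter> J) \<le> ennreal c * emeasure \<mu> J"
    if "J \<in> \<D>" "x \<in> J" "J \<subseteq> I" "x \<in> N" for x J
    using that unfolding N_def T_def by blast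
  have N_sets: "N \<in> sets lebesgue" and N_E: "N \<subseteq> E"
    unfolding N_def using E Union_sets[of T] by (auto simp: T_def)
  obtain W where W: "\<And>n. open (W n)" "\<And>n. N \<subseteq> W n" "decseq W" "(\<Inter>n. W n) - N \<in> null_sets lebesgue"
    by (rule lebesgue_outer_open_Inter[OF N_sets], rule that)
  have W_sets: "W n \<inter> I \<in> sets \<mu>" for n
    using W(1) cell_sets[OF I] sets by (auto intro!: sets.Int)
  have le: "emeasure \<mu> N \<le> ennreal c * emeasure \<mu> (W n \<inter> I)" for n
  proof -
    define S where "S = {J\<in>\<D>. J \<subseteq> W n \<inter> I \<and> J \<inter> N \<noteq> {}}"
    have S: "S \<subseteq> \<D>" by (auto simp: S_def)
    have "N \<subseteq> \<Union>S"
    proof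
      fix x assume x: "x \<in> N"
      then obtain J where "J \<in> \<D>" "x \<in> J" "J \<subseteq> I" "J \<subseteq> W n"
        using small_cell[OF I W(1)[of n], of x] E N_E W(2)[of n] by blast
      with x show "x \<in> \<Union>S" unfolding S_def by blast
    qed
    then have "emeasure \<mu> N = emeasure \<mu> (N \<inter> \<Union>S)" by (simp add: Int_absorb2)
    also have "\<dots> = (\<integral>\<^sup>+J. emeasure \<mu> (N \<inter> J) \<partial>count_space (maximal S))"
      by (rule emeasure_Union_maximal[OF S sets N_sets])
    also have "\<dots> \<le> (\<integral>\<^sup>+J. ennreal c * emeasure \<mu> J \<partial>count_space (maximal S))"
    proof (intro nn_integral_mono)
      fix J assume "J \<in> space (count_space (maximal S))"
      then have J: "J \<in> S" using maximal_subset by auto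
      then obtain x where x: "x \<in> J" "x \<in> N" unfolding S_def by blast
      have "emeasure \<mu> (N \<inter> J) \<le> emeasure \<mu> (E \<inter> J)"
        using E N_E cell_sets J S sets by (intro emeasure_mono) auto
      also have "\<dots> \<le> ennreal c * emeasure \<mu> J"
        using x J by (intro N_le) (auto simp: S_def)
      finally show "emeasure \<mu> (N \<inter> J) \<le> ennreal c * emeasure \<mu> J" .
    qed
    also have "\<dots> = ennreal c * emeasure \<mu> (\<Union>S)"
      by (subst nn_integral_cmult) (auto simp: emeasure_Union_maximal'[OF S sets])
    also have "\<dots> \<le> ennreal c * emeasure \<mu> (W n \<inter> I)"
      using W_sets by (intro mult_left_mono emeasure_mono) (auto simp: S_def)
    finally show ?thesis .
  qed
  have "(INF n. emeasure \<mu> (W n \<inter> I)) = emeasure \<mu> (\<Inter>n. W n \<inter> I)"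
  proof (rule INF_emeasure_decseq)
    show "decseq (\<lambda>n. W n \<inter> I)" using W(3) unfolding decseq_def by blast
    show "emeasure \<mu> (W n \<inter> I) \<noteq> \<infinity>" for n
      using emeasure_mono[of "W n \<inter> I" I \<mu>] fin cell_sets[OF I] sets by (auto simp: top_unique)
  qed (use W_sets in auto)
  also have "emeasure \<mu> (\<Inter>n. W n \<inter> I) \<le> emeasure \<mu> (N \<union> ((\<Inter>n. W n) - N))"
  proof (rule emeasure_mono)
    show "N \<union> ((\<Inter>n. W n) - N) \<in> sets \<mu>"
      unfolding sets by (rule sets.Un[OF N_sets null_setsD2[OF W(4)]])
  qed blast
  also have "\<dots> = emeasure \<mu> N"
  proof (rule emeasure_Un_null_set)
    show "(\<Inter>n. W n) - N \<in> null_sets \<mu>" using W(4) ac unfolding absolutely_continuous_def by blast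
  qed (use N_sets sets in auto)
  finally have inf: "(INF n. emeasure \<mu> (W n \<inter> I)) \<le> emeasure \<mu> N" .
  have "emeasure \<mu> N \<le> emeasure \<mu> I" using E N_E cell_sets[OF I] sets by (intro emeasure_mono) auto
  then have "emeasure \<mu> N < top" using fin by (auto simp: le_less_trans)
  then obtain r where r: "0 \<le> r" "emeasure \<mu> N = ennreal r"
    by (cases "emeasure \<mu> N") auto
  have "emeasure \<mu> N = 0"
  proof (cases "c \<le> 0")
    case True then show ?thesis using le[of 0] by (simp add: ennreal_neg)
  next
    case False
    \<comment> \<open>Dividing by \<open>c\<close> first leaves a lower bound for every
      \<open>W n \<inter> I\<close>, which passes to the infimum.\<close>
    have "ennreal (1 / c) * emeasure \<mu> N \<le> emeasure \<mu> (W n \<inter> I)" for n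
    proof -
      have "ennreal (1 / c) * emeasure \<mu> N \<le> ennreal (1 / c) * (ennreal c * emeasure \<mu> (W n \<inter> I))"
        by (intro mult_left_mono le) auto
      also have "\<dots> = emeasure \<mu> (W n \<inter> I)"
        using False by (simp add: mult.assoc[symmetric] ennreal_mult[symmetric])
      finally show ?thesis .
    qed
    then have "ennreal (1 / c) * emeasure \<mu> N \<le> (INF n. emeasure \<mu> (W n \<inter> I))"
      by (intro INF_greatest)
    also note inf
    finally have "ennreal (1 / c * r) \<le> ennreal r"
      using r False by (simp add: ennreal_mult[symmetric])
    then have "r \<le> c * r" using r False by (simp add: field_simps)
    then have "r = 0" using r(1) c by (smt (verit) mult_less_cancel_right2)
    then show ?thesis using r by simp
  qed
  with N_eq show ?thesis by simp
qed

text \<open>The Calderon--Zygmund stopping cubes of the density of \<open>E\<close> form a set \<open>E'\<close> with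
  \<open>\<mu>(E') \<le> \<mu>(E) / c\<close> and \<open>\<nu>(E) \<le> \<beta> \<nu>(E')\<close>; iterating this turns one fixed comparison
  into a power-type one.\<close>
lemma iterated_comparison:
  assumes sets: "sets \<mu> = sets lebesgue" "sets \<nu> = sets lebesgue"
    and ac: "absolutely_continuous lebesgue \<mu>" "absolutely_continuous \<mu> \<nu>"
    and fin: "\<And>I. I \<in> \<D> \<Longrightarrow> emeasure \<mu> I < \<infinity>"
    and const: "0 < c" "c < 1" "0 \<le> \<beta>" "0 < C"
    and doubling: "\<And>J J'. J \<in> \<D> \<Longrightarrow> J' \<in> \<D> \<Longrightarrow> J \<subseteq> J' \<Longrightarrow> vol J' \<le> D * vol J
        \<Longrightarrow> emeasure \<mu> J' \<le> ennreal C * emeasure \<mu> J"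
    and step: "\<And>J E. J \<in> \<D> \<Longrightarrow> E \<in> sets lebesgue \<Longrightarrow> E \<subseteq> J \<Longrightarrow>
        emeasure \<mu> E \<le> ennreal (c * C) * emeasure \<mu> J \<Longrightarrow> emeasure \<nu> E \<le> ennreal \<beta> * emeasure \<nu> J"
    and I: "I \<in> \<D>"
  shows "E \<in> sets lebesgue \<Longrightarrow> E \<subseteq> I \<Longrightarrow> emeasure \<mu> E \<le> ennreal (c ^ m) * emeasure \<mu> I \<Longrightarrow>
      emeasure \<nu> E \<le> ennreal (\<beta> ^ m) * emeasure \<nu> I"
proof (induction m arbitrary: E)
  case 0
  then show ?case using cell_sets[OF I] sets by (auto intro!: emeasure_mono)
next
  case (Suc m)
  define S where "S = {J\<in>\<D>. J \<subseteq> I \<and> \<not> emeasure \<mu> (E \<inter> J) \<le> ennreal c * emeasure \<mu> J}"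
  have S: "S \<subseteq> \<D>" by (auto simp: S_def)
  have E': "\<Union>S \<in> sets lebesgue" "\<Union>S \<subseteq> I" using Union_sets[OF S] by (auto simp: S_def)
  have E_c: "emeasure \<mu> E \<le> ennreal c * emeasure \<mu> I"
  proof -
    have "c ^ Suc m \<le> c" using const by (simp add: mult_le_cancel_left1 power_le_one)
    then have "ennreal (c ^ Suc m) * emeasure \<mu> I \<le> ennreal c * emeasure \<mu> I"
      by (intro mult_right_mono ennreal_leI) auto
    with Suc.prems(3) show ?thesis by simp
  qed
  have "E - \<Union>S = {x\<in>E. \<forall>J\<in>\<D>. x \<in> J \<longrightarrow> J \<subseteq> I \<longrightarrow> emeasure \<mu> (E \<inter> J) \<le> ennreal c * emeasure \<mu> J}"
    unfolding S_def using Suc.prems(2) by blast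
  then have "emeasure \<mu> (E - \<Union>S) = 0"
    using density_point_null[OF sets(1) ac(1) I fin[OF I] Suc.prems(1,2) const(2)] by simp
  then have "E - \<Union>S \<in> null_sets \<mu>"
    using sets Suc.prems E' by (auto intro!: null_setsI)
  then have null: "E - \<Union>S \<in> null_sets \<nu>" using ac(2) unfolding absolutely_continuous_def by blast
  have "emeasure \<nu> E \<le> emeasure \<nu> (E \<inter> \<Union>S \<union> (E - \<Union>S))"
    by (intro emeasure_mono) (use sets Suc.prems E' in auto)
  also have "\<dots> = emeasure \<nu> (E \<inter> \<Union>S)"
    using null sets Suc.prems E' by (intro emeasure_Un_null_set) auto
  also have "\<dots> = (\<integral>\<^sup>+J. emeasure \<nu> (E \<inter> J) \<partial>count_space (maximal S))"
    by (rule emeasure_Union_maximal[OF S sets(2) Suc.prems(1)])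
  also have "\<dots> \<le> (\<integral>\<^sup>+J. ennreal \<beta> * emeasure \<nu> J \<partial>count_space (maximal S))"
  proof (intro nn_integral_mono)
    fix J assume "J \<in> space (count_space (maximal S))"
    then have J: "J \<in> S" and Jmax: "\<And>J'. J' \<in> S \<Longrightarrow> J \<subseteq> J' \<Longrightarrow> J' = J"
      unfolding maximal_def by auto
    \<comment> \<open>Since \<open>I\<close> itself is not in \<open>S\<close>, a maximal
      \<open>J\<close> has a parent inside \<open>I\<close>. By maximality the density of
      \<open>E\<close> there is at most \<open>c\<close>, and doubling returns this to
      \<open>J\<close> with the factor \<open>C\<close>, as \<open>step\<close> requires.\<close>
    have "I \<notin> S" using E_c Suc.prems(2) by (auto simp: S_def Int_absorb2)
    with J have "J \<subset> I" "J \<in> \<D>" unfolding S_def by auto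
    then obtain J' where J': "J' \<in> \<D>" "J \<subset> J'" "J' \<subseteq> I"
        "vol J' \<le> D * vol J"
      using parent[OF \<open>J \<in> \<D>\<close> I] by blast
    then have "J' \<notin> S" using Jmax by blast
    then have le: "emeasure \<mu> (E \<inter> J') \<le> ennreal c * emeasure \<mu> J'" using J' unfolding S_def by auto
    have "emeasure \<mu> (E \<inter> J) \<le> emeasure \<mu> (E \<inter> J')"
      by (intro emeasure_mono) (use J' Suc.prems cell_sets sets in auto)
    also note le
    also have "ennreal c * emeasure \<mu> J' \<le> ennreal c * (ennreal C * emeasure \<mu> J)"
      using J' \<open>J \<in> \<D>\<close> by (intro mult_left_mono doubling) auto
    also have "\<dots> = ennreal (c * C) * emeasure \<mu> J"
      using const by (simp add: ennreal_mult mult.assoc)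
    finally show "emeasure \<nu> (E \<inter> J) \<le> ennreal \<beta> * emeasure \<nu> J"
      using step[of J "E \<inter> J"] \<open>J \<in> \<D>\<close> Suc.prems(1) cell_sets by auto
  qed
  also have "\<dots> = ennreal \<beta> * emeasure \<nu> (\<Union>S)"
    by (subst nn_integral_cmult) (auto simp: emeasure_Union_maximal'[OF S sets(2)])
  also have "\<dots> \<le> ennreal \<beta> * (ennreal (\<beta> ^ m) * emeasure \<nu> I)"
  proof (intro mult_left_mono Suc.IH[OF E'])
    have "ennreal c * emeasure \<mu> (\<Union>S) = (\<integral>\<^sup>+J. ennreal c * emeasure \<mu> J \<partial>count_space (maximal S))"
      by (subst nn_integral_cmult) (auto simp: emeasure_Union_maximal'[OF S sets(1)])
    also have "\<dots> \<le> (\<integral>\<^sup>+J. emeasure \<mu> (E \<inter> J) \<partial>count_space (maximal S))"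
      using maximal_subset[of S] by (intro nn_integral_mono) (auto simp: S_def)
    also have "\<dots> = emeasure \<mu> (E \<inter> \<Union>S)"
      by (rule emeasure_Union_maximal[OF S sets(1) Suc.prems(1), symmetric])
    also have "\<dots> \<le> emeasure \<mu> E"
      by (intro emeasure_mono) (use Suc.prems sets in auto)
    also have "\<dots> \<le> ennreal (c ^ Suc m) * emeasure \<mu> I" by (rule Suc.prems)
    also have "\<dots> = ennreal c * (ennreal (c ^ m) * emeasure \<mu> I)"
      using const by (simp add: ennreal_mult mult.assoc)
    finally show "emeasure \<mu> (\<Union>S) \<le> ennreal (c ^ m) * emeasure \<mu> I"
      using const by (simp add: ennreal_mult_le_mult_iff)
  qed auto
  also have "\<dots> = ennreal (\<beta> ^ Suc m) * emeasure \<nu> I"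
    using const by (simp add: ennreal_mult mult.assoc)
  finally show ?case .
qed

end

section \<open>Local A-infinity weights\<close>

abbreviation wmeas :: "('a::euclidean_space \<Rightarrow> real) \<Rightarrow> 'a measure" where
  "wmeas w \<equiv> density lebesgue (\<lambda>x. ennreal (w x))"

abbreviation wvol :: "('a::euclidean_space \<Rightarrow> real) \<Rightarrow> 'a set \<Rightarrow> real" where
  "wvol w \<equiv> measure (wmeas w)"

lemma emeasure_wmeas_ge:
  assumes "w \<in> borel_measurable lebesgue" "X \<in> sets lebesgue" "\<And>x. x \<in> X \<Longrightarrow> t \<le> w x"
  shows "ennreal t * emeasure lebesgue X \<le> emeasure (wmeas w) X"
proof -
  have "ennreal t * emeasure lebesgue X = (\<integral>\<^sup>+x\<in>X. ennreal t \<partial>lebesgue)"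
    using assms by (simp add: nn_integral_cmult_indicator)
  also have "\<dots> \<le> (\<integral>\<^sup>+x\<in>X. ennreal (w x) \<partial>lebesgue)"
    using assms by (intro nn_integral_mono) (auto simp: indicator_def intro: ennreal_leI)
  also have "\<dots> = emeasure (wmeas w) X"
    using assms by (subst emeasure_density) auto
  finally show ?thesis .
qed

lemma absolutely_continuous_wmeas:
  assumes "w \<in> borel_measurable lebesgue"
  shows "absolutely_continuous lebesgue (wmeas w)"
  using assms by (intro absolutely_continuousI_density) simp

lemma absolutely_continuous_wmeas':
  assumes "w \<in> borel_measurable lebesgue" "AE x in lebesgue. 0 < w x"
  shows "absolutely_continuous (wmeas w) lebesgue"
proof -
  have "X \<in> null_sets lebesgue" if "X \<in> null_sets (wmeas w)" for X
  proof -
    have X: "X \<in> sets lebesgue" and ae: "AE x in lebesgue. x \<in> X \<longrightarrow> ennreal (w x) = 0"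
      using that null_sets_density_iff[of "\<lambda>x. ennreal (w x)" lebesgue X] assms by auto
    from ae assms(2) have "AE x in lebesgue. x \<notin> X" by eventually_elim auto
    then show ?thesis using X by (simp add: AE_iff_null_sets)
  qed
  then show ?thesis unfolding absolutely_continuous_def by blast
qed

section \<open>Comparison of a weight with Lebesgue measure on the cells\<close>

context dyadic_family
begin

text \<open>A qualitative form of A_infinity, uniform over the cells: the points where
  \<open>w\<close> is at most \<open>b\<close> times its mean occupy a small share. Both A_1 and
  A_infinity weights yield it directly, and it implies power-type comparisons in both
  directions.\<close>

definition local_Ainf :: "('a \<Rightarrow> real) \<Rightarrow> bool" where
  "local_Ainf w \<longleftrightarrow> w \<in> borel_measurable lebesgue \<and> (AE x in lebesgue. 0 < w x) \<and>
    (\<forall>I\<in>\<D>. emeasure (wmeas w) I < \<infinity>) \<and>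
    (\<forall>\<epsilon>>0. \<exists>b>0. \<forall>I\<in>\<D>. vol {x\<in>I. w x * vol I \<le> b * wvol w I}
        \<le> \<epsilon> * vol I)"

lemma emeasure_cell_eq:
  assumes "sets \<mu> = sets lebesgue" "emeasure \<mu> I < \<infinity>" "E \<subseteq> I" "I \<in> \<D>"
  shows "emeasure \<mu> E = ennreal (measure \<mu> E)"
proof -
  have "emeasure \<mu> E \<le> emeasure \<mu> I" using assms cell_sets by (intro emeasure_mono) auto
  with assms(2) have "emeasure \<mu> E \<noteq> \<infinity>" by (auto simp: top_unique)
  then show ?thesis by (simp add: emeasure_eq_ennreal_measure)
qed

lemma emeasure_lebesgue_cell: "I \<in> \<D> \<Longrightarrow> emeasure lebesgue I < \<infinity>"
  using cell_lmeasurable[of I] unfolding fmeasurable_def by blast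

lemma wmeas_cell_pos:
  assumes "w \<in> borel_measurable lebesgue" "AE x in lebesgue. 0 < w x"
    and "emeasure (wmeas w) I < \<infinity>" "I \<in> \<D>"
  shows "0 < wvol w I"
proof (rule ccontr)
  assume "\<not> 0 < wvol w I"
  then have "wvol w I = 0" using measure_nonneg[of "wmeas w" I] by linarith
  then have "emeasure (wmeas w) I = 0"
    using emeasure_cell_eq[of "wmeas w" I I] assms by simp
  then have "I \<in> null_sets (wmeas w)" using cell_sets[OF assms(4)] by (intro null_setsI) auto
  then have "I \<in> null_sets lebesgue"
    using absolutely_continuous_wmeas'[OF assms(1,2)] unfolding absolutely_continuous_def by blast
  then have "vol I = 0" by (simp add: measure_eq_0_null_sets)
  with cell_pos[OF assms(4)] show False by simp
qed

text \<open>With \<open>\<epsilon> = \<eta> / 2\<close>, at least half of the share guaranteed for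
  \<open>E\<close> lies outside the low set \<open>B\<close>, and there \<open>w\<close> is bounded
  below by a multiple of its mean.\<close>

lemma local_Ainf_lower:
  assumes w: "local_Ainf w" and \<eta>: "0 < \<eta>"
  obtains \<kappa> where "0 < \<kappa>" "\<kappa> < 1"
    "\<And>I E. I \<in> \<D> \<Longrightarrow> E \<in> sets lebesgue \<Longrightarrow> E \<subseteq> I \<Longrightarrow> \<eta> * vol I \<le> vol E
      \<Longrightarrow> \<kappa> * wvol w I \<le> wvol w E"
proof -
  have meas: "w \<in> borel_measurable lebesgue" and fin: "\<And>I. I \<in> \<D> \<Longrightarrow> emeasure (wmeas w) I < \<infinity>"
    using w unfolding local_Ainf_def by auto
  have "\<exists>b>0. \<forall>I\<in>\<D>. vol {x\<in>I. w x * vol I \<le> b * wvol w I}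
        \<le> \<eta>/2 * vol I"
    using w half_gt_zero[OF \<eta>] unfolding local_Ainf_def by (elim conjE) (erule allE, erule mp)
  then obtain l where l: "l > 0" "\<And>I. I \<in> \<D> \<Longrightarrow>
      vol {x\<in>I. w x * vol I \<le> l * wvol w I} \<le> \<eta>/2 * vol I"
    by (elim exE conjE) (rule that, assumption, erule bspec)
  \<comment> \<open>The cap \<open>1/2\<close> secures \<open>\<kappa> < 1\<close>.\<close>
  define \<kappa> where "\<kappa> = min (l * \<eta> / 2) (1/2)"
  show ?thesis
  proof
    show "0 < \<kappa>" "\<kappa> < 1" using l \<eta> by (auto simp: \<kappa>_def)
    fix I E assume I: "I \<in> \<D>" and E: "E \<in> sets lebesgue" "E \<subseteq> I"
      and ge: "\<eta> * vol I \<le> vol E"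
    define t where "t = l * wvol w I / vol I"
    define B where "B = {x\<in>I. w x * vol I \<le> l * wvol w I}"
    have "{x\<in>space lebesgue. w x * vol I \<le> l * wvol w I} \<in> sets lebesgue"
      using meas by measurable
    moreover have "B = I \<inter> {x\<in>space lebesgue. w x * vol I \<le> l * wvol w I}"
      by (auto simp: B_def)
    ultimately have B: "B \<in> sets lebesgue" "B \<subseteq> I"
      using cell_sets[OF I] by (auto simp: B_def)
    have EB: "E \<in> lmeasurable" "B \<in> lmeasurable"
      by (rule fmeasurableI2[OF cell_lmeasurable[OF I] E(2,1)], rule fmeasurableI2[OF cell_lmeasurable[OF I] B(2,1)])
    have "vol E \<le> vol (E - B) + vol B"
    proof -
      have "vol E \<le> vol ((E - B) \<union> B)"
        using EB by (intro measure_mono_fmeasurable) auto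
      also have "\<dots> \<le> vol (E - B) + vol B"
        using EB by (intro measure_Un_le) auto
      finally show ?thesis .
    qed
    then have 1: "\<eta> / 2 * vol I \<le> vol (E - B)"
      using ge l(2)[OF I] unfolding B_def by linarith
    have "t \<le> w x" if "x \<in> E - B" for x
      using that E cell_pos[OF I] unfolding t_def B_def by (auto simp: field_simps)
    then have "ennreal t * emeasure lebesgue (E - B) \<le> emeasure (wmeas w) (E - B)"
      using E B meas by (intro emeasure_wmeas_ge) auto
    also have "\<dots> \<le> emeasure (wmeas w) E" using E by (intro emeasure_mono) auto
    finally have *: "ennreal t * emeasure lebesgue (E - B) \<le> emeasure (wmeas w) E" .
    have "E - B \<subseteq> I" using E by blast
    with * have "ennreal t * ennreal (vol (E - B)) \<le> ennreal (wvol w E)"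
      using emeasure_cell_eq[of lebesgue I "E - B"] emeasure_cell_eq[of "wmeas w" I E]
        fin[OF I] emeasure_lebesgue_cell[OF I] I E by auto
    moreover have t: "0 \<le> t" using l unfolding t_def by simp
    ultimately have "t * vol (E - B) \<le> wvol w E"
      by (simp add: ennreal_mult[symmetric])
    moreover have "t * (\<eta> / 2 * vol I) \<le> t * vol (E - B)"
      using 1 t by (intro mult_left_mono)
    moreover have "t * (\<eta> / 2 * vol I) = l * \<eta> / 2 * wvol w I"
      using cell_pos[OF I] unfolding t_def by simp
    moreover have "\<kappa> * wvol w I \<le> l * \<eta> / 2 * wvol w I"
      unfolding \<kappa>_def by (intro mult_right_mono) auto
    ultimately show "\<kappa> * wvol w I \<le> wvol w E" by linarith
  qed
qed

text \<open>The lower estimate applied to the complement \<open>I - E\<close>.\<close>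

lemma local_Ainf_upper:
  assumes w: "local_Ainf w" and \<eta>: "\<eta> < 1"
  obtains \<kappa> where "0 < \<kappa>" "\<kappa> < 1"
    "\<And>I E. I \<in> \<D> \<Longrightarrow> E \<in> sets lebesgue \<Longrightarrow> E \<subseteq> I \<Longrightarrow> vol E \<le> \<eta> * vol I
      \<Longrightarrow> wvol w E \<le> (1 - \<kappa>) * wvol w I"
proof -
  obtain \<kappa> where \<kappa>: "0 < \<kappa>" "\<kappa> < 1"
    "\<And>I E. I \<in> \<D> \<Longrightarrow> E \<in> sets lebesgue \<Longrightarrow> E \<subseteq> I \<Longrightarrow> (1 - \<eta>) * vol I \<le> vol E
      \<Longrightarrow> \<kappa> * wvol w I \<le> wvol w E"
    using local_Ainf_lower[OF w, of "1 - \<eta>"] \<eta> by auto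
  show ?thesis
  proof (rule that[OF \<kappa>(1,2)])
    fix I E assume I: "I \<in> \<D>" and E: "E \<in> sets lebesgue" "E \<subseteq> I"
      and le: "vol E \<le> \<eta> * vol I"
    have fin: "emeasure (wmeas w) I < \<infinity>" using w I unfolding local_Ainf_def by auto
    have "vol (I - E) = vol I - vol E"
      using E cell_sets[OF I] emeasure_lebesgue_cell[OF I] by (intro measure_Diff) auto
    moreover have "wvol w (I - E) = wvol w I - wvol w E"
      using E cell_sets[OF I] fin by (intro measure_Diff) auto
    ultimately show "wvol w E \<le> (1 - \<kappa>) * wvol w I"
      using \<kappa>(3)[OF I, of "I - E"] E cell_sets[OF I] le by (auto simp: algebra_simps)
  qed
qed

text \<open>The iteration with Lebesgue measure as \<open>\<mu>\<close>. It doubles along parents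
  with constant \<open>D\<close>, so the threshold \<open>1/2\<close> for a single step allows
  \<open>c = 1 / (2 * D)\<close>.\<close>

lemma local_Ainf_power_decay:
  assumes w: "local_Ainf w"
  obtains c \<beta> where "0 < c" "c < 1" "0 < \<beta>" "\<beta> < 1"
    "\<And>I E m. I \<in> \<D> \<Longrightarrow> E \<in> sets lebesgue \<Longrightarrow> E \<subseteq> I \<Longrightarrow> vol E \<le> c ^ m * vol I
      \<Longrightarrow> wvol w E \<le> \<beta> ^ m * wvol w I"
proof -
  have meas: "w \<in> borel_measurable lebesgue" and fin: "\<And>I. I \<in> \<D> \<Longrightarrow> emeasure (wmeas w) I < \<infinity>"
    using w unfolding local_Ainf_def by auto
  obtain \<kappa> where \<kappa>: "0 < \<kappa>" "\<kappa> < 1"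
    "\<And>I E. I \<in> \<D> \<Longrightarrow> E \<in> sets lebesgue \<Longrightarrow> E \<subseteq> I \<Longrightarrow> vol E \<le> 1/2 * vol I
      \<Longrightarrow> wvol w E \<le> (1 - \<kappa>) * wvol w I"
    using local_Ainf_upper[OF w, of "1/2"] by auto
  have eL: "emeasure lebesgue E = ennreal (vol E)" if "E \<subseteq> I" "I \<in> \<D>" for E I
    using emeasure_cell_eq[of lebesgue I E] emeasure_lebesgue_cell that by auto
  have eW: "emeasure (wmeas w) E = ennreal (wvol w E)" if "E \<subseteq> I" "I \<in> \<D>" for E I
    using emeasure_cell_eq[of "wmeas w" I E] fin that by auto
  define c where "c = 1 / (2 * D)"
  have c: "0 < c" "c < 1" "c * D = 1 / 2" using D_ge by (auto simp: c_def field_simps)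
  show ?thesis
  proof (rule that[of c "1 - \<kappa>"])
    fix I E m assume I: "I \<in> \<D>" and E: "E \<in> sets lebesgue" "E \<subseteq> I"
      and le: "vol E \<le> c ^ m * vol I"
    have "emeasure (wmeas w) E \<le> ennreal ((1 - \<kappa>) ^ m) * emeasure (wmeas w) I"
    proof (rule iterated_comparison[where \<mu>=lebesgue and c=c and C=D])
      show "absolutely_continuous lebesgue lebesgue" by (simp add: absolutely_continuous_def)
      show "absolutely_continuous lebesgue (wmeas w)" by (rule absolutely_continuous_wmeas[OF meas])
      show "emeasure lebesgue J' \<le> ennreal D * emeasure lebesgue J"
        if "J \<in> \<D>" "J' \<in> \<D>" "vol J' \<le> D * vol J" for J J'
        using that D_ge eL[of J J] eL[of J' J'] by (simp add: ennreal_mult[symmetric])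
      show "emeasure (wmeas w) F \<le> ennreal (1 - \<kappa>) * emeasure (wmeas w) J"
        if "J \<in> \<D>" "F \<in> sets lebesgue" "F \<subseteq> J" "emeasure lebesgue F \<le> ennreal (c * D) * emeasure lebesgue J"
        for J F
      proof -
        have "vol F \<le> 1/2 * vol J"
          using that(4) eL[OF that(3,1)] eL[of J J] that(1) unfolding c(3)
          by (simp add: ennreal_mult[symmetric] del: ennreal_half)
        then show ?thesis
          using \<kappa>(3)[OF that(1-3)] eW[OF that(3,1)] eW[of J J] that(1) \<kappa>(2)
          by (simp add: ennreal_mult[symmetric])
      qed
      show "emeasure lebesgue E \<le> ennreal (c ^ m) * emeasure lebesgue I"
        using le eL[OF E(2) I] eL[of I I] I c by (simp add: ennreal_mult[symmetric])
    qed (use c \<kappa> D_ge E I emeasure_lebesgue_cell in auto)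
    then show "wvol w E \<le> (1 - \<kappa>) ^ m * wvol w I"
      using eW[OF E(2) I] eW[of I I] I \<kappa> by (simp add: ennreal_mult[symmetric])
  qed (use c \<kappa> in auto)
qed

text \<open>The same iteration with the two measures exchanged. Doubling of \<open>w\<close> along
  parents comes from \<open>local_Ainf_lower\<close>, as a cell fills at least \<open>1/D\<close> of
  its parent.\<close>

lemma local_Ainf_power_decay_converse:
  assumes w: "local_Ainf w"
  obtains c \<beta> where "0 < c" "c < 1" "0 < \<beta>" "\<beta> < 1"
    "\<And>I E m. I \<in> \<D> \<Longrightarrow> E \<in> sets lebesgue \<Longrightarrow> E \<subseteq> I \<Longrightarrow> wvol w E \<le> c ^ m * wvol w I
      \<Longrightarrow> vol E \<le> \<beta> ^ m * vol I"
proof -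
  have meas: "w \<in> borel_measurable lebesgue" and fin: "\<And>I. I \<in> \<D> \<Longrightarrow> emeasure (wmeas w) I < \<infinity>"
    and pos: "AE x in lebesgue. 0 < w x"
    using w unfolding local_Ainf_def by auto
  obtain \<kappa> where \<kappa>: "0 < \<kappa>" "\<kappa> < 1"
    "\<And>I E. I \<in> \<D> \<Longrightarrow> E \<in> sets lebesgue \<Longrightarrow> E \<subseteq> I \<Longrightarrow> 1/2 * vol I \<le> vol E
      \<Longrightarrow> \<kappa> * wvol w I \<le> wvol w E"
    using local_Ainf_lower[OF w, of "1/2"] by auto
  obtain \<kappa>' where \<kappa>': "0 < \<kappa>'" "\<kappa>' < 1"
    "\<And>I E. I \<in> \<D> \<Longrightarrow> E \<in> sets lebesgue \<Longrightarrow> E \<subseteq> I \<Longrightarrow> 1/D * vol I \<le> vol E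
      \<Longrightarrow> \<kappa>' * wvol w I \<le> wvol w E"
    using local_Ainf_lower[OF w, of "1/D"] D_ge by auto
  have eL: "emeasure lebesgue E = ennreal (vol E)" if "E \<subseteq> I" "I \<in> \<D>" for E I
    using emeasure_cell_eq[of lebesgue I E] emeasure_lebesgue_cell that by auto
  have eW: "emeasure (wmeas w) E = ennreal (wvol w E)" if "E \<subseteq> I" "I \<in> \<D>" for E I
    using emeasure_cell_eq[of "wmeas w" I E] fin that by auto
  \<comment> \<open>After the doubling loss \<open>1 / \<kappa>'\<close> the share is
    \<open>\<kappa> / 2\<close>, strictly below the share \<open>\<kappa>\<close> that a set filling
    half of a cell must have.\<close>
  define c where "c = \<kappa> * \<kappa>' / 2"
  have "\<kappa> * \<kappa>' < 1" using \<kappa> \<kappa>' mult_strict_mono[of \<kappa> 1 \<kappa>' 1] by simp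
  then have c: "0 < c" "c < 1" "c * (1 / \<kappa>') = \<kappa> / 2" using \<kappa> \<kappa>' by (auto simp: c_def)
  show ?thesis
  proof (rule that[of c "1/2"])
    fix I E m assume I: "I \<in> \<D>" and E: "E \<in> sets lebesgue" "E \<subseteq> I"
      and le: "wvol w E \<le> c ^ m * wvol w I"
    have "emeasure lebesgue E \<le> ennreal ((1/2) ^ m) * emeasure lebesgue I"
    proof (rule iterated_comparison[where \<mu>="wmeas w" and c=c and C="1/\<kappa>'"])
      show "absolutely_continuous lebesgue (wmeas w)" by (rule absolutely_continuous_wmeas[OF meas])
      show "absolutely_continuous (wmeas w) lebesgue" by (rule absolutely_continuous_wmeas'[OF meas pos])
      show "emeasure (wmeas w) J' \<le> ennreal (1/\<kappa>') * emeasure (wmeas w) J"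
        if J: "J \<in> \<D>" "J' \<in> \<D>" "J \<subseteq> J'" "vol J' \<le> D * vol J" for J J'
      proof -
        have "\<kappa>' * wvol w J' \<le> wvol w J"
          using J D_ge cell_sets by (intro \<kappa>'(3)) (auto simp: field_simps)
        then have "wvol w J' \<le> 1/\<kappa>' * wvol w J"
          using \<kappa>' by (simp add: field_simps)
        then show ?thesis using \<kappa>' eW[of J J] eW[of J' J'] J by (simp add: ennreal_mult[symmetric])
      qed
      show "emeasure lebesgue F \<le> ennreal (1/2) * emeasure lebesgue J"
        if "J \<in> \<D>" "F \<in> sets lebesgue" "F \<subseteq> J" "emeasure (wmeas w) F \<le> ennreal (c * (1/\<kappa>')) * emeasure (wmeas w) J"
        for J F
      proof -
        have le: "wvol w F \<le> \<kappa>/2 * wvol w J"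
          using that(4) eW[OF that(3,1)] eW[of J J] that(1) \<kappa> unfolding c(3)
          by (simp add: ennreal_mult[symmetric])
        have p: "0 < \<kappa> * wvol w J" using wmeas_cell_pos[OF meas pos fin] that(1) \<kappa> by auto
        have "vol F \<le> 1/2 * vol J"
        proof (rule ccontr)
          assume "\<not> vol F \<le> 1/2 * vol J"
          then have "\<kappa> * wvol w J \<le> wvol w F"
            by (intro \<kappa>(3) that) auto
          with le p show False by simp
        qed
        then have "ennreal (vol F) \<le> ennreal (1/2 * vol J)" by (rule ennreal_leI)
        also have "\<dots> = ennreal (1/2) * ennreal (vol J)" by (rule ennreal_mult) auto
        finally show ?thesis
          using eL[OF that(3,1)] eL[of J J] that(1) by simp
      qed
      show "emeasure (wmeas w) E \<le> ennreal (c ^ m) * emeasure (wmeas w) I"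
        using le eW[OF E(2) I] eW[of I I] I c by (simp add: ennreal_mult[symmetric])
    qed (use c \<kappa> \<kappa>' D_ge E I fin in auto)
    then show "vol E \<le> (1/2) ^ m * vol I"
      using eL[OF E(2) I] eL[of I I] I by (simp add: ennreal_mult[symmetric])
  qed (use c in auto)
qed

end

section \<open>Sums over scales\<close>

lemma ex_power_int_between:
  fixes a x :: real
  assumes "1 < a" "0 < x"
  obtains k :: int where "a powi k < x" "x \<le> a powi (k + 1)"
proof
  \<comment> \<open>Ceiling minus one, not floor: the interval is open on the left and closed on the
    right.\<close>
  define k where "k = \<lceil>log a x\<rceil> - 1"
  have eq: "a powi j = a powr real_of_int j" for j :: int
    using assms by (simp add: powr_real_of_int')
  have "a powr real_of_int k < a powr log a x"
    unfolding k_def using assms by (intro powr_less_mono) linarith+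
  then show "a powi k < x" using assms by (simp add: eq)
  have "a powr log a x \<le> a powr real_of_int (k + 1)"
    unfolding k_def using assms by (intro powr_mono) linarith+
  then show "x \<le> a powi (k + 1)" using assms by (simp add: eq)
qed

lemma power_int_less_cancel:
  fixes a :: real
  assumes "1 < a" "a powi j < a powi k"
  shows "j < k"
  using assms power_int_increasing[of k j a] by (metis less_imp_le not_le)

lemma nn_integral_geometric:
  assumes "0 \<le> q" "q < (1::real)"
  shows "(\<integral>\<^sup>+n. ennreal (q ^ n) \<partial>count_space (UNIV :: nat set)) = ennreal (1 / (1 - q))"
proof -
  have "(\<integral>\<^sup>+n. ennreal (q ^ n) \<partial>count_space UNIV) = (\<Sum>n. ennreal (q ^ n))"
    by (rule nn_integral_count_space_nat)
  also have "\<dots> = ennreal (\<Sum>n. q ^ n)"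
    using assms by (intro suminf_ennreal2) (auto intro: summable_geometric)
  also have "(\<Sum>n. q ^ n) = 1 / (1 - q)" using assms by (intro suminf_geometric) auto
  finally show ?thesis .
qed

text \<open>The truncated exponent is the one produced by \<open>U_piece\<close>: 0, 1 and -1 all
  contribute 1. Two half-lines cover the integers, with 0 counted twice, hence the factor 2.\<close>

lemma nn_integral_int_abs_decay:
  assumes "0 \<le> q" "q < (1::real)"
  shows "(\<integral>\<^sup>+l. ennreal (q ^ (nat \<bar>l\<bar> - 1)) \<partial>count_space (UNIV :: int set)) \<le> ennreal (2 * (1 + 1 / (1 - q)))"
proof -
  let ?f = "\<lambda>l::int. ennreal (q ^ (nat \<bar>l\<bar> - 1))"
  have N: "(\<integral>\<^sup>+n. ennreal (q ^ (n - 1)) \<partial>count_space (UNIV :: nat set)) = ennreal (1 + 1 / (1 - q))"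
  proof -
    have "(\<integral>\<^sup>+n. ennreal (q ^ (n - 1)) \<partial>count_space (UNIV :: nat set)) = (\<Sum>n. ennreal (q ^ (n - 1)))"
      by (rule nn_integral_count_space_nat)
    also have "\<dots> = (\<Sum>n. ennreal (q ^ (n + 1 - 1))) + (\<Sum>n<1. ennreal (q ^ (n - 1)))"
      by (rule suminf_offset) auto
    also have "(\<Sum>n. ennreal (q ^ (n + 1 - 1))) = ennreal (1 / (1 - q))"
      using nn_integral_geometric[OF assms] by (simp add: nn_integral_count_space_nat)
    also have "(\<Sum>n<1. ennreal (q ^ (n - 1))) = ennreal 1" by simp
    also have "ennreal (1 / (1 - q)) + ennreal 1 = ennreal (1 + 1 / (1 - q))"
      using assms by (subst ennreal_plus[symmetric]) (auto simp: add.commute)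
    finally show ?thesis .
  qed
  have part: "(\<integral>\<^sup>+l. ?f l \<partial>count_space (range h)) = ennreal (1 + 1 / (1 - q))"
    if "inj h" "\<And>n. \<bar>h n\<bar> = int n" for h :: "nat \<Rightarrow> int"
  proof -
    have "(\<integral>\<^sup>+n. ?f (h n) \<partial>count_space UNIV) = (\<integral>\<^sup>+l. ?f l \<partial>count_space (range h))"
      using that(1) by (intro nn_integral_bij_count_space) (auto simp: bij_betw_def)
    with N that(2) show ?thesis by simp
  qed
  have "(\<integral>\<^sup>+l. ?f l \<partial>count_space UNIV) \<le>
      (\<integral>\<^sup>+l. ?f l * indicator (range int) l + ?f l * indicator (range (\<lambda>n. - int n)) l \<partial>count_space UNIV)"
  proof (intro nn_integral_mono)
    fix l :: int
    have "l \<in> range int \<or> l \<in> range (\<lambda>n. - int n)"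
    proof (cases "0 \<le> l")
      case True then have "l = int (nat l)" by simp
      then show ?thesis by blast
    next
      case False then have "l = - int (nat (- l))" by simp
      then show ?thesis by blast
    qed
    then show "?f l \<le> ?f l * indicator (range int) l + ?f l * indicator (range (\<lambda>n. - int n)) l"
      by (auto simp: indicator_def)
  qed
  also have "\<dots> = (\<integral>\<^sup>+l. ?f l \<partial>count_space (range int)) + (\<integral>\<^sup>+l. ?f l \<partial>count_space (range (\<lambda>n. - int n)))"
    by (subst nn_integral_add) (simp_all add: nn_integral_count_space_indicator)
  also have "\<dots> = ennreal (1 + 1 / (1 - q)) + ennreal (1 + 1 / (1 - q))"
    by (subst (1 2) part) (auto simp: inj_def)
  also have "\<dots> = ennreal (2 * (1 + 1 / (1 - q)))"
    using assms by (subst ennreal_plus[symmetric]) auto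
  finally show ?thesis .
qed

text \<open>A geometric series is at most twice its largest term. This turns the sum over the sizes
  of the means of \<open>u\<close> back into a multiple of the value of \<open>u\<close>. For
  \<open>X = 0\<close> no power qualifies.\<close>

lemma nn_integral_dyadic_below:
  fixes X :: real
  assumes "0 \<le> X"
  shows "(\<integral>\<^sup>+i. (if 2 powi i \<le> X then ennreal (2 powi i) else 0) \<partial>count_space (UNIV :: int set)) \<le> ennreal (2 * X)"
proof (cases "X = 0")
  case True
  have "\<not> 2 powi i \<le> X" for i :: int using True by (simp add: not_le)
  then show ?thesis by simp
next
  case False
  obtain k :: int where k: "2 powi k < X" "X \<le> 2 powi (k + 1)"
    using ex_power_int_between[of 2 X] False assms by auto
  \<comment> \<open>The right end is included in the choice of \<open>k\<close>, so when
    \<open>X\<close> is itself a power of 2 the largest admissible exponent is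
    \<open>k + 1\<close>.\<close>
  define n where "n = (if X = 2 powi (k + 1) then k + 1 else k)"
  have n: "2 powi n \<le> X" using k by (auto simp: n_def)
  have le: "i \<le> n" if "2 powi i \<le> X" for i :: int
  proof (rule ccontr)
    assume "\<not> i \<le> n"
    then have "2 powi (n + 1) \<le> (2 powi i :: real)" by (intro power_int_increasing) auto
    with that have "2 powi (n + 1) \<le> X" by simp
    then show False
    proof (cases "X = 2 powi (k + 1)")
      case True
      then have "2 powi (k + 2) \<le> (2 powi (k + 1) :: real)" using \<open>2 powi (n + 1) \<le> X\<close> by (simp add: n_def add.commute)
      moreover have "(2 powi (k + 1) :: real) < 2 powi (k + 2)" by (intro power_int_strict_increasing) auto
      ultimately show False by simp
    next
      case False
      then show False using \<open>2 powi (n + 1) \<le> X\<close> k by (simp add: n_def)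
    qed
  qed
  let ?h = "\<lambda>j::nat. n - int j"
  have range: "i \<in> range ?h" if "i \<le> n" for i
  proof -
    have "i = n - int (nat (n - i))" using that by simp
    then show ?thesis by blast
  qed
  have "(\<integral>\<^sup>+i. (if 2 powi i \<le> X then ennreal (2 powi i) else 0) \<partial>count_space UNIV)
      \<le> (\<integral>\<^sup>+i. ennreal (2 powi i) * indicator (range ?h) i \<partial>count_space UNIV)"
    using range le by (intro nn_integral_mono) (auto simp: indicator_def)
  also have "\<dots> = (\<integral>\<^sup>+i. ennreal (2 powi i) \<partial>count_space (range ?h))"
    by (simp add: nn_integral_count_space_indicator)
  also have "\<dots> = (\<integral>\<^sup>+j. ennreal (2 powi (n - int j)) \<partial>count_space UNIV)"
    by (rule nn_integral_bij_count_space[symmetric]) (auto simp: bij_betw_def inj_def)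
  also have "\<dots> = (\<integral>\<^sup>+j. ennreal (2 powi n) * ennreal ((1/2) ^ j) \<partial>count_space UNIV)"
    by (intro nn_integral_cong) (simp add: ennreal_mult[symmetric] power_int_diff power_divide)
  also have "\<dots> = ennreal (2 powi n) * ennreal (1 / (1 - 1/2))"
    by (subst nn_integral_cmult) (simp_all only: nn_integral_geometric, auto)
  also have "\<dots> = ennreal (2 * 2 powi n)" by (subst ennreal_mult[symmetric]) auto
  also have "\<dots> \<le> ennreal (2 * X)" using n by (intro ennreal_leI) auto
  finally show ?thesis .
qed

lemma emeasure_density_mult_le:
  assumes [measurable]: "u \<in> borel_measurable lebesgue" "v \<in> borel_measurable lebesgue" "X \<in> sets lebesgue"
    and "\<And>x. x \<in> X \<Longrightarrow> v x \<le> t" "\<And>x. x \<in> X \<Longrightarrow> 0 \<le> u x" "0 \<le> t"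
  shows "emeasure (wmeas (\<lambda>x. u x * v x)) X \<le> ennreal t * emeasure (wmeas u) X"
proof -
  have "emeasure (wmeas (\<lambda>x. u x * v x)) X = (\<integral>\<^sup>+x\<in>X. ennreal (u x * v x) \<partial>lebesgue)"
    by (subst emeasure_density) auto
  also have "\<dots> \<le> (\<integral>\<^sup>+x. ennreal t * (ennreal (u x) * indicator X x) \<partial>lebesgue)"
  proof (intro nn_integral_mono)
    fix x
    show "ennreal (u x * v x) * indicator X x \<le> ennreal t * (ennreal (u x) * indicator X x)"
    proof (cases "x \<in> X")
      case True
      have "u x * v x \<le> t * u x" using mult_right_mono[OF assms(4,5)[OF True]] by (simp add: mult.commute)
      then have "ennreal (u x * v x) \<le> ennreal t * ennreal (u x)"
        using assms(5)[OF True] assms(6) by (simp add: ennreal_mult[symmetric] ennreal_leI)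
      with True show ?thesis by simp
    qed simp
  qed
  also have "\<dots> = ennreal t * (\<integral>\<^sup>+x\<in>X. ennreal (u x) \<partial>lebesgue)"
    by (rule nn_integral_cmult) measurable
  also have "(\<integral>\<^sup>+x\<in>X. ennreal (u x) \<partial>lebesgue) = emeasure (wmeas u) X"
    by (subst emeasure_density) auto
  finally show ?thesis .
qed

section \<open>The dyadic weak type estimate\<close>

text \<open>One ratio \<open>a\<close> serves for the stopping heights, for the sizes of the means
  of \<open>v\<close> and for both decay conditions, so that exponents add up. The share
  \<open>D / a\<close> in \<open>sparse\<close> is what stopping cells of larger height can
  occupy.\<close>

locale dyadic_weights = dyadic_family +
  fixes u v g :: "'a \<Rightarrow> real" and a \<beta> \<kappa> C\<^sub>1 :: real
  assumes meas: "u \<in> borel_measurable lebesgue" "v \<in> borel_measurable lebesgue" "g \<in> borel_measurable lebesgue"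
    and nonneg: "\<And>x. 0 \<le> u x" "\<And>x. 0 \<le> v x" "\<And>x. 0 \<le> g x"
    and fin: "\<And>I. I \<in> \<D> \<Longrightarrow> emeasure (wmeas u) I < \<infinity>" "\<And>I. I \<in> \<D> \<Longrightarrow> emeasure (wmeas v) I < \<infinity>"
      "\<And>I. I \<in> \<D> \<Longrightarrow> emeasure (wmeas g) I < \<infinity>"
    and pos: "\<And>I. I \<in> \<D> \<Longrightarrow> 0 < wvol u I" "\<And>I. I \<in> \<D> \<Longrightarrow> 0 < wvol v I"
    and A1: "\<And>I. I \<in> \<D> \<Longrightarrow> AE x in lebesgue. x \<in> I \<longrightarrow> wvol u I \<le> C\<^sub>1 * u x * vol I"
    and const: "1 < a" "D \<le> a" "0 < \<beta>" "\<beta> < 1" "0 < \<kappa>" "0 < C\<^sub>1"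
    and sparse: "\<And>I E. I \<in> \<D> \<Longrightarrow> E \<in> sets lebesgue \<Longrightarrow> E \<subseteq> I \<Longrightarrow> vol E \<le> D / a * vol I
      \<Longrightarrow> wvol v E \<le> (1 - \<kappa>) * wvol v I"
    and decay1: "\<And>I E n. I \<in> \<D> \<Longrightarrow> E \<in> sets lebesgue \<Longrightarrow> E \<subseteq> I \<Longrightarrow> a ^ n * vol E \<le> vol I
      \<Longrightarrow> wvol u E \<le> \<beta> ^ n * wvol u I"
    and decay2: "\<And>I E n. I \<in> \<D> \<Longrightarrow> E \<in> sets lebesgue \<Longrightarrow> E \<subseteq> I \<Longrightarrow> a ^ n * wvol v E \<le> wvol v I
      \<Longrightarrow> wvol u E \<le> \<beta> ^ n * wvol u I"
begin

section \<open>Stopping cells and the decomposition of the level set\<close>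

abbreviation "U \<equiv> wvol u"
abbreviation "V \<equiv> wvol v"
abbreviation "G \<equiv> wvol g"

text \<open>The last clause is maximality among the cells whose mean of \<open>g\<close> exceeds the
  height. The upper bound is what a parent provides, and since \<open>D \<le> a\<close> it pins down
  the height: a cell stops at one \<open>k\<close> at most.\<close>

definition stop :: "'a set \<Rightarrow> int \<Rightarrow> bool" where
  "stop J k \<longleftrightarrow> J \<in> \<D> \<and> a powi k * vol J < G J \<and> G J \<le> D * a powi k * vol J \<and>
     (\<forall>I\<in>\<D>. J \<subset> I \<longrightarrow> G I \<le> a powi k * vol I)"

definition shell :: "int \<Rightarrow> 'a set" where
  "shell k = {x. a powi k < v x \<and> v x \<le> a powi (k + 1)}"

text \<open>Besides its stopping height \<open>k\<close>, a stopping cube carries the size \<open>a^(k+l)\<close> of the mean of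
  \<open>v\<close> and the size \<open>2^i\<close> of the mean of \<open>u\<close>.\<close>
definition stop_class :: "int \<Rightarrow> int \<Rightarrow> 'a set set" where
  "stop_class l i = {J. \<exists>k. stop J k \<and> a powi (k + l) * vol J < V J \<and> V J \<le> a powi (k + l + 1) * vol J \<and>
     2 powi i * vol J < U J \<and> U J \<le> 2 powi (i + 1) * vol J}"

definition piece :: "'a set \<Rightarrow> 'a set" where
  "piece J = {x\<in>J. \<exists>k. stop J k \<and> x \<in> shell k}"

text \<open>For a cell without ancestors no parent bounds the mean of \<open>g\<close> from above,
  so no height is attached to it and \<open>v\<close> is compared with the mean itself.\<close>

definition top_piece :: "'a set \<Rightarrow> 'a set" where
  "top_piece J = {x\<in>J. v x * vol J \<le> a * G J}"

text \<open>The dyadic maximal function of \<open>g\<close> against the level \<open>v\<close>; the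
  number \<open>t\<close> of the weak type inequality is absorbed into \<open>g\<close>.\<close>

definition level_set :: "'a set" where
  "level_set = {x. 0 < v x \<and> (\<exists>I\<in>\<D>. x \<in> I \<and> v x * vol I < G I)}"

lemma eL: "I \<in> \<D> \<Longrightarrow> E \<subseteq> I \<Longrightarrow> emeasure lebesgue E = ennreal (vol E)"
  using emeasure_cell_eq[of lebesgue I E] emeasure_lebesgue_cell by auto
lemma eU: "I \<in> \<D> \<Longrightarrow> E \<subseteq> I \<Longrightarrow> emeasure (wmeas u) E = ennreal (U E)"
  using emeasure_cell_eq[of "wmeas u" I E] fin by auto
lemma eV: "I \<in> \<D> \<Longrightarrow> E \<subseteq> I \<Longrightarrow> emeasure (wmeas v) E = ennreal (V E)"
  using emeasure_cell_eq[of "wmeas v" I E] fin by auto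
lemma eG: "I \<in> \<D> \<Longrightarrow> E \<subseteq> I \<Longrightarrow> emeasure (wmeas g) E = ennreal (G E)"
  using emeasure_cell_eq[of "wmeas g" I E] fin by auto

lemma a_pos: "0 < a" using const by simp

lemma G_mono:
  assumes "I \<in> \<D>" "J \<in> \<D>" "J \<subseteq> I"
  shows "G J \<le> G I"
proof -
  have "emeasure (wmeas g) J \<le> emeasure (wmeas g) I"
    using assms cell_sets by (intro emeasure_mono) auto
  then show ?thesis using eG[of I I] eG[of J J] assms by simp
qed

lemma stop_cell: "stop J k \<Longrightarrow> J \<in> \<D>" by (simp add: stop_def)

lemma stop_class_cell: "stop_class l i \<subseteq> \<D>" by (auto simp: stop_class_def stop_def)

lemma stop_unique:
  assumes "stop J k" "stop J k'"
  shows "k = k'"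
proof -
  have le: "j \<le> j'" if "stop J j" "stop J j'" for j j'
  proof -
    have p: "0 < vol J" using that cell_pos stop_cell by blast
    have "a powi j * vol J < D * a powi j' * vol J" using that unfolding stop_def by linarith
    then have "a powi j < D * a powi j'" using p by simp
    also have "\<dots> \<le> a * a powi j'" using const a_pos by (intro mult_right_mono) auto
    also have "\<dots> = a powi (j' + 1)" using a_pos by (simp add: power_int_add)
    finally show ?thesis using power_int_less_cancel[OF const(1)] by fastforce
  qed
  show ?thesis using le[OF assms] le[OF assms(2,1)] by simp
qed

lemma shell_sets: "shell k \<in> sets lebesgue"
proof -
  have "{x\<in>space lebesgue. a powi k < v x \<and> v x \<le> a powi (k + 1)} \<in> sets lebesgue"
    using meas(2) by measurable
  then show ?thesis by (simp add: shell_def)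
qed

lemma piece_eq: "stop J k \<Longrightarrow> piece J = J \<inter> shell k"
  unfolding piece_def using stop_unique by blast

lemma piece_sets:
  assumes "J \<in> stop_class l i"
  shows "piece J \<in> sets lebesgue"
proof -
  obtain k where k: "stop J k" using assms by (auto simp: stop_class_def)
  show ?thesis unfolding piece_eq[OF k] using shell_sets cell_sets[OF stop_cell[OF k]] by auto
qed

lemma top_piece_sets:
  assumes "J \<in> \<D>"
  shows "top_piece J \<in> sets lebesgue"
proof -
  have "{x\<in>space lebesgue. v x * vol J \<le> a * G J} \<in> sets lebesgue" using meas(2) by measurable
  moreover have "top_piece J = J \<inter> {x\<in>space lebesgue. v x * vol J \<le> a * G J}" by (auto simp: top_piece_def)
  ultimately show ?thesis using cell_sets[OF assms] by auto
qed

lemma stop_in_class: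
  assumes "stop J k"
  shows "\<exists>l i. J \<in> stop_class l i"
proof -
  have J: "J \<in> \<D>" and p: "0 < vol J" using assms cell_pos stop_cell by blast+
  obtain n where n: "a powi n < V J / vol J" "V J / vol J \<le> a powi (n + 1)"
    using ex_power_int_between[OF const(1), of "V J / vol J"] pos(2)[OF J] p by auto
  obtain i where i: "2 powi i < U J / vol J" "U J / vol J \<le> 2 powi (i + 1)"
    using ex_power_int_between[of 2 "U J / vol J"] pos(1)[OF J] p by auto
  have "J \<in> stop_class (n - k) i"
    unfolding stop_class_def using assms n i p by (auto simp: field_simps intro!: exI[of _ k])
  then show ?thesis by blast
qed

lemma level_set_cover:
  "level_set \<subseteq> (\<Union>T\<in>maximal \<D>. top_piece T) \<union> (\<Union>(l, i)\<in>UNIV. \<Union>J\<in>stop_class l i. piece J)"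
proof
  fix x assume "x \<in> level_set"
  then obtain I where x: "0 < v x" "I \<in> \<D>" "x \<in> I" "v x * vol I < G I" by (auto simp: level_set_def)
  obtain k where k: "a powi k < v x" "v x \<le> a powi (k + 1)"
    using ex_power_int_between[OF const(1) x(1)] .
  \<comment> \<open>Only ancestors of \<open>I\<close> compete, but whatever lies above a maximal
    \<open>J\<close> is again an ancestor of \<open>I\<close>, so \<open>J\<close> is maximal among
    all cells whose mean exceeds the height.\<close>
  define S where "S = {J\<in>\<D>. I \<subseteq> J \<and> a powi k * vol J < G J}"
  have "a powi k * vol I < v x * vol I" using k(1) cell_pos[OF x(2)] by simp
  then have IS: "I \<in> S" using x by (auto simp: S_def)
  have S: "S \<subseteq> \<D>" by (auto simp: S_def)
  obtain J where J: "J \<in> maximal S" "I \<subseteq> J" using maximal_above[OF S IS] by blast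
  then have JS: "J \<in> S" and Jmax: "\<And>J'. J' \<in> S \<Longrightarrow> J \<subseteq> J' \<Longrightarrow> J' = J" unfolding maximal_def by auto
  have JD: "J \<in> \<D>" and Jk: "a powi k * vol J < G J" using JS by (auto simp: S_def)
  have xJ: "x \<in> J" using J x by blast
  have anc: "G I' \<le> a powi k * vol I'" if "I' \<in> \<D>" "J \<subset> I'" for I'
  proof (rule ccontr)
    assume "\<not> G I' \<le> a powi k * vol I'"
    then have "I' \<in> S" using that J by (auto simp: S_def)
    then show False using Jmax that by blast
  qed
  show "x \<in> (\<Union>T\<in>maximal \<D>. top_piece T) \<union> (\<Union>(l, i)\<in>UNIV. \<Union>J\<in>stop_class l i. piece J)"
  proof (cases "J \<in> maximal \<D>")
    case True
    have "v x * vol J \<le> a * (a powi k * vol J)"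
      using k(2) cell_pos[OF JD] a_pos by (simp add: power_int_add mult.commute mult.assoc)
    also have "\<dots> \<le> a * G J" using Jk a_pos by (intro mult_left_mono) auto
    finally have "x \<in> top_piece J" using xJ by (simp add: top_piece_def)
    with True show ?thesis by blast
  next
    case False
    then obtain I' where I': "I' \<in> \<D>" "J \<subset> I'" using JD unfolding maximal_def by blast
    \<comment> \<open>The parent lies strictly above \<open>J\<close>, so its mean of
      \<open>g\<close> is at most \<open>a powi k\<close>; passing down to \<open>J\<close> costs
      the factor \<open>D\<close>.\<close>
    obtain J' where J': "J' \<in> \<D>" "J \<subset> J'" "vol J' \<le> D * vol J"
      using parent[OF JD I'] by blast
    have "G J \<le> G J'" using J' JD by (intro G_mono) auto
    also have "\<dots> \<le> a powi k * vol J'" using J' by (intro anc)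
    also have "\<dots> \<le> a powi k * (D * vol J)" using J' a_pos by (intro mult_left_mono) auto
    finally have "stop J k" using JD Jk anc by (auto simp: stop_def mult_ac)
    moreover have "x \<in> shell k" using k by (simp add: shell_def)
    ultimately have "x \<in> piece J" using xJ by (auto simp: piece_def)
    moreover obtain l i where "J \<in> stop_class l i" using stop_in_class[OF \<open>stop J k\<close>] by blast
    ultimately show ?thesis by blast
  qed
qed

text \<open>Smaller stopping cells of every height and class are removed, which makes the cores of
  any two stopping cells disjoint.\<close>

definition core :: "'a set \<Rightarrow> 'a set" where
  "core J = J - \<Union>{J'. J' \<subset> J \<and> (\<exists>k. stop J' k)}"

lemma core_sets: "J \<in> \<D> \<Longrightarrow> core J \<in> sets lebesgue"
  unfolding core_def using cell_sets stop_cell by (intro sets.Diff Union_sets) auto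

text \<open>The stopping cubes are sparse with respect to \<open>v\<close>: the smaller stopping cubes in \<open>J\<close> cover a
  fraction at most \<open>D / a\<close> of \<open>J\<close> by the jump of the stopping height.\<close>
lemma V_core:
  assumes J: "stop J k"
  shows "\<kappa> * V J \<le> V (core J)"
proof -
  define S where "S = {J'. J' \<subset> J \<and> (\<exists>k. stop J' k)}"
  have S: "S \<subseteq> \<D>" using stop_cell by (auto simp: S_def)
  have JD: "J \<in> \<D>" using J by (rule stop_cell)
  have SJ: "\<Union>S \<subseteq> J" by (auto simp: S_def)
  have Ss: "\<Union>S \<in> sets lebesgue" by (rule Union_sets[OF S])
  have jump: "a powi (k + 1) * vol J' \<le> G J'" if "J' \<in> S" for J'
  proof -
    obtain k' where k': "stop J' k'" "J' \<subset> J" using \<open>J' \<in> S\<close> unfolding S_def by blast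
    then have p: "0 < vol J'" "J' \<in> \<D>" using cell_pos stop_cell by blast+
    \<comment> \<open>\<open>J\<close> lies strictly above the stopping cell \<open>J'\<close>, so
      its mean of \<open>g\<close> is at most \<open>a powi k'\<close>. As that mean also exceeds
      \<open>a powi k\<close>, the integer \<open>k'\<close> is at least
      \<open>k + 1\<close>.\<close>
    have "a powi k * vol J < a powi k' * vol J" using J k' JD unfolding stop_def by (meson less_le_trans)
    then have "a powi k < a powi k'" using cell_pos[OF JD] by simp
    then have "k + 1 \<le> k'" using power_int_less_cancel[OF const(1)] by fastforce
    then have "a powi (k + 1) \<le> a powi k'" using const(1) by (intro power_int_increasing) auto
    then have "a powi (k + 1) * vol J' \<le> a powi k' * vol J'" using p by (intro mult_right_mono) auto
    also have "\<dots> \<le> G J'" using k'(1) unfolding stop_def by simp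
    finally show ?thesis .
  qed
  have "ennreal (a powi (k + 1)) * emeasure lebesgue (\<Union>S)
      = (\<integral>\<^sup>+J'. ennreal (a powi (k + 1)) * emeasure lebesgue J' \<partial>count_space (maximal S))"
    by (subst nn_integral_cmult) (auto simp: emeasure_Union_maximal'[OF S])
  also have "\<dots> \<le> (\<integral>\<^sup>+J'. emeasure (wmeas g) J' \<partial>count_space (maximal S))"
  proof (intro nn_integral_mono)
    fix J' assume "J' \<in> space (count_space (maximal S))"
    then have J': "J' \<in> S" using maximal_subset by auto
    then have "J' \<in> \<D>" using S by blast
    then show "ennreal (a powi (k + 1)) * emeasure lebesgue J' \<le> emeasure (wmeas g) J'"
      using jump[OF J'] eL[of J' J'] eG[of J' J'] a_pos
      by (simp add: ennreal_mult[symmetric] ennreal_leI)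
  qed
  also have "\<dots> = emeasure (wmeas g) (\<Union>S)" by (rule emeasure_Union_maximal'[OF S, symmetric]) simp
  also have "\<dots> \<le> emeasure (wmeas g) J" using SJ cell_sets[OF JD] by (intro emeasure_mono) auto
  finally have "ennreal (a powi (k + 1) * vol (\<Union>S)) \<le> ennreal (G J)"
    using eL[OF JD SJ] eG[of J J] JD a_pos by (simp add: ennreal_mult[symmetric])
  then have "a powi (k + 1) * vol (\<Union>S) \<le> G J" by (simp add: ennreal_le_iff)
  also have "\<dots> \<le> D * a powi k * vol J" using J by (simp add: stop_def)
  finally have "a powi k * (a * vol (\<Union>S)) \<le> a powi k * (D * vol J)"
    using a_pos by (simp add: power_int_add mult_ac)
  then have "a * vol (\<Union>S) \<le> D * vol J" using a_pos by simp
  then have "vol (\<Union>S) \<le> D / a * vol J" using a_pos by (simp add: field_simps)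
  then have "V (\<Union>S) \<le> (1 - \<kappa>) * V J" by (rule sparse[OF JD Ss SJ])
  moreover have "V (J - \<Union>S) = V J - V (\<Union>S)"
    using Ss SJ cell_sets[OF JD] fin(2)[OF JD] by (intro measure_Diff) auto
  ultimately show ?thesis unfolding core_def S_def[symmetric] by (simp add: algebra_simps)
qed

lemma core_disjoint: "disjoint_family_on core (stop_class l i)"
  unfolding disjoint_family_on_def
proof (intro ballI impI)
  fix J J' assume J: "J \<in> stop_class l i" "J' \<in> stop_class l i" "J \<noteq> J'"
  then obtain k k' where k: "stop J k" "stop J' k'" unfolding stop_class_def by blast
  consider "J \<inter> J' = {}" | "J \<subset> J'" | "J' \<subset> J"
    using nested[OF stop_cell[OF k(1)] stop_cell[OF k(2)]] J(3) by blast
  then show "core J \<inter> core J' = {}"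
    by cases (use k in \<open>auto simp: core_def\<close>)
qed

text \<open>The disjoint cores reduce the sum to the measure of the union, which is split again over
  the maximal cells. On each of these the height cancels between
  \<open>V J \<le> a powi (k + l + 1) * vol J\<close> and \<open>a powi k * vol J < G J\<close>. The
  set \<open>\<Union>F\<close> is kept on the right for the later sum over \<open>i\<close>.\<close>

lemma V_packing:
  assumes F: "F = stop_class l i"
  shows "(\<integral>\<^sup>+J. emeasure (wmeas v) J \<partial>count_space F) \<le> ennreal (a powi (l + 1) / \<kappa>) * emeasure (wmeas g) (\<Union>F)"
proof -
  have FD: "F \<subseteq> \<D>" unfolding F by (rule stop_class_cell)
  then have cF: "countable F" using countable_family countable_subset by blast
  have "(\<integral>\<^sup>+J. emeasure (wmeas v) J \<partial>count_space F) \<le>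
      (\<integral>\<^sup>+J. ennreal (1 / \<kappa>) * emeasure (wmeas v) (core J) \<partial>count_space F)"
  proof (intro nn_integral_mono)
    fix J assume "J \<in> space (count_space F)"
    then obtain k where k: "stop J k" using F unfolding stop_class_def by auto
    have "V J \<le> 1 / \<kappa> * V (core J)" using V_core[OF k] const by (simp add: field_simps)
    moreover have "core J \<subseteq> J" by (auto simp: core_def)
    ultimately show "emeasure (wmeas v) J \<le> ennreal (1 / \<kappa>) * emeasure (wmeas v) (core J)"
      using eV[OF stop_cell[OF k], of J] eV[OF stop_cell[OF k], of "core J"] const
      by (simp add: ennreal_mult[symmetric] ennreal_leI)
  qed
  also have "\<dots> = ennreal (1 / \<kappa>) * (\<integral>\<^sup>+J. emeasure (wmeas v) (core J) \<partial>count_space F)"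
    by (rule nn_integral_cmult) simp
  also have "(\<integral>\<^sup>+J. emeasure (wmeas v) (core J) \<partial>count_space F) = emeasure (wmeas v) (\<Union>J\<in>F. core J)"
    using core_disjoint F FD cF by (intro emeasure_UN_countable[symmetric]) (auto intro: core_sets)
  also have "\<dots> \<le> emeasure (wmeas v) (\<Union>F)"
    using Union_sets[OF FD] by (intro emeasure_mono) (auto simp: core_def)
  also have "\<dots> = (\<integral>\<^sup>+J. emeasure (wmeas v) J \<partial>count_space (maximal F))"
    by (rule emeasure_Union_maximal'[OF FD]) simp
  also have "\<dots> \<le> (\<integral>\<^sup>+J. ennreal (a powi (l + 1)) * emeasure (wmeas g) J \<partial>count_space (maximal F))"
  proof (intro nn_integral_mono)
    fix J assume "J \<in> space (count_space (maximal F))"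
    then have "J \<in> F" using maximal_subset by auto
    then obtain k where k: "stop J k" "V J \<le> a powi (k + l + 1) * vol J" using F unfolding stop_class_def by auto
    note k(2)
    also have "a powi (k + l + 1) * vol J = a powi (l + 1) * (a powi k * vol J)"
      using a_pos by (simp add: power_int_add)
    also have "\<dots> \<le> a powi (l + 1) * G J" using k(1) a_pos by (intro mult_left_mono) (auto simp: stop_def)
    finally show "emeasure (wmeas v) J \<le> ennreal (a powi (l + 1)) * emeasure (wmeas g) J"
      using eV[OF stop_cell[OF k(1)], of J] eG[OF stop_cell[OF k(1)], of J] a_pos
      by (simp add: ennreal_mult[symmetric] ennreal_leI)
  qed
  also have "\<dots> = ennreal (a powi (l + 1)) * emeasure (wmeas g) (\<Union>F)"
    by (subst nn_integral_cmult) (auto simp: emeasure_Union_maximal'[OF FD])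
  also have "ennreal (1 / \<kappa>) * (ennreal (a powi (l + 1)) * emeasure (wmeas g) (\<Union>F))
      = ennreal (a powi (l + 1) / \<kappa>) * emeasure (wmeas g) (\<Union>F)"
    using const a_pos by (simp add: mult.assoc[symmetric] ennreal_mult[symmetric])
  finally show ?thesis by (simp add: mult_left_mono)
qed

text \<open>One power of \<open>a\<close> is lost, to the upper end of the shell for positive
  \<open>l\<close> and to the upper end of the class for negative \<open>l\<close>; hence the
  exponent \<open>nat \<bar>l\<bar> - 1\<close>.\<close>

lemma U_piece:
  assumes k: "stop J k" and VJ: "a powi (k + l) * vol J < V J" "V J \<le> a powi (k + l + 1) * vol J"
  shows "U (piece J) \<le> \<beta> ^ (nat \<bar>l\<bar> - 1) * U J"
proof -
  have JD: "J \<in> \<D>" using k by (rule stop_cell)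
  let ?P = "piece J"
  have P: "?P \<in> sets lebesgue" "?P \<subseteq> J" and PE: "?P = J \<inter> shell k"
    using piece_eq[OF k] shell_sets cell_sets[OF JD] by auto
  have eP: "emeasure lebesgue ?P = ennreal (vol ?P)" "emeasure (wmeas v) ?P = ennreal (V ?P)"
    using eL[OF JD P(2)] eV[OF JD P(2)] by auto
  have lower: "a powi k * vol ?P \<le> V ?P"
  proof -
    have "ennreal (a powi k) * emeasure lebesgue ?P \<le> emeasure (wmeas v) ?P"
      using meas P by (intro emeasure_wmeas_ge) (auto simp: PE shell_def)
    then show ?thesis using eP a_pos by (simp add: ennreal_mult[symmetric])
  qed
  have upper: "V ?P \<le> a powi (k + 1) * vol ?P"
  proof -
    have "emeasure (wmeas (\<lambda>x. 1 * v x)) ?P \<le> ennreal (a powi (k + 1)) * emeasure (wmeas (\<lambda>_. 1)) ?P"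
      using meas P a_pos by (intro emeasure_density_mult_le) (auto simp: PE shell_def)
    also have "emeasure (wmeas (\<lambda>_. 1)) ?P = emeasure lebesgue ?P" by (simp add: density_1)
    finally show ?thesis using eP a_pos by (simp add: ennreal_mult[symmetric])
  qed
  have VP: "V ?P \<le> V J"
  proof -
    have "emeasure (wmeas v) ?P \<le> emeasure (wmeas v) J" using P cell_sets[OF JD] by (intro emeasure_mono) auto
    then show ?thesis using eP eV[OF JD, of J] by simp
  qed
  have mP: "vol ?P \<le> vol J"
  proof -
    have "emeasure lebesgue ?P \<le> emeasure lebesgue J" using P cell_sets[OF JD] by (intro emeasure_mono) auto
    then show ?thesis using eP eL[OF JD, of J] by simp
  qed
  define n where "n = nat \<bar>l\<bar> - 1"
  show ?thesis
  proof (cases "0 \<le> l")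
    case True
    \<comment> \<open>For large \<open>l\<close> the values of \<open>v\<close> on the piece are far
      below its mean over \<open>J\<close>, so the piece has a small share of the
      \<open>v\<close>-measure, and \<open>decay2\<close> converts this to \<open>u\<close>.\<close>
    have "a ^ n * V ?P \<le> V J"
    proof (cases "l = 0")
      case True
      then show ?thesis using VP by (simp add: n_def)
    next
      case False
      then have n: "int n = l - 1" using True by (simp add: n_def)
      have "a ^ n * V ?P \<le> a ^ n * (a powi (k + 1) * vol J)"
        using upper mP a_pos by (intro mult_left_mono order_trans[OF upper] mult_left_mono) auto
      also have "\<dots> = a powi (int n + (k + 1)) * vol J" using a_pos by (subst power_int_add) auto
      also have "int n + (k + 1) = k + l" using n by simp
      also have "a powi (k + l) * vol J \<le> V J" using VJ by simp
      finally show ?thesis .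
    qed
    then show ?thesis unfolding n_def[symmetric] by (rule decay2[OF JD P])
  next
    case False
    then have n: "int n = - l - 1" by (simp add: n_def)
    \<comment> \<open>Chebyshev: on the piece \<open>v\<close> exceeds its mean over
      \<open>J\<close>, so the piece has small volume and \<open>decay1\<close> applies.\<close>
    have "a powi k * (a ^ n * vol ?P) = a ^ n * (a powi k * vol ?P)" by simp
    also have "\<dots> \<le> a ^ n * (a powi (k + l + 1) * vol J)"
      using lower VP VJ a_pos by (intro mult_left_mono) auto
    also have "\<dots> = a powi (int n + (k + l + 1)) * vol J" using a_pos by (subst power_int_add) auto
    also have "int n + (k + l + 1) = k" using n by simp
    finally have "a ^ n * vol ?P \<le> vol J" using a_pos by simp
    then show ?thesis unfolding n_def[symmetric] by (rule decay1[OF JD P])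
  qed
qed

section \<open>Estimates for the measure with density \<open>u * v\<close>\<close>

abbreviation "UV \<equiv> wmeas (\<lambda>x. u x * v x)"

lemma UV_class:
  "emeasure UV (\<Union>J\<in>stop_class l i. piece J) \<le>
    ennreal (2 * a\<^sup>2 / \<kappa> * \<beta> ^ (nat \<bar>l\<bar> - 1)) * (ennreal (2 powi i) * emeasure (wmeas g) (\<Union>(stop_class l i)))"
proof -
  define F where "F = stop_class l i"
  have FD: "F \<subseteq> \<D>" unfolding F_def by (rule stop_class_cell)
  then have cF: "countable F" using countable_family countable_subset by blast
  define b where "b = \<beta> ^ (nat \<bar>l\<bar> - 1)"
  have b: "0 \<le> b" using const by (simp add: b_def)
  \<comment> \<open>Collects the bound \<open>a powi (k + 1)\<close> for \<open>v\<close> on the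
    piece, the decay \<open>b\<close>, the bound \<open>2 powi (i + 1)\<close> for the mean of
    \<open>u\<close> and the lower bound \<open>a powi (k + l)\<close> for the mean of
    \<open>v\<close>. The height \<open>k\<close> cancels, which lets all heights be summed at
    once.\<close>
  define t where "t = a powi (1 - l) * b * 2 powi (i + 1)"
  have t: "0 \<le> t" using a_pos b by (simp add: t_def)
  have "emeasure UV (\<Union>J\<in>F. piece J) \<le> (\<integral>\<^sup>+J. emeasure UV (piece J) \<partial>count_space F)"
    using piece_sets by (intro emeasure_UN_le_count_space cF) (auto simp: F_def)
  also have "\<dots> \<le> (\<integral>\<^sup>+J. ennreal t * emeasure (wmeas v) J \<partial>count_space F)"
  proof (intro nn_integral_mono)
    fix J assume "J \<in> space (count_space F)"
    then obtain k where k: "stop J k" and VJ: "a powi (k + l) * vol J < V J" "V J \<le> a powi (k + l + 1) * vol J"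
      and UJ: "U J \<le> 2 powi (i + 1) * vol J" and JF: "J \<in> stop_class l i"
      using F_def unfolding stop_class_def by auto
    have JD: "J \<in> \<D>" using k by (rule stop_cell)
    have PJ: "piece J \<subseteq> J" by (auto simp: piece_def)
    have "emeasure UV (piece J) \<le> ennreal (a powi (k + 1)) * emeasure (wmeas u) (piece J)"
      using meas piece_sets[OF JF] nonneg a_pos piece_eq[OF k]
      by (intro emeasure_density_mult_le) (auto simp: shell_def)
    also have "\<dots> = ennreal (a powi (k + 1) * U (piece J))"
      using eU[OF JD PJ] a_pos by (simp add: ennreal_mult)
    also have "\<dots> \<le> ennreal (t * V J)"
    proof (rule ennreal_leI)
      have "a powi (k + 1) * U (piece J) \<le> a powi (k + 1) * (b * (2 powi (i + 1) * vol J))"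
        using mult_left_mono[OF UJ b] U_piece[OF k VJ] a_pos unfolding b_def[symmetric]
        by (intro mult_left_mono) auto
      also have "\<dots> = t * (a powi (k + l) * vol J)"
      proof -
        have "a powi (k + 1) = a powi (1 - l) * a powi (k + l)"
          using a_pos by (subst power_int_add[symmetric]) (auto simp: algebra_simps)
        then show ?thesis by (simp add: t_def)
      qed
      also have "\<dots> \<le> t * V J" using VJ t by (intro mult_left_mono) auto
      finally show "a powi (k + 1) * U (piece J) \<le> t * V J" .
    qed
    also have "\<dots> = ennreal t * emeasure (wmeas v) J" using eV[OF JD, of J] t by (simp add: ennreal_mult)
    finally show "emeasure UV (piece J) \<le> ennreal t * emeasure (wmeas v) J" .
  qed
  also have "\<dots> = ennreal t * (\<integral>\<^sup>+J. emeasure (wmeas v) J \<partial>count_space F)"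
    by (rule nn_integral_cmult) simp
  also have "\<dots> \<le> ennreal t * (ennreal (a powi (l + 1) / \<kappa>) * emeasure (wmeas g) (\<Union>F))"
    by (intro mult_left_mono V_packing[OF F_def]) simp
  also have "\<dots> = ennreal (t * (a powi (l + 1) / \<kappa>)) * emeasure (wmeas g) (\<Union>F)"
    using t const a_pos by (simp add: mult.assoc[symmetric] ennreal_mult[symmetric])
  \<comment> \<open>The powers of \<open>a\<close> from the pieces and from the packing combine to
    the square of \<open>a\<close>, so \<open>l\<close> survives only in \<open>b\<close>.\<close>
  also have "t * (a powi (l + 1) / \<kappa>) = (2 * a\<^sup>2 / \<kappa> * b) * 2 powi i"
  proof -
    have "a powi (1 - l) * a powi (l + 1) = a powi 2"
      using a_pos by (subst power_int_add[symmetric]) auto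
    then have "a powi (1 - l) * a powi (l + 1) = a\<^sup>2" by simp
    then show ?thesis by (simp add: t_def power_int_add mult_ac)
  qed
  also have "ennreal ((2 * a\<^sup>2 / \<kappa> * b) * 2 powi i) = ennreal (2 * a\<^sup>2 / \<kappa> * b) * ennreal (2 powi i)"
    using b const a_pos by (intro ennreal_mult) auto
  finally show ?thesis unfolding F_def[symmetric] b_def[symmetric] by (simp only: mult.assoc)
qed

lemma AE_A1: "AE x in lebesgue. \<forall>I\<in>\<D>. x \<in> I \<longrightarrow> U I \<le> C\<^sub>1 * u x * vol I"
  using A1 countable_family by (subst AE_ball_countable) auto

text \<open>Sum and integral are exchanged. A class contributes at \<open>x\<close> only if
  \<open>x\<close> lies in one of its cells, and then A_1 puts \<open>2 powi i\<close> below
  \<open>C\<^sub>1 * u x\<close>. As the cells are countable, one null set serves for all of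
  them.\<close>

lemma sum_over_i:
  "(\<integral>\<^sup>+i. ennreal (2 powi i) * emeasure (wmeas g) (\<Union>(stop_class l i)) \<partial>count_space UNIV)
    \<le> ennreal (2 * C\<^sub>1) * (\<integral>\<^sup>+x. ennreal (g x * u x) \<partial>lebesgue)"
proof -
  note [measurable] = meas
  have S[measurable]: "\<Union>(stop_class l i) \<in> sets lebesgue" for i by (rule Union_sets[OF stop_class_cell])
  let ?f = "\<lambda>i x. ennreal (2 powi i) * (ennreal (g x) * indicator (\<Union>(stop_class l i)) x)"
  have "(\<integral>\<^sup>+i. ennreal (2 powi i) * emeasure (wmeas g) (\<Union>(stop_class l i)) \<partial>count_space UNIV)
      = (\<integral>\<^sup>+i. \<integral>\<^sup>+x. ?f i x \<partial>lebesgue \<partial>count_space UNIV)"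
  proof (intro nn_integral_cong)
    fix i :: int
    have "(\<integral>\<^sup>+x. ?f i x \<partial>lebesgue) = ennreal (2 powi i) * (\<integral>\<^sup>+x. ennreal (g x) * indicator (\<Union>(stop_class l i)) x \<partial>lebesgue)"
      by (rule nn_integral_cmult) measurable
    then show "ennreal (2 powi i) * emeasure (wmeas g) (\<Union>(stop_class l i)) = (\<integral>\<^sup>+x. ?f i x \<partial>lebesgue)"
      by (subst emeasure_density) auto
  qed
  also have "\<dots> = (\<integral>\<^sup>+x. \<integral>\<^sup>+i. ?f i x \<partial>count_space UNIV \<partial>lebesgue)"
    by (rule nn_integral_count_space_nn_integral[symmetric]) (simp, measurable)
  also have "\<dots> \<le> (\<integral>\<^sup>+x. ennreal (2 * C\<^sub>1) * ennreal (g x * u x) \<partial>lebesgue)"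
  proof (rule nn_integral_mono_AE)
    show "AE x in lebesgue. (\<integral>\<^sup>+i. ?f i x \<partial>count_space UNIV) \<le> ennreal (2 * C\<^sub>1) * ennreal (g x * u x)"
      using AE_A1
    proof eventually_elim
      case (elim x)
      have X: "0 \<le> C\<^sub>1 * u x" using const nonneg by simp
      have "?f i x \<le> ennreal (g x) * (if 2 powi i \<le> C\<^sub>1 * u x then ennreal (2 powi i) else 0)" for i
      proof (cases "x \<in> \<Union>(stop_class l i)")
        case True
        then obtain J where J: "x \<in> J" "J \<in> stop_class l i" by blast
        then have JD: "J \<in> \<D>" using stop_class_cell by blast
        have "2 powi i * vol J < U J" using J unfolding stop_class_def by auto
        also have "\<dots> \<le> C\<^sub>1 * u x * vol J" using elim JD J by blast
        finally have "2 powi i \<le> C\<^sub>1 * u x" using cell_pos[OF JD] by simp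
        then show ?thesis by (simp add: mult.commute mult.left_commute indicator_def)
      qed simp
      then have "(\<integral>\<^sup>+i. ?f i x \<partial>count_space UNIV) \<le>
          (\<integral>\<^sup>+i. ennreal (g x) * (if 2 powi i \<le> C\<^sub>1 * u x then ennreal (2 powi i) else 0) \<partial>count_space UNIV)"
        by (intro nn_integral_mono)
      also have "\<dots> = ennreal (g x) * (\<integral>\<^sup>+i. (if 2 powi i \<le> C\<^sub>1 * u x then ennreal (2 powi i) else 0) \<partial>count_space UNIV)"
        by (rule nn_integral_cmult) simp
      also have "\<dots> \<le> ennreal (g x) * ennreal (2 * (C\<^sub>1 * u x))"
        by (intro mult_left_mono nn_integral_dyadic_below X) simp
      also have "\<dots> = ennreal (2 * C\<^sub>1) * ennreal (g x * u x)"
        using const nonneg X by (simp add: ennreal_mult[symmetric] mult_ac)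
      finally show ?case .
    qed
  qed
  also have "\<dots> = ennreal (2 * C\<^sub>1) * (\<integral>\<^sup>+x. ennreal (g x * u x) \<partial>lebesgue)"
    by (rule nn_integral_cmult) measurable
  finally show ?thesis .
qed

text \<open>The maximal cells of the whole family are disjoint, so their contributions add up
  without any decay: \<open>v\<close> is at most \<open>a\<close> times the mean of
  \<open>g\<close>, and A_1 moves the mean of \<open>u\<close> under the integral of
  \<open>g\<close>.\<close>

lemma UV_top:
  "emeasure UV (\<Union>T\<in>maximal \<D>. top_piece T) \<le> ennreal (a * C\<^sub>1) * (\<integral>\<^sup>+x. ennreal (g x * u x) \<partial>lebesgue)"
proof -
  note [measurable] = meas
  have MD: "maximal \<D> \<subseteq> \<D>" by (rule maximal_subset)
  then have cM: "countable (maximal \<D>)" using countable_family countable_subset by blast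
  have gu: "(\<integral>\<^sup>+x. ennreal (g x * u x) * indicator X x \<partial>lebesgue) = emeasure (wmeas (\<lambda>x. g x * u x)) X"
    if "X \<in> sets lebesgue" for X
    using that by (subst emeasure_density) auto
  have "emeasure UV (\<Union>T\<in>maximal \<D>. top_piece T) \<le> (\<integral>\<^sup>+T. emeasure UV (top_piece T) \<partial>count_space (maximal \<D>))"
    using MD top_piece_sets by (intro emeasure_UN_le_count_space cM) auto
  also have "\<dots> \<le> (\<integral>\<^sup>+T. ennreal (a * C\<^sub>1) * emeasure (wmeas (\<lambda>x. g x * u x)) T \<partial>count_space (maximal \<D>))"
  proof (intro nn_integral_mono)
    fix T assume "T \<in> space (count_space (maximal \<D>))"
    then have T: "T \<in> \<D>" using MD by auto
    then have p: "0 < vol T" and Ts[measurable]: "T \<in> sets lebesgue" using cell_pos cell_sets by auto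
    have sub: "top_piece T \<subseteq> T" by (auto simp: top_piece_def)
    have "emeasure UV (top_piece T) \<le> ennreal (a * G T / vol T) * emeasure (wmeas u) (top_piece T)"
      using meas top_piece_sets[OF T] nonneg a_pos p
      by (intro emeasure_density_mult_le) (auto simp: top_piece_def field_simps)
    also have "\<dots> \<le> ennreal (a * G T / vol T) * emeasure (wmeas u) T"
      using sub Ts by (intro mult_left_mono emeasure_mono) auto
    also have "\<dots> = ennreal (a * (U T / vol T)) * emeasure (wmeas g) T"
      using eU[OF T, of T] eG[OF T, of T] p a_pos by (simp add: ennreal_mult[symmetric] mult_ac)
    also have "emeasure (wmeas g) T = (\<integral>\<^sup>+x\<in>T. ennreal (g x) \<partial>lebesgue)"
      by (subst emeasure_density) auto
    also have "ennreal (a * (U T / vol T)) * (\<integral>\<^sup>+x\<in>T. ennreal (g x) \<partial>lebesgue)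
        = (\<integral>\<^sup>+x. ennreal (a * (U T / vol T)) * (ennreal (g x) * indicator T x) \<partial>lebesgue)"
      by (rule nn_integral_cmult[symmetric]) measurable
    also have "\<dots> \<le> (\<integral>\<^sup>+x. ennreal (a * C\<^sub>1) * (ennreal (g x * u x) * indicator T x) \<partial>lebesgue)"
    proof (rule nn_integral_mono_AE)
      show "AE x in lebesgue. ennreal (a * (U T / vol T)) * (ennreal (g x) * indicator T x)
          \<le> ennreal (a * C\<^sub>1) * (ennreal (g x * u x) * indicator T x)"
        using A1[OF T]
      proof eventually_elim
        case (elim x)
        show ?case
        proof (cases "x \<in> T")
          case True
          then have "U T / vol T \<le> C\<^sub>1 * u x" using elim p by (simp add: field_simps)
          then have "a * (U T / vol T) * g x \<le> a * (C\<^sub>1 * u x) * g x"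
            using a_pos nonneg by (intro mult_right_mono mult_left_mono) auto
          then have "ennreal (a * (U T / vol T) * g x) \<le> ennreal (a * C\<^sub>1 * (g x * u x))"
            by (intro ennreal_leI) (simp add: mult_ac)
          then have "ennreal (a * (U T / vol T)) * ennreal (g x) \<le> ennreal (a * C\<^sub>1) * ennreal (g x * u x)"
            using a_pos const nonneg p by (subst (1 2) ennreal_mult[symmetric]) auto
          with True show ?thesis by simp
        qed simp
      qed
    qed
    also have "\<dots> = ennreal (a * C\<^sub>1) * (\<integral>\<^sup>+x\<in>T. ennreal (g x * u x) \<partial>lebesgue)"
      by (rule nn_integral_cmult) measurable
    finally show "emeasure UV (top_piece T) \<le> ennreal (a * C\<^sub>1) * emeasure (wmeas (\<lambda>x. g x * u x)) T"
      using gu[OF Ts] by simp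
  qed
  also have "\<dots> = ennreal (a * C\<^sub>1) * emeasure (wmeas (\<lambda>x. g x * u x)) (\<Union>\<D>)"
    by (subst nn_integral_cmult) (auto simp: emeasure_Union_maximal'[of \<D>])
  also have "emeasure (wmeas (\<lambda>x. g x * u x)) (\<Union>\<D>) \<le> (\<integral>\<^sup>+x. ennreal (g x * u x) \<partial>lebesgue)"
    unfolding gu[OF Union_sets[OF order_refl], symmetric]
    by (intro nn_integral_mono) (auto simp: indicator_def)
  finally show ?thesis by (simp add: mult_left_mono)
qed

lemma weak_type:
  "(\<integral>\<^sup>+x\<in>level_set. ennreal (u x * v x) \<partial>lebesgue) \<le>
    ennreal (a * C\<^sub>1 + 2 * a\<^sup>2 / \<kappa> * (2 * (1 + 1 / (1 - \<beta>))) * (2 * C\<^sub>1)) * (\<integral>\<^sup>+x. ennreal (g x * u x) \<partial>lebesgue)"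
proof -
  note [measurable] = meas
  define R where "R = (\<integral>\<^sup>+x. ennreal (g x * u x) \<partial>lebesgue)"
  define K where "K = 2 * a\<^sup>2 / \<kappa>"
  have K: "0 \<le> K" using const by (simp add: K_def)
  define L where "L = 2 * (1 + 1 / (1 - \<beta>))"
  have L: "0 \<le> L" using const by (simp add: L_def)
  let ?T = "\<Union>T\<in>maximal \<D>. top_piece T"
  let ?P = "\<lambda>p. \<Union>J\<in>stop_class (fst p) (snd p). piece J"
  let ?S = "\<Union>p\<in>UNIV. ?P p"
  have P: "?P p \<in> sets lebesgue" for p
    by (intro sets.countable_UN' countable_subset[OF stop_class_cell countable_family]) (auto intro: piece_sets)
  have T: "?T \<in> sets lebesgue"
    by (intro sets.countable_UN' countable_subset[OF maximal_subset countable_family])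
      (use maximal_subset top_piece_sets in blast)
  have S: "?S \<in> sets lebesgue" by (rule sets.countable_UN''[OF _ P]) simp
  \<comment> \<open>The level set is enlarged to a measurable union before measures of pieces are
    used.\<close>
  have "level_set \<subseteq> ?T \<union> ?S" using level_set_cover by (simp add: case_prod_beta)
  then have "(\<integral>\<^sup>+x\<in>level_set. ennreal (u x * v x) \<partial>lebesgue) \<le> (\<integral>\<^sup>+x\<in>?T \<union> ?S. ennreal (u x * v x) \<partial>lebesgue)"
    by (intro nn_integral_mono) (auto simp: indicator_def)
  also have "\<dots> = emeasure UV (?T \<union> ?S)" using S T by (subst emeasure_density) auto
  also have "\<dots> \<le> emeasure UV ?T + emeasure UV ?S" using S T by (intro emeasure_subadditive) auto
  also have "emeasure UV ?T \<le> ennreal (a * C\<^sub>1) * R" unfolding R_def by (rule UV_top)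
  also have "emeasure UV ?S \<le> (\<integral>\<^sup>+p. emeasure UV (?P p) \<partial>count_space UNIV)"
    using P by (intro emeasure_UN_le_count_space) auto
  also have "\<dots> \<le> (\<integral>\<^sup>+p. ennreal (K * \<beta> ^ (nat \<bar>fst p\<bar> - 1)) *
      (ennreal (2 powi (snd p)) * emeasure (wmeas g) (\<Union>(stop_class (fst p) (snd p)))) \<partial>count_space UNIV)"
    unfolding K_def by (intro nn_integral_mono UV_class)
  also have "\<dots> = (\<integral>\<^sup>+l. \<integral>\<^sup>+i. ennreal (K * \<beta> ^ (nat \<bar>l\<bar> - 1)) *
      (ennreal (2 powi i) * emeasure (wmeas g) (\<Union>(stop_class l i))) \<partial>count_space UNIV \<partial>count_space UNIV)"
    by (subst nn_integral_fst_count_space[symmetric]) simp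
  also have "\<dots> = (\<integral>\<^sup>+l. ennreal (K * \<beta> ^ (nat \<bar>l\<bar> - 1)) * (\<integral>\<^sup>+i.
      (ennreal (2 powi i) * emeasure (wmeas g) (\<Union>(stop_class l i))) \<partial>count_space UNIV) \<partial>count_space UNIV)"
    by (intro nn_integral_cong nn_integral_cmult) simp
  also have "\<dots> \<le> (\<integral>\<^sup>+l. ennreal (K * \<beta> ^ (nat \<bar>l\<bar> - 1)) * (ennreal (2 * C\<^sub>1) * R) \<partial>count_space UNIV)"
    unfolding R_def by (intro nn_integral_mono mult_left_mono sum_over_i) simp
  also have "\<dots> = (\<integral>\<^sup>+l. (ennreal K * (ennreal (2 * C\<^sub>1) * R)) * ennreal (\<beta> ^ (nat \<bar>l\<bar> - 1)) \<partial>count_space UNIV)"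
    using K const by (intro nn_integral_cong) (simp add: ennreal_mult mult_ac)
  also have "\<dots> = (ennreal K * (ennreal (2 * C\<^sub>1) * R)) * (\<integral>\<^sup>+l. ennreal (\<beta> ^ (nat \<bar>l\<bar> - 1)) \<partial>count_space UNIV)"
    by (rule nn_integral_cmult) simp
  also have "\<dots> \<le> (ennreal K * (ennreal (2 * C\<^sub>1) * R)) * ennreal L"
    unfolding L_def using const by (intro mult_left_mono nn_integral_int_abs_decay) auto
  also have "\<dots> = ennreal (K * L * (2 * C\<^sub>1)) * R"
    using K L const by (simp add: ennreal_mult mult_ac)
  also have "ennreal (a * C\<^sub>1) * R + \<dots> = ennreal (a * C\<^sub>1 + K * L * (2 * C\<^sub>1)) * R"
    using K L const a_pos by (subst ennreal_plus) (auto simp: distrib_right)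
  finally show ?thesis unfolding R_def K_def L_def by (simp add: add_mono)
qed

end

section \<open>Choice of the constants\<close>

context dyadic_family
begin

text \<open>The constant is fixed before \<open>g\<close>: all thresholds come from the two weights,
  \<open>D\<close> and \<open>C\<^sub>1\<close>.\<close>

theorem mixed_weak_type:
  assumes u: "local_Ainf u" "\<And>x. 0 \<le> u x" and v: "local_Ainf v" "\<And>x. 0 \<le> v x"
    and A1: "0 < C\<^sub>1" "\<And>I. I \<in> \<D> \<Longrightarrow> AE x in lebesgue. x \<in> I \<longrightarrow> wvol u I \<le> C\<^sub>1 * u x * vol I"
  obtains C where "0 < C" "\<And>g. g \<in> borel_measurable lebesgue \<Longrightarrow> (\<And>x. 0 \<le> g x) \<Longrightarrow>
      (\<And>I. I \<in> \<D> \<Longrightarrow> emeasure (wmeas g) I < \<infinity>) \<Longrightarrow>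
      (\<integral>\<^sup>+x\<in>{x. 0 < v x \<and> (\<exists>I\<in>\<D>. x \<in> I \<and> v x * vol I < wvol g I)}.
        ennreal (u x * v x) \<partial>lebesgue) \<le> ennreal C * (\<integral>\<^sup>+x. ennreal (g x * u x) \<partial>lebesgue)"
proof -
  have meas: "u \<in> borel_measurable lebesgue" "v \<in> borel_measurable lebesgue"
    and ae: "AE x in lebesgue. 0 < u x" "AE x in lebesgue. 0 < v x"
    and fin: "\<And>I. I \<in> \<D> \<Longrightarrow> emeasure (wmeas u) I < \<infinity>" "\<And>I. I \<in> \<D> \<Longrightarrow> emeasure (wmeas v) I < \<infinity>"
    using u(1) v(1) unfolding local_Ainf_def by auto
  obtain c \<beta> where c: "0 < c" "c < 1" "0 < \<beta>" "\<beta> < 1"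
    "\<And>I E n. I \<in> \<D> \<Longrightarrow> E \<in> sets lebesgue \<Longrightarrow> E \<subseteq> I \<Longrightarrow> vol E \<le> c ^ n * vol I
      \<Longrightarrow> wvol u E \<le> \<beta> ^ n * wvol u I"
    by (rule local_Ainf_power_decay[OF u(1)], rule that)
  obtain c' \<beta>' where c': "0 < c'" "c' < 1" "0 < \<beta>'" "\<beta>' < 1"
    "\<And>I E n. I \<in> \<D> \<Longrightarrow> E \<in> sets lebesgue \<Longrightarrow> E \<subseteq> I \<Longrightarrow> wvol v E \<le> c' ^ n * wvol v I
      \<Longrightarrow> vol E \<le> \<beta>' ^ n * vol I"
    by (rule local_Ainf_power_decay_converse[OF v(1)], rule that)
  obtain \<kappa> where \<kappa>: "0 < \<kappa>" "\<kappa> < 1"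
    "\<And>I E. I \<in> \<D> \<Longrightarrow> E \<in> sets lebesgue \<Longrightarrow> E \<subseteq> I \<Longrightarrow> vol E \<le> 1/2 * vol I
      \<Longrightarrow> wvol v E \<le> (1 - \<kappa>) * wvol v I"
    by (rule local_Ainf_upper[OF v(1), of "1/2"]) auto
  \<comment> \<open>\<open>N\<close> steps of the comparison from \<open>v\<close> to volume pay for
    one step of the comparison from volume to \<open>u\<close>; their composition is
    \<open>decay2\<close>.\<close>
  obtain N where N: "\<beta>' ^ N < c" using real_arch_pow_inv[OF c(1) c'(4)] by blast
  \<comment> \<open>The entries serve, in this order, the share \<open>1/2\<close> in
    \<open>sparse\<close>, then \<open>decay1\<close>, then \<open>decay2\<close>, and finally
    \<open>1 < a\<close>.\<close>
  define a where "a = Max {2 * D, 1 / c, 1 / c' ^ N, 2}"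
  have a: "2 * D \<le> a" "1 / c \<le> a" "1 / c' ^ N \<le> a" "2 \<le> a" by (auto simp: a_def)
  have inv_pow: "x \<le> b ^ n * y" if "a ^ n * x \<le> y" "1 / b \<le> a" "0 < b" "0 \<le> x" for x y b :: real and n :: nat
  proof -
    have "(1 / b) ^ n * x \<le> a ^ n * x" using that by (intro mult_right_mono power_mono) auto
    with that(1) have "(1 / b) ^ n * x \<le> y" by simp
    then show ?thesis using that(3) by (simp add: power_divide field_simps)
  qed
  define C where "C = a * C\<^sub>1 + 2 * a\<^sup>2 / \<kappa> * (2 * (1 + 1 / (1 - \<beta>))) * (2 * C\<^sub>1)"
  show ?thesis
  proof (rule that[of C])
    have "0 < a * C\<^sub>1" using a A1(1) by simp
    moreover have "0 \<le> 2 * a\<^sup>2 / \<kappa> * (2 * (1 + 1 / (1 - \<beta>))) * (2 * C\<^sub>1)"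
      using a A1(1) \<kappa> c by (intro mult_nonneg_nonneg) auto
    ultimately show "0 < C" by (simp add: C_def)
  next
    fix g :: "'a \<Rightarrow> real"
    assume g: "g \<in> borel_measurable lebesgue" "\<And>x. 0 \<le> g x" "\<And>I. I \<in> \<D> \<Longrightarrow> emeasure (wmeas g) I < \<infinity>"
    interpret dyadic_weights \<D> D u v g a \<beta> \<kappa> C\<^sub>1
    proof unfold_locales
      show "1 < a" "D \<le> a" using a D_ge by auto
      show "wvol v E \<le> (1 - \<kappa>) * wvol v I"
        if "I \<in> \<D>" "E \<in> sets lebesgue" "E \<subseteq> I" "vol E \<le> D / a * vol I" for I E
      proof (rule \<kappa>(3)[OF that(1-3)])
        have "D / a \<le> 1 / 2" using a by (simp add: field_simps)
        then have "D / a * vol I \<le> 1 / 2 * vol I" by (intro mult_right_mono) auto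
        then show "vol E \<le> 1 / 2 * vol I" by (rule order_trans[OF that(4)])
      qed
      show "wvol u E \<le> \<beta> ^ n * wvol u I"
        if "I \<in> \<D>" "E \<in> sets lebesgue" "E \<subseteq> I" "a ^ n * vol E \<le> vol I" for I E n
        using inv_pow[OF that(4) a(2) c(1)] by (intro c(5) that) auto
      show "wvol u E \<le> \<beta> ^ n * wvol u I"
        if "I \<in> \<D>" "E \<in> sets lebesgue" "E \<subseteq> I" "a ^ n * wvol v E \<le> wvol v I" for I E n
      proof (rule c(5)[OF that(1-3)])
        have "wvol v E \<le> (c' ^ N) ^ n * wvol v I"
          using inv_pow[OF that(4) a(3)] c'(1) by auto
        then have "vol E \<le> \<beta>' ^ (N * n) * vol I"
          by (intro c'(5) that) (simp add: power_mult)
        also have "\<dots> \<le> c ^ n * vol I"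
          unfolding power_mult using N c' by (intro mult_right_mono power_mono) auto
        finally show "vol E \<le> c ^ n * vol I" .
      qed
    qed (use meas g u v fin wmeas_cell_pos[OF meas(1) ae(1) fin(1)] wmeas_cell_pos[OF meas(2) ae(2) fin(2)]
        c \<kappa> A1 in auto)
    show "(\<integral>\<^sup>+x\<in>{x. 0 < v x \<and> (\<exists>I\<in>\<D>. x \<in> I \<and> v x * vol I < wvol g I)}.
        ennreal (u x * v x) \<partial>lebesgue) \<le> ennreal C * (\<integral>\<^sup>+x. ennreal (g x * u x) \<partial>lebesgue)"
      using weak_type unfolding level_set_def C_def .
  qed
qed

end

section \<open>Shifted dyadic grids\<close>

text \<open>The shift is measured in side lengths of level \<open>n\<close>. Nesting requires
  \<open>grid_shift \<tau> (n + 1) b - 2 * grid_shift \<tau> n b\<close> to be an integer; the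
  alternating sign makes it 1 or -1 in the shifted coordinates.\<close>

definition grid_shift :: "'a set \<Rightarrow> int \<Rightarrow> 'a \<Rightarrow> real" where
  "grid_shift \<tau> n b = (if b \<in> \<tau> then if even n then 1/3 else - 1/3 else 0)"

definition grid_index :: "'a::euclidean_space set \<Rightarrow> int \<Rightarrow> 'a \<Rightarrow> 'a \<Rightarrow> int" where
  "grid_index \<tau> n x b = \<lfloor>x \<bullet> b * 2 powi n - grid_shift \<tau> n b\<rfloor>"

text \<open>A class of points with equal indices rather than an explicit box: nesting then only asks
  that the index at level \<open>n + 1\<close> determine the index at level \<open>n\<close>. The
  side length is \<open>2 powi (-n)\<close>, so larger \<open>n\<close> is finer.\<close>

definition cell :: "'a::euclidean_space set \<Rightarrow> int \<Rightarrow> 'a \<Rightarrow> 'a set" where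
  "cell \<tau> n x = {y. \<forall>b\<in>Basis. grid_index \<tau> n y b = grid_index \<tau> n x b}"

definition cell_corner :: "'a::euclidean_space set \<Rightarrow> int \<Rightarrow> 'a \<Rightarrow> 'a" where
  "cell_corner \<tau> n x = (\<Sum>b\<in>Basis. (2 powi (-n) * (of_int (grid_index \<tau> n x b) + grid_shift \<tau> n b)) *\<^sub>R b)"

lemma cell_refl: "x \<in> cell \<tau> n x" by (simp add: cell_def)

lemma cell_eq: "y \<in> cell \<tau> n x \<Longrightarrow> cell \<tau> n y = cell \<tau> n x"
  by (auto simp: cell_def)

lemma grid_index_succ:
  "grid_index \<tau> n x b =
    (if b \<in> \<tau> then if even n then (grid_index \<tau> (n + 1) x b - 1) div 2 else (grid_index \<tau> (n + 1) x b + 1) div 2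
     else grid_index \<tau> (n + 1) x b div 2)"
proof -
  \<comment> \<open>Here \<open>j\<close> is the integer by which the doubled shift of one level
    differs from the shift of the next: 0, -1 or 1 in the three cases.\<close>
  have half: "\<lfloor>z\<rfloor> = (\<lfloor>w\<rfloor> + j) div 2" if "2 * z = w + of_int j" for z w :: real and j
  proof -
    have "\<lfloor>2 * z / real_of_int 2\<rfloor> = \<lfloor>2 * z\<rfloor> div 2" by (rule floor_divide_real_eq_div) simp
    then have "\<lfloor>z\<rfloor> = \<lfloor>2 * z\<rfloor> div 2" by simp
    also have "\<lfloor>2 * z\<rfloor> = \<lfloor>w\<rfloor> + j" unfolding that by simp
    finally show ?thesis .
  qed
  have p: "(2::real) powi (n + 1) = 2 * 2 powi n" by (simp add: power_int_add)
  consider "b \<notin> \<tau>" | "b \<in> \<tau>" "even n" | "b \<in> \<tau>" "odd n" by blast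
  then show ?thesis
  proof cases
    case 1
    have "grid_index \<tau> n x b = (grid_index \<tau> (n + 1) x b + 0) div 2"
      unfolding grid_index_def by (rule half) (simp add: 1 grid_shift_def p)
    with 1 show ?thesis by simp
  next
    case 2
    have "grid_index \<tau> n x b = (grid_index \<tau> (n + 1) x b + (- 1)) div 2"
      unfolding grid_index_def by (rule half) (simp add: 2 grid_shift_def p)
    with 2 show ?thesis by simp
  next
    case 3
    have "grid_index \<tau> n x b = (grid_index \<tau> (n + 1) x b + 1) div 2"
      unfolding grid_index_def by (rule half) (simp add: 3 grid_shift_def p)
    with 3 show ?thesis by simp
  qed
qed

lemma cell_succ: "cell \<tau> (n + 1) x \<subseteq> cell \<tau> n x"
proof -
  have "grid_index \<tau> n y b = grid_index \<tau> n x b" if "grid_index \<tau> (n + 1) y b = grid_index \<tau> (n + 1) x b" for y b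
    using that grid_index_succ[of \<tau> n y b] grid_index_succ[of \<tau> n x b] by simp
  then show ?thesis unfolding cell_def by blast
qed

lemma cell_mono:
  assumes "n \<le> k"
  shows "cell \<tau> k x \<subseteq> cell \<tau> n x"
  using assms
proof (induction k rule: int_ge_induct)
  case base then show ?case by simp
next
  case (step i) then show ?case using cell_succ[of \<tau> i x] by simp
qed

lemma cell_mono':
  assumes "n \<le> k" "y \<in> cell \<tau> n x"
  shows "cell \<tau> k y \<subseteq> cell \<tau> n x"
  using cell_mono[OF assms(1), of \<tau> y] cell_eq[OF assms(2)] by simp

lemma mem_cell_iff:
  "y \<in> cell \<tau> n x \<longleftrightarrow> (\<forall>b\<in>Basis. cell_corner \<tau> n x \<bullet> b \<le> y \<bullet> b \<and> y \<bullet> b < cell_corner \<tau> n x \<bullet> b + 2 powi (-n))"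
proof -
  have c: "cell_corner \<tau> n x \<bullet> b = 2 powi (-n) * (of_int (grid_index \<tau> n x b) + grid_shift \<tau> n b)"
    if "b \<in> Basis" for b
    unfolding cell_corner_def using that by simp
  have "grid_index \<tau> n y b = k \<longleftrightarrow> 2 powi (-n) * (of_int k + grid_shift \<tau> n b) \<le> y \<bullet> b \<and>
      y \<bullet> b < 2 powi (-n) * (of_int k + grid_shift \<tau> n b) + 2 powi (-n)" for b k
  proof -
    have p: "(2::real) powi (-n) = 1 / 2 powi n" "0 < (2::real) powi n"
      by (auto simp: power_int_minus field_simps)
    have "grid_index \<tau> n y b = k \<longleftrightarrow> of_int k \<le> y \<bullet> b * 2 powi n - grid_shift \<tau> n b \<and>
        y \<bullet> b * 2 powi n - grid_shift \<tau> n b < of_int k + 1"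
      unfolding grid_index_def by (rule floor_eq_iff)
    then show ?thesis unfolding p(1) using p(2) by (auto simp: field_simps)
  qed
  then show ?thesis unfolding cell_def using c by auto
qed

lemma cell_subset_cbox: "cell \<tau> n x \<subseteq> cbox (cell_corner \<tau> n x) (cell_corner \<tau> n x + 2 powi (-n) *\<^sub>R One)"
  by (force simp: mem_cell_iff mem_box inner_add_left intro: less_imp_le)

lemma box_subset_cell: "box (cell_corner \<tau> n x) (cell_corner \<tau> n x + 2 powi (-n) *\<^sub>R One) \<subseteq> cell \<tau> n x"
  by (force simp: mem_cell_iff mem_box inner_add_left intro: less_imp_le)

lemma cbox_diff_cell_null:
  "cbox (cell_corner \<tau> n x) (cell_corner \<tau> n x + 2 powi (-n) *\<^sub>R One) - cell \<tau> n x \<in> null_sets lebesgue"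
proof -
  have "negligible (cbox (cell_corner \<tau> n x) (cell_corner \<tau> n x + 2 powi (-n) *\<^sub>R One) - cell \<tau> n x)"
    by (rule negligible_subset[OF negligible_frontier_interval])
      (use box_subset_cell in blast)
  then show ?thesis by (simp add: negligible_iff_null_sets)
qed

lemma cell_sets_lebesgue: "cell \<tau> n x \<in> sets lebesgue"
proof -
  let ?Q = "cbox (cell_corner \<tau> n x) (cell_corner \<tau> n x + 2 powi (-n) *\<^sub>R One)"
  have "cell \<tau> n x = ?Q - (?Q - cell \<tau> n x)" using cell_subset_cbox[of \<tau> n x] by blast
  then show ?thesis using null_setsD2[OF cbox_diff_cell_null[of \<tau> n x]]
    by (metis lmeasurable_cbox fmeasurableD sets.Diff)
qed

text \<open>Carries conditions stated for closed cubes over to half-open cells; absolute continuity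
  disposes of the faces.\<close>

lemma emeasure_cell_cbox:
  assumes "sets \<mu> = sets lebesgue" "absolutely_continuous lebesgue \<mu>"
  shows "emeasure \<mu> (cell \<tau> n x) = emeasure \<mu> (cbox (cell_corner \<tau> n x) (cell_corner \<tau> n x + 2 powi (-n) *\<^sub>R One))"
proof -
  let ?Q = "cbox (cell_corner \<tau> n x) (cell_corner \<tau> n x + 2 powi (-n) *\<^sub>R One)"
  have "emeasure \<mu> (cell \<tau> n x \<union> (?Q - cell \<tau> n x)) = emeasure \<mu> (cell \<tau> n x)"
  proof (rule emeasure_Un_null_set)
    show "?Q - cell \<tau> n x \<in> null_sets \<mu>"
      using cbox_diff_cell_null assms(2) unfolding absolutely_continuous_def by blast
  qed (simp add: assms cell_sets_lebesgue)
  moreover have "cell \<tau> n x \<union> (?Q - cell \<tau> n x) = ?Q" using cell_subset_cbox[of \<tau> n x] by blast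
  ultimately show ?thesis by simp
qed

lemma emeasure_cell: "emeasure lebesgue (cell \<tau> n (x::'a::euclidean_space)) = ennreal ((2 powi (-n)) ^ DIM('a))"
proof -
  have "emeasure lebesgue (cell \<tau> n x) = emeasure lebesgue (cbox (cell_corner \<tau> n x) (cell_corner \<tau> n x + 2 powi (-n) *\<^sub>R One))"
    by (rule emeasure_cell_cbox) (auto simp: absolutely_continuous_def)
  also have "\<dots> = ennreal ((2 powi (-n)) ^ DIM('a))"
    by (subst emeasure_completion) (auto simp: emeasure_lborel_cbox_eq inner_add_left inner_diff_left)
  finally show ?thesis .
qed

lemma measure_cell: "vol (cell \<tau> n (x::'a::euclidean_space)) = (2 powi (-n)) ^ DIM('a)"
  using emeasure_cell[of \<tau> n x] by (simp add: measure_def)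

lemma cell_lmeasurable: "cell \<tau> n x \<in> lmeasurable"
  using cell_sets_lebesgue[of \<tau> n x] emeasure_cell[of \<tau> n x] by (intro fmeasurableI) auto

lemma cell_diameter:
  fixes x :: "'a::euclidean_space"
  assumes "y \<in> cell \<tau> n x" "z \<in> cell \<tau> n x"
  shows "norm (y - z) \<le> real DIM('a) * 2 powi (-n)"
proof -
  have "norm (y - z) \<le> (\<Sum>b\<in>Basis. \<bar>(y - z) \<bullet> b\<bar>)" by (rule norm_le_l1)
  also have "\<dots> \<le> (\<Sum>b\<in>(Basis::'a set). 2 powi (-n))"
    using assms unfolding mem_cell_iff by (intro sum_mono) (force simp: inner_diff_left abs_le_iff)
  finally show ?thesis by simp
qed

text \<open>The side is bounded by \<open>\<rho>\<close> at every point of the cell, so that all its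
  subcells inherit membership; evaluated at one fixed point, the condition bounds the size of all
  ancestors.\<close>

definition local_grid :: "('a::euclidean_space \<Rightarrow> real) \<Rightarrow> 'a set \<Rightarrow> 'a set set" where
  "local_grid \<rho> \<tau> = {I. \<exists>n x. I = cell \<tau> n x \<and> (\<forall>y\<in>I. 2 powi (-n) \<le> \<rho> y)}"

lemma local_gridI: "(\<And>y. y \<in> cell \<tau> n x \<Longrightarrow> 2 powi (-n) \<le> \<rho> y) \<Longrightarrow> cell \<tau> n x \<in> local_grid \<rho> \<tau>"
  unfolding local_grid_def by (intro CollectI exI[of _ n] exI[of _ x] conjI refl ballI)

lemma measure_cell_less:
  fixes x y :: "'a::euclidean_space"
  assumes "n < k"
  shows "vol (cell \<tau> k y) < vol (cell \<tau> n x)"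
  unfolding measure_cell using assms by (intro power_strict_mono power_int_strict_increasing) auto

lemma dyadic_family_local_grid:
  fixes \<rho> :: "'a::euclidean_space \<Rightarrow> real"
  assumes \<rho>: "\<And>x. 0 < \<rho> x"
  shows "dyadic_family (local_grid \<rho> \<tau>) (2 ^ DIM('a))"
proof
  obtain B :: "'a set" where B: "countable B" "\<And>U. open U \<Longrightarrow> U \<noteq> {} \<Longrightarrow> \<exists>d\<in>B. d \<in> U"
    using countable_dense_setE by blast
  \<comment> \<open>Each cell contains a nonempty open box and thus a point of the countable dense
    set \<open>B\<close>, which can replace the representative \<open>x\<close>.\<close>
  have "local_grid \<rho> \<tau> \<subseteq> (\<lambda>(n, x). cell \<tau> n x) ` (UNIV \<times> B)"
  proof
    fix I assume "I \<in> local_grid \<rho> \<tau>"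
    then obtain n x where I: "I = cell \<tau> n x" by (auto simp: local_grid_def)
    have "box (cell_corner \<tau> n x) (cell_corner \<tau> n x + 2 powi (-n) *\<^sub>R One) \<noteq> {}"
      by (simp add: box_ne_empty inner_add_left)
    then obtain d where d: "d \<in> B" "d \<in> cell \<tau> n x"
      using B(2)[OF open_box] box_subset_cell[of \<tau> n x] by blast
    then have "I = cell \<tau> n d" using I cell_eq by blast
    with d show "I \<in> (\<lambda>(n, x). cell \<tau> n x) ` (UNIV \<times> B)" by auto
  qed
  then show "countable (local_grid \<rho> \<tau>)"
    by (rule countable_subset) (intro countable_image countable_SIGMA B(1), simp)
next
  fix I assume "I \<in> local_grid \<rho> \<tau>"
  then obtain n x where I: "I = cell \<tau> n x" and small: "\<And>y. y \<in> I \<Longrightarrow> 2 powi (-n) \<le> \<rho> y"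
    unfolding local_grid_def by blast
  show "I \<in> lmeasurable" unfolding I by (rule cell_lmeasurable)
  show "0 < vol I" unfolding I measure_cell by simp
  {
    fix J assume "J \<in> local_grid \<rho> \<tau>" "I \<inter> J \<noteq> {}"
    then obtain k y z where J: "J = cell \<tau> k y" "z \<in> I" "z \<in> J" unfolding local_grid_def by blast
    then have "I = cell \<tau> n z" "J = cell \<tau> k z" using I cell_eq by blast+
    then show "I \<subseteq> J \<or> J \<subseteq> I" using cell_mono[of n k \<tau> z] cell_mono[of k n \<tau> z] by (cases "n \<le> k") auto
  }
  show "finite {J \<in> local_grid \<rho> \<tau>. I \<subseteq> J}"
  proof -
    obtain j :: nat where j: "\<rho> x < 2 ^ j" using real_arch_pow[of 2 "\<rho> x"] by auto
    \<comment> \<open>Every ancestor contains \<open>x\<close> and so has side at most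
      \<open>\<rho> x\<close>, while it is no finer than \<open>I\<close>; finitely many levels
      remain.\<close>
    have "{J \<in> local_grid \<rho> \<tau>. I \<subseteq> J} \<subseteq> (\<lambda>k. cell \<tau> k x) ` {- int j..n}"
    proof
      fix J assume "J \<in> {J \<in> local_grid \<rho> \<tau>. I \<subseteq> J}"
      then obtain k y where J: "J = cell \<tau> k y" "I \<subseteq> J" "\<And>z. z \<in> J \<Longrightarrow> 2 powi (-k) \<le> \<rho> z"
        unfolding local_grid_def by blast
      have xJ: "x \<in> J" using J(2) I cell_refl by blast
      then have Jx: "J = cell \<tau> k x" using J(1) cell_eq by blast
      have "- int j \<le> k"
      proof (rule ccontr)
        assume "\<not> - int j \<le> k"
        then have "(2::real) powi (int j) \<le> 2 powi (-k)" by (intro power_int_increasing) auto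
        with J(3)[OF xJ] j show False by simp
      qed
      moreover have "k \<le> n"
      proof (rule ccontr)
        assume "\<not> k \<le> n"
        then have "vol J < vol I" unfolding I Jx by (intro measure_cell_less) auto
        moreover have "vol I \<le> vol J"
          using J(2) unfolding I Jx by (intro measure_mono_fmeasurable cell_lmeasurable cell_sets_lebesgue)
        ultimately show False by simp
      qed
      ultimately show "J \<in> (\<lambda>k. cell \<tau> k x) ` {- int j..n}" unfolding Jx by auto
    qed
    then show ?thesis by (rule finite_subset) simp
  qed
  show "\<exists>J\<in>local_grid \<rho> \<tau>. z \<in> J \<and> J \<subseteq> I \<and> J \<subseteq> W" if W: "open W" "z \<in> I" "z \<in> W" for W z
  proof -
    obtain e where e: "0 < e" "ball z e \<subseteq> W" using W open_contains_ball by blast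
    have d: "0 < e / real DIM('a)" using e by simp
    obtain j :: nat where j: "(1/2) ^ j < e / real DIM('a)" using real_arch_pow_inv[OF d, of "1/2"] by auto
    define k where "k = max n (int j)"
    have "(2::real) powi (-k) \<le> 2 powi (- int j)" unfolding k_def by (intro power_int_increasing) auto
    also have "\<dots> = (1/2) ^ j" by (simp add: power_int_minus power_divide field_simps)
    finally have "real DIM('a) * 2 powi (-k) \<le> real DIM('a) * (1/2) ^ j" by (intro mult_left_mono) auto
    also have "\<dots> < e" using j by (simp add: field_simps)
    finally have k: "real DIM('a) * 2 powi (-k) < e" .
    have sub: "cell \<tau> k z \<subseteq> I" unfolding I using W(2) I by (intro cell_mono') (auto simp: k_def)
    have "(2::real) powi (-k) \<le> 2 powi (-n)" unfolding k_def by (intro power_int_increasing) auto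
    then have "2 powi (-k) \<le> \<rho> y" if "y \<in> cell \<tau> k z" for y
      using small[of y] sub that by (meson order_trans subsetD)
    then have "cell \<tau> k z \<in> local_grid \<rho> \<tau>" by (rule local_gridI)
    moreover have "cell \<tau> k z \<subseteq> W"
    proof
      fix y assume "y \<in> cell \<tau> k z"
      then have "norm (z - y) \<le> real DIM('a) * 2 powi (-k)" using cell_refl by (intro cell_diameter)
      with k have "y \<in> ball z e" by (simp add: dist_norm)
      then show "y \<in> W" using e by blast
    qed
    ultimately show ?thesis using sub cell_refl[of z \<tau> k] by (intro bexI[of _ "cell \<tau> k z"] conjI)
  qed
  fix J assume J: "J \<in> local_grid \<rho> \<tau>" "J \<subset> I"
  then obtain k y where Jk: "J = cell \<tau> k y" unfolding local_grid_def by blast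
  then have yI: "y \<in> I" using J cell_refl by blast
  then have Iy: "I = cell \<tau> n y" using I cell_eq by blast
  have nk: "n < k"
  proof (rule ccontr)
    assume "\<not> n < k"
    then have "I \<subseteq> J" unfolding Iy Jk by (intro cell_mono) auto
    with J(2) show False by blast
  qed
  show "\<exists>J'\<in>local_grid \<rho> \<tau>. J \<subset> J' \<and> J' \<subseteq> I \<and> vol J' \<le> 2 ^ DIM('a) * vol J"
  proof (intro bexI conjI)
    \<comment> \<open>The cell one level coarser still lies in \<open>I\<close>, whose side is
      already at most \<open>\<rho>\<close> at all its points.\<close>
    let ?J = "cell \<tau> (k - 1) y"
    show sub: "?J \<subseteq> I" unfolding Iy using nk by (intro cell_mono) auto
    have "(2::real) powi (-(k - 1)) \<le> 2 powi (-n)" using nk by (intro power_int_increasing) auto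
    then have "2 powi (-(k - 1)) \<le> \<rho> z" if "z \<in> ?J" for z
      using small[of z] sub that by (meson order_trans subsetD)
    then show "?J \<in> local_grid \<rho> \<tau>" by (rule local_gridI)
    have "J \<subseteq> ?J" unfolding Jk by (intro cell_mono) auto
    moreover have "vol J < vol ?J" unfolding Jk by (intro measure_cell_less) auto
    ultimately show "J \<subset> ?J" by blast
    have "(2::real) powi (-(k - 1)) = 2 * 2 powi (-k)" by (simp add: power_int_diff power_int_minus power_int_add field_simps)
    then show "vol ?J \<le> 2 ^ DIM('a) * vol J"
      unfolding Jk measure_cell by (simp add: power_mult_distrib)
  qed
qed simp

text \<open>The one-third trick: the walls of the unshifted and of the shifted grid of a given level are
  at distance at least a third of the side length, so in each coordinate one of the two does not
  separate the cube.\<close>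
lemma cbox_subset_shifted_cell:
  fixes x :: "'a::euclidean_space"
  assumes h: "0 < h" "6 * h < 2 powi (-n)"
  obtains \<tau> where "\<tau> \<subseteq> Basis" "cbox (x - h *\<^sub>R One) (x + h *\<^sub>R One) \<subseteq> cell \<tau> n x"
proof -
  \<comment> \<open>The coordinates in which a wall of the unshifted grid separates the cube; only
    these are shifted.\<close>
  define \<tau> where "\<tau> = {b\<in>Basis. \<lfloor>(x \<bullet> b - h) * 2 powi n\<rfloor> \<noteq> \<lfloor>(x \<bullet> b + h) * 2 powi n\<rfloor>}"
  have p: "0 < (2::real) powi n" by simp
  have h2: "2 * (h * 2 powi n) < 1/3"
  proof -
    have "6 * h < 1 / 2 powi n" using h(2) by (simp add: power_int_minus field_simps)
    then show ?thesis using p by (simp add: field_simps)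
  qed
  have const: "\<lfloor>(x \<bullet> b - h) * 2 powi n - grid_shift \<tau> n b\<rfloor> = \<lfloor>(x \<bullet> b + h) * 2 powi n - grid_shift \<tau> n b\<rfloor>"
    if b: "b \<in> Basis" for b
  proof (cases "b \<in> \<tau>")
    case False
    then show ?thesis using b by (simp add: \<tau>_def grid_shift_def)
  next
    case True
    define A B where "A = (x \<bullet> b - h) * 2 powi n" and "B = (x \<bullet> b + h) * 2 powi n"
    have AB: "A < B" "B < A + 1/3" using h h2 p by (auto simp: A_def B_def algebra_simps)
    have "\<lfloor>A\<rfloor> \<noteq> \<lfloor>B\<rfloor>" using True by (simp add: \<tau>_def A_def B_def)
    moreover have "\<lfloor>A\<rfloor> \<le> \<lfloor>B\<rfloor>" using AB by (intro floor_mono) simp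
    ultimately have "\<lfloor>A\<rfloor> < \<lfloor>B\<rfloor>" by simp
    then have "A < of_int \<lfloor>B\<rfloor>" by (simp add: floor_less_iff)
    moreover have "of_int \<lfloor>B\<rfloor> \<le> B" by simp
    ultimately have K: "A < of_int \<lfloor>B\<rfloor>" "of_int \<lfloor>B\<rfloor> \<le> B" .
    \<comment> \<open>In grid units the edge from \<open>A\<close> to \<open>B\<close> is shorter
      than 1/3 and contains the wall \<open>\<lfloor>B\<rfloor>\<close>; a shift by 1/3 in either
      direction leaves it strictly between two walls.\<close>
    show ?thesis
    proof (cases "even n")
      case even: True
      have "\<lfloor>A - 1/3\<rfloor> = \<lfloor>B\<rfloor> - 1" "\<lfloor>B - 1/3\<rfloor> = \<lfloor>B\<rfloor> - 1"
        unfolding floor_eq_iff using K AB by (simp_all, linarith+)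
      with even True show ?thesis unfolding A_def[symmetric] B_def[symmetric] by (simp add: grid_shift_def)
    next
      case odd: False
      have "\<lfloor>A + 1/3\<rfloor> = \<lfloor>B\<rfloor>" "\<lfloor>B + 1/3\<rfloor> = \<lfloor>B\<rfloor>"
        unfolding floor_eq_iff using K AB by (simp_all, linarith+)
      with odd True show ?thesis unfolding A_def[symmetric] B_def[symmetric] by (simp add: grid_shift_def)
    qed
  qed
  show ?thesis
  proof (rule that[of \<tau>])
    show "\<tau> \<subseteq> Basis" by (auto simp: \<tau>_def)
    show "cbox (x - h *\<^sub>R One) (x + h *\<^sub>R One) \<subseteq> cell \<tau> n x"
    proof
      fix y assume y: "y \<in> cbox (x - h *\<^sub>R One) (x + h *\<^sub>R One)"
      have "grid_index \<tau> n y b = grid_index \<tau> n x b" if b: "b \<in> Basis" for b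
      proof -
        let ?A = "(x \<bullet> b - h) * 2 powi n - grid_shift \<tau> n b"
        let ?B = "(x \<bullet> b + h) * 2 powi n - grid_shift \<tau> n b"
        have yb: "x \<bullet> b - h \<le> y \<bullet> b" "y \<bullet> b \<le> x \<bullet> b + h"
          using y b by (auto simp: mem_box inner_add_left inner_diff_left)
        have "\<lfloor>?A\<rfloor> \<le> grid_index \<tau> n y b" "grid_index \<tau> n y b \<le> \<lfloor>?B\<rfloor>"
          unfolding grid_index_def using yb p by (auto intro!: floor_mono mult_right_mono)
        moreover have "\<lfloor>?A\<rfloor> \<le> grid_index \<tau> n x b" "grid_index \<tau> n x b \<le> \<lfloor>?B\<rfloor>"
          unfolding grid_index_def using h p by (auto intro!: floor_mono mult_right_mono)
        ultimately show ?thesis using const[OF b] by linarith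
      qed
      then show "y \<in> cell \<tau> n x" by (simp add: cell_def)
    qed
  qed
qed

section \<open>Weights on the local grids\<close>

lemma dim_pos: "0 < real DIM('a::euclidean_space)" "0 < sqrt (real DIM('a))"
  by auto

lemma cube_eq_cbox: "cube (x::'a::euclidean_space) (sqrt (real DIM('a)) * h) = cbox (x - h *\<^sub>R One) (x + h *\<^sub>R One)"
  using dim_pos[where 'a='a] by (simp add: cube_def)

lemma cell_closure_cube:
  fixes x :: "'a::euclidean_space" and \<tau> :: "'a set" and n :: int
  defines "c \<equiv> cell_corner \<tau> n x + (2 powi (-n) / 2) *\<^sub>R One"
    and "r \<equiv> sqrt (real DIM('a)) * (2 powi (-n) / 2)"
  shows "cube c r = cbox (cell_corner \<tau> n x) (cell_corner \<tau> n x + 2 powi (-n) *\<^sub>R One)"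
    and "c \<in> cell \<tau> n x"
proof -
  have "(2 powi (-n) / 2) *\<^sub>R One + (2 powi (-n) / 2) *\<^sub>R One = 2 powi (-n) *\<^sub>R (One :: 'a)"
    by (simp add: scaleR_left_distrib[symmetric])
  then show "cube c r = cbox (cell_corner \<tau> n x) (cell_corner \<tau> n x + 2 powi (-n) *\<^sub>R One)"
    unfolding c_def r_def cube_eq_cbox by (simp add: add.assoc)
  show "c \<in> cell \<tau> n x" unfolding c_def mem_cell_iff by (auto simp: inner_add_left)
qed

lemma weight_emeasure:
  assumes "weight w" "compact K"
  shows "emeasure (wmeas w) K = ennreal (\<integral>y\<in>K. w y \<partial>lebesgue)"
proof -
  have w: "w \<in> borel_measurable lebesgue" "\<And>x. 0 \<le> w x" "set_integrable lebesgue K w"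
    using assms unfolding weight_def by auto
  have K: "K \<in> sets lebesgue" using compact_imp_closed[OF assms(2)] by simp
  have "emeasure (wmeas w) K = (\<integral>\<^sup>+x. ennreal (w x) * indicator K x \<partial>lebesgue)"
    using w K by (subst emeasure_density) auto
  also have "\<dots> = (\<integral>\<^sup>+x. ennreal (indicator K x *\<^sub>R w x) \<partial>lebesgue)"
    by (intro nn_integral_cong) (auto simp: indicator_def)
  also have "\<dots> = ennreal (\<integral>y\<in>K. w y \<partial>lebesgue)"
    unfolding set_lebesgue_integral_def using w
    by (intro nn_integral_eq_integral) (auto simp: set_integrable_def indicator_def)
  finally show ?thesis .
qed

lemma weight_measure:
  assumes "weight w" "compact K"
  shows "(\<integral>y\<in>K. w y \<partial>lebesgue) = wvol w K"
proof -
  have "0 \<le> (\<integral>y\<in>K. w y \<partial>lebesgue)"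
    using assms unfolding weight_def set_lebesgue_integral_def by (intro integral_nonneg_AE) (auto simp: indicator_def)
  then show ?thesis using weight_emeasure[OF assms] by (simp add: measure_def)
qed

lemma compact_cube: "compact (cube x r)" by (simp add: cube_def)

lemma cell_cube_measures:
  fixes x :: "'a::euclidean_space"
  assumes w: "weight w" and Q: "cube c r = cbox (cell_corner \<tau> n x) (cell_corner \<tau> n x + 2 powi (-n) *\<^sub>R One)"
  shows "wvol w (cell \<tau> n x) = (\<integral>y\<in>cube c r. w y \<partial>lebesgue)"
    and "emeasure (wmeas w) (cell \<tau> n x) < \<infinity>"
    and "vol (cell \<tau> n x) = vol (cube c r)"
proof -
  have m: "w \<in> borel_measurable lebesgue" using w by (simp add: weight_def)
  have e: "emeasure (wmeas w) (cell \<tau> n x) = emeasure (wmeas w) (cube c r)"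
    unfolding Q by (intro emeasure_cell_cbox absolutely_continuous_wmeas m) simp
  then show "wvol w (cell \<tau> n x) = (\<integral>y\<in>cube c r. w y \<partial>lebesgue)"
    unfolding weight_measure[OF w compact_cube] measure_def by simp
  show "emeasure (wmeas w) (cell \<tau> n x) < \<infinity>" unfolding e weight_emeasure[OF w compact_cube] by simp
  have "emeasure lebesgue (cell \<tau> n x) = emeasure lebesgue (cube c r)"
    unfolding Q by (intro emeasure_cell_cbox) (auto simp: absolutely_continuous_def)
  then show "vol (cell \<tau> n x) = vol (cube c r)" by (simp add: measure_def)
qed

text \<open>The centre of a cell belongs to it, so \<open>r / \<rho> c\<close> is at most half the
  square root of the dimension. Here the growth factor of both weight classes becomes a
  constant.\<close>

lemma local_grid_cases:
  fixes \<rho> :: "'a::euclidean_space \<Rightarrow> real"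
  assumes "\<And>x. 0 < \<rho> x" "I \<in> local_grid \<rho> \<tau>" "0 \<le> \<theta>"
  obtains n x c r where "I = cell \<tau> n x"
    "cube c r = cbox (cell_corner \<tau> n x) (cell_corner \<tau> n x + 2 powi (-n) *\<^sub>R One)"
    "0 < r" "(1 + r / \<rho> c) powr \<theta> \<le> (1 + sqrt (real DIM('a)) / 2) powr \<theta>"
proof -
  obtain n x where I: "I = cell \<tau> n x" and small: "\<And>y. y \<in> I \<Longrightarrow> 2 powi (-n) \<le> \<rho> y"
    using assms(2) unfolding local_grid_def by blast
  define c where "c = cell_corner \<tau> n x + (2 powi (-n) / 2) *\<^sub>R One"
  define r where "r = sqrt (real DIM('a)) * (2 powi (-n) / 2)"
  note cr = cell_closure_cube[where x = x and \<tau> = \<tau> and n = n, folded c_def r_def]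
  have r: "0 < r" using dim_pos[where 'a='a] by (simp add: r_def)
  have "2 powi (-n) \<le> \<rho> c" using small cr(2) I by blast
  then have "sqrt (real DIM('a)) / 2 * 2 powi (-n) \<le> sqrt (real DIM('a)) / 2 * \<rho> c" by (intro mult_left_mono) auto
  then have "r \<le> sqrt (real DIM('a)) / 2 * \<rho> c" by (simp add: r_def)
  then have "r / \<rho> c \<le> sqrt (real DIM('a)) / 2" using assms(1)[of c] by (simp add: field_simps)
  then have "(1 + r / \<rho> c) powr \<theta> \<le> (1 + sqrt (real DIM('a)) / 2) powr \<theta>"
    using r assms(1)[of c] assms(3) by (intro powr_mono2) (auto intro!: add_nonneg_nonneg divide_nonneg_nonneg less_imp_le)
  then show ?thesis using that[OF I cr(1) r] by blast
qed

lemma A1_local_grid: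
  fixes \<rho> :: "'a::euclidean_space \<Rightarrow> real"
  assumes \<rho>: "\<And>x. 0 < \<rho> x" and u: "u \<in> A1_rho_theta \<rho> \<theta>" "0 \<le> \<theta>"
  obtains C where "0 < C" "\<And>I \<tau>. I \<in> local_grid \<rho> \<tau> \<Longrightarrow>
    AE x in lebesgue. x \<in> I \<longrightarrow> wvol u I \<le> C * u x * vol I"
proof -
  have w: "weight u" using u by (simp add: A1_rho_theta_def)
  obtain B where B: "\<And>x r. 0 < r \<Longrightarrow> AE y in lebesgue. y \<in> cube x r \<longrightarrow>
      avg (cube x r) u \<le> B * (1 + r / \<rho> x) powr \<theta> * u y"
    using u unfolding A1_rho_theta_def by blast
  \<comment> \<open>\<open>B\<close> is an arbitrary real; the maximum with 1 makes the constant
    positive.\<close>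
  define C where "C = max B 1 * (1 + sqrt (real DIM('a)) / 2) powr \<theta>"
  show ?thesis
  proof (rule that[of C])
    have "1 + sqrt (real DIM('a)) / 2 \<noteq> 0" using dim_pos(2)[where 'a='a] by linarith
    then show "0 < C" unfolding C_def by (intro mult_pos_pos) auto
    fix I \<tau> assume Ig: "I \<in> local_grid \<rho> \<tau>"
    obtain n x c r where I: "I = cell \<tau> n x"
      and Q: "cube c r = cbox (cell_corner \<tau> n x) (cell_corner \<tau> n x + 2 powi (-n) *\<^sub>R One)"
      and r: "0 < r" "(1 + r / \<rho> c) powr \<theta> \<le> (1 + sqrt (real DIM('a)) / 2) powr \<theta>"
      by (rule local_grid_cases[OF \<rho> Ig u(2)], rule that)
    note M = cell_cube_measures[OF w Q, folded I]
    have p: "0 < vol I" unfolding I measure_cell by simp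
    show "AE x in lebesgue. x \<in> I \<longrightarrow> wvol u I \<le> C * u x * vol I"
      using B[OF r(1), of c]
    proof eventually_elim
      case (elim y)
      show ?case
      proof
        assume "y \<in> I"
        then have "y \<in> cube c r" using cell_subset_cbox[of \<tau> n x] I Q by blast
        with elim have "wvol u I / vol I \<le> B * (1 + r / \<rho> c) powr \<theta> * u y"
          using M unfolding avg_def by simp
        also have "\<dots> \<le> C * u y"
          unfolding C_def using r(2) w by (intro mult_right_mono mult_mono) (auto simp: weight_def)
        finally show "wvol u I \<le> C * u y * vol I" using p by (simp add: field_simps)
      qed
    qed
  qed
qed

text \<open>A_1 keeps \<open>u\<close> above \<open>1 / C\<close> times its mean almost everywhere,
  so the low set for \<open>1 / (2 * C)\<close> is null and a single \<open>b\<close> serves every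
  \<open>\<epsilon>\<close>.\<close>

lemma A1_imp_local_Ainf:
  fixes \<rho> :: "'a::euclidean_space \<Rightarrow> real"
  assumes \<rho>: "\<And>x. 0 < \<rho> x" and u: "u \<in> A1_rho_theta \<rho> \<theta>" "0 \<le> \<theta>"
  shows "dyadic_family.local_Ainf (local_grid \<rho> \<tau>) u"
proof -
  interpret dyadic_family "local_grid \<rho> \<tau>" "2 ^ DIM('a)" by (rule dyadic_family_local_grid[OF \<rho>])
  have w: "weight u" using u by (simp add: A1_rho_theta_def)
  obtain C where C: "0 < C" "\<And>I \<tau>. I \<in> local_grid \<rho> \<tau> \<Longrightarrow>
    AE x in lebesgue. x \<in> I \<longrightarrow> wvol u I \<le> C * u x * vol I"
    by (rule A1_local_grid[OF \<rho> u], rule that)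
  have um: "u \<in> borel_measurable lebesgue" using w by (simp add: weight_def)
  have pos: "AE x in lebesgue. 0 < u x" using w by (simp add: weight_def)
  have fin: "emeasure (wmeas u) I < \<infinity>" if "I \<in> local_grid \<rho> \<tau>" for I
    by (rule local_grid_cases[OF \<rho> that u(2)]) (simp only: cell_cube_measures(2)[OF w])
  have "vol {x\<in>I. u x * vol I \<le> 1 / (2 * C) * wvol u I} = 0"
    if I: "I \<in> local_grid \<rho> \<tau>" for I
  proof -
    let ?S = "{x\<in>I. u x * vol I \<le> 1 / (2 * C) * wvol u I}"
    have "{x\<in>space lebesgue. u x * vol I \<le> 1 / (2 * C) * wvol u I} \<in> sets lebesgue"
      using um by measurable
    moreover have "?S = I \<inter> {x\<in>space lebesgue. u x * vol I \<le> 1 / (2 * C) * wvol u I}"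
      by auto
    ultimately have S: "?S \<in> sets lebesgue" using cell_sets[OF I] by (simp only: sets.Int)
    have "AE x in lebesgue. x \<notin> {x\<in>I. u x * vol I \<le> 1 / (2 * C) * wvol u I}"
      using C(2)[OF I] pos
    proof eventually_elim
      case (elim x)
      show ?case
      proof
        assume "x \<in> {x\<in>I. u x * vol I \<le> 1 / (2 * C) * wvol u I}"
        then have x: "x \<in> I" "u x * vol I \<le> 1 / (2 * C) * wvol u I" by auto
        have "1 / (2 * C) * wvol u I \<le> 1 / (2 * C) * (C * u x * vol I)"
          using elim(1) x(1) C(1) by (intro mult_left_mono) auto
        also have "\<dots> = u x * vol I / 2" using C(1) by simp
        finally have "u x * vol I \<le> 0" using x(2) by simp
        moreover have "0 < u x * vol I" using elim(2) cell_pos[OF I] by simp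
        ultimately show False by simp
      qed
    qed
    then have "?S \<in> null_sets lebesgue" by (simp only: AE_iff_null_sets[OF S])
    then show ?thesis by (rule measure_eq_0_null_sets)
  qed
  then have "\<exists>b>0. \<forall>I\<in>local_grid \<rho> \<tau>. vol {x\<in>I. u x * vol I \<le> b * wvol u I}
        \<le> \<epsilon> * vol I" if "0 < \<epsilon>" for \<epsilon>
    using that C(1) by (intro exI[of _ "1 / (2 * C)"]) auto
  then show ?thesis unfolding local_Ainf_def using w fin by (auto simp: weight_def)
qed

text \<open>Since \<open>exp (- h) \<ge> 1 - h\<close>, the function \<open>h = ln (w_I / w)\<close> exceeds \<open>s\<close> on a set of size
  controlled by the integral of \<open>h + exp (- h)\<close>, and \<open>exp (- h) = w / w_I\<close> has mean one.\<close>
lemma Ainf_imp_local_Ainf: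
  fixes \<rho> :: "'a::euclidean_space \<Rightarrow> real"
  assumes \<rho>: "\<And>x. 0 < \<rho> x" and v: "v \<in> Ainf_rho_theta \<rho> \<theta>" "0 \<le> \<theta>"
  shows "dyadic_family.local_Ainf (local_grid \<rho> \<tau>) v"
proof -
  interpret dyadic_family "local_grid \<rho> \<tau>" "2 ^ DIM('a)" by (rule dyadic_family_local_grid[OF \<rho>])
  have w: "weight v" using v by (simp add: Ainf_rho_theta_def)
  then have meas: "v \<in> borel_measurable lebesgue" and nonneg: "\<And>x. 0 \<le> v x"
    and pos: "AE x in lebesgue. 0 < v x" by (auto simp: weight_def)
  obtain B where B: "\<And>x r. 0 < r \<Longrightarrow> set_integrable lebesgue (cube x r) (\<lambda>y. ln (inverse (v y)))"
    "\<And>x r. 0 < r \<Longrightarrow> avg (cube x r) v * exp (avg (cube x r) (\<lambda>y. ln (inverse (v y))))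
         \<le> B * (1 + r / \<rho> x) powr \<theta>"
    using v unfolding Ainf_rho_theta_def by blast
  define C where "C = max B 1 * (1 + sqrt (real DIM('a)) / 2) powr \<theta>"
  have fin: "emeasure (wmeas v) I < \<infinity>" if "I \<in> local_grid \<rho> \<tau>" for I
    by (rule local_grid_cases[OF \<rho> that v(2)]) (simp only: cell_cube_measures(2)[OF w])
  have key: "s * vol {x\<in>I. v x * vol I \<le> exp (- s) * wvol v I}
      \<le> (ln C + 1) * vol I" if I: "I \<in> local_grid \<rho> \<tau>" and s: "0 < s" for I s
  proof -
    obtain n x c r where Ic: "I = cell \<tau> n x"
      and Q: "cube c r = cbox (cell_corner \<tau> n x) (cell_corner \<tau> n x + 2 powi (-n) *\<^sub>R One)"
      and r: "0 < r" "(1 + r / \<rho> c) powr \<theta> \<le> (1 + sqrt (real DIM('a)) / 2) powr \<theta>"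
      by (rule local_grid_cases[OF \<rho> I v(2)], rule that)
    define Q where "Q = cube c r"
    note M = cell_cube_measures[OF w Q, folded Ic Q_def]
    have IQ: "I \<subseteq> Q" unfolding Q_def Ic Q by (rule cell_subset_cbox)
    define m where "m = vol I"
    define W where "W = wvol v I"
    have m: "0 < m" using cell_pos[OF I] by (simp add: m_def)
    have W: "0 < W" unfolding W_def by (rule wmeas_cell_pos[OF meas pos fin[OF I] I])
    define L where "L = (\<integral>y\<in>Q. ln (inverse (v y)) \<partial>lebesgue)"
    have Li: "set_integrable lebesgue Q (\<lambda>y. ln (inverse (v y)))" unfolding Q_def by (rule B(1)[OF r(1)])
    have vi: "set_integrable lebesgue Q v" using w compact_cube[of c r] unfolding Q_def weight_def by blast
    have "W / m * exp (L / m) \<le> B * (1 + r / \<rho> c) powr \<theta>"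
      using B(2)[OF r(1), of c] M unfolding avg_def L_def m_def W_def Q_def by simp
    also have "\<dots> \<le> C" unfolding C_def using r(2) by (intro mult_mono) auto
    finally have C: "W / m * exp (L / m) \<le> C" .
    have "0 < W / m * exp (L / m)" using W m by simp
    with C have "ln (W / m * exp (L / m)) \<le> ln C" by (subst ln_le_cancel_iff) auto
    moreover have "ln (W / m * exp (L / m)) = ln (W / m) + L / m" using W m by (subst ln_mult) auto
    ultimately have lnC: "ln (W / m) + L / m \<le> ln C" by simp
    define S where "S = {x\<in>I. v x * m \<le> exp (- s) * W}"
    have "{x\<in>space lebesgue. v x * m \<le> exp (- s) * W} \<in> sets lebesgue" using meas by measurable
    moreover have "S = I \<inter> {x\<in>space lebesgue. v x * m \<le> exp (- s) * W}" by (auto simp: S_def)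
    ultimately have S: "S \<in> sets lebesgue" "S \<subseteq> I" using cell_sets[OF I] by (auto simp: S_def)
    have Slm: "S \<in> lmeasurable" by (rule fmeasurableI2[OF cell_lmeasurable[OF I] S(2,1)])
    have Qlm: "Q \<in> lmeasurable" unfolding Q_def cube_def by (rule lmeasurable_cbox)
    \<comment> \<open>This is \<open>h + exp (- h)\<close> on \<open>Q\<close> and 0 outside. Almost
      everywhere it is nonnegative and at least \<open>s\<close> on \<open>S\<close>, which gives a
      Chebyshev bound for \<open>S\<close>.\<close>
    define f where "f y = indicator Q y * ln (W / m) + indicator Q y *\<^sub>R ln (inverse (v y)) +
        m / W * (indicator Q y *\<^sub>R v y)" for y
    have i1: "integrable lebesgue (\<lambda>y. indicator Q y * ln (W / m))"
      using Qlm by (intro integrable_mult_left integrable_real_indicator) (auto simp: fmeasurable_def)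
    have i2: "integrable lebesgue (\<lambda>y. m / W * (indicator Q y *\<^sub>R v y))"
      using vi unfolding set_integrable_def by (rule integrable_mult_right)
    have "(\<integral>y. s * indicator S y \<partial>lebesgue) \<le> (\<integral>y. f y \<partial>lebesgue)"
    proof (rule integral_mono_AE)
      show "integrable lebesgue (\<lambda>y. s * indicator S y)"
        using Slm by (intro integrable_mult_right integrable_real_indicator) (auto simp: fmeasurable_def)
      show "integrable lebesgue f"
        unfolding f_def using i1 i2 Li unfolding set_integrable_def by (intro Bochner_Integration.integrable_add)
      show "AE y in lebesgue. s * indicator S y \<le> f y"
        using pos
      proof eventually_elim
        case (elim y)
        show ?case
        proof (cases "y \<in> Q")
          case False
          then have "y \<notin> S" using S(2) IQ by blast
          with False show ?thesis by (simp add: f_def)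
        next
          case True
          define h where "h = ln (W / m) + ln (inverse (v y))"
          have e: "exp (- h) = m / W * v y"
          proof -
            have "h = ln (W / m * inverse (v y))" unfolding h_def using W m elim by (subst ln_mult) auto
            then have "exp h = W / m * inverse (v y)" using W m elim by simp
            then have "inverse (exp h) = m / W * v y" by (simp add: field_simps)
            then show ?thesis by (simp only: exp_minus)
          qed
          have f: "f y = h + exp (- h)" unfolding e using True by (simp add: f_def h_def)
          show ?thesis
          proof (cases "y \<in> S")
            case True
            then have "v y * m \<le> exp (- s) * W" by (simp add: S_def)
            then have "exp (- h) \<le> exp (- s)" unfolding e using W by (simp add: field_simps)
            then have "s \<le> h" by simp
            moreover have "0 \<le> exp (- h)" by simp
            ultimately have "s \<le> f y" unfolding f by linarith
            then show ?thesis using True by simp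
          next
            case False
            have "1 + (- h) \<le> exp (- h)" by (rule exp_ge_add_one_self)
            then have "0 \<le> f y" unfolding f by linarith
            then show ?thesis using False by simp
          qed
        qed
      qed
    qed
    also have "(\<integral>y. s * indicator S y \<partial>lebesgue) = s * vol S" by simp
    also have "(\<integral>y. f y \<partial>lebesgue) = m * ln (W / m) + L + m / W * W"
    proof -
      have "(\<integral>y. f y \<partial>lebesgue) = (\<integral>y. indicator Q y * ln (W / m) \<partial>lebesgue) +
          (\<integral>y. indicator Q y *\<^sub>R ln (inverse (v y)) \<partial>lebesgue) + (\<integral>y. m / W * (indicator Q y *\<^sub>R v y) \<partial>lebesgue)"
        unfolding f_def using i1 i2 Li unfolding set_integrable_def
        by (subst Bochner_Integration.integral_add; (intro Bochner_Integration.integrable_add)?; simp)+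
      then show ?thesis
        using M unfolding L_def m_def W_def set_lebesgue_integral_def by simp
    qed
    also have "m * ln (W / m) + L + m / W * W = m * (ln (W / m) + L / m + 1)"
      using m W by (simp add: field_simps)
    also have "\<dots> \<le> m * (ln C + 1)" using lnC m by (intro mult_left_mono) auto
    finally show ?thesis unfolding S_def m_def W_def by (simp add: mult.commute)
  qed
  have "\<exists>b>0. \<forall>I\<in>local_grid \<rho> \<tau>. vol {x\<in>I. v x * vol I \<le> b * wvol v I}
        \<le> \<epsilon> * vol I" if \<epsilon>: "0 < \<epsilon>" for \<epsilon>
  proof (intro exI[of _ "exp (- max 1 ((ln C + 1) / \<epsilon>))"] conjI ballI)
    \<comment> \<open>This choice makes \<open>(ln C + 1) / ?s\<close> at most
      \<open>\<epsilon>\<close>; the maximum with 1 keeps \<open>?s\<close> positive.\<close>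
    let ?s = "max 1 ((ln C + 1) / \<epsilon>)"
    fix I assume I: "I \<in> local_grid \<rho> \<tau>"
    let ?S = "{x\<in>I. v x * vol I \<le> exp (- ?s) * wvol v I}"
    have "?s * vol ?S \<le> (ln C + 1) * vol I" by (rule key[OF I]) simp
    also have "\<dots> \<le> (?s * \<epsilon>) * vol I"
    proof (rule mult_right_mono)
      have "(ln C + 1) / \<epsilon> \<le> ?s" by simp
      then show "ln C + 1 \<le> ?s * \<epsilon>" using \<epsilon> by (simp only: pos_divide_le_eq)
    qed simp
    finally have "?s * vol ?S \<le> ?s * (\<epsilon> * vol I)" by (simp only: mult.assoc)
    moreover have "0 < ?s" by simp
    ultimately show "vol ?S \<le> \<epsilon> * vol I" by (simp only: mult_le_cancel_left_pos)
  qed simp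
  then show ?thesis unfolding local_Ainf_def using meas pos fin by auto
qed

section \<open>Large cubes\<close>

lemma sigma_finite_lebesgue: "sigma_finite_measure (lebesgue :: 'a::euclidean_space measure)"
proof
  show "\<exists>A. countable A \<and> A \<subseteq> sets lebesgue \<and> \<Union>A = space lebesgue \<and> (\<forall>a\<in>A. emeasure (lebesgue :: 'a measure) a \<noteq> \<infinity>)"
  proof (intro exI[of _ "range (\<lambda>n::nat. cball 0 (real n))"] conjI)
    have "x \<in> (\<Union>n::nat. cball 0 (real n))" for x :: 'a
      using real_arch_simple[of "norm x"] by auto
    then show "(\<Union>n::nat. cball (0::'a) (real n)) = space lebesgue" by auto
    show "\<forall>a\<in>range (\<lambda>n::nat. cball (0::'a) (real n)). emeasure lebesgue a \<noteq> \<infinity>"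
      using fmeasurableD2[OF lmeasurable_cball] by auto
  qed auto
qed

text \<open>Rounding \<open>N0\<close> up to a natural number and weakening the exponent
  \<open>N0 / (N0 + 1)\<close> to 1 leaves a power-type bound from below and linear growth from
  above, with one common constant.\<close>

lemma critical_radius_bounds:
  assumes "critical_radius \<rho>"
  obtains C :: real and N :: nat where "1 \<le> C"
    "\<And>x. 0 < \<rho> x"
    "\<And>x y. \<rho> x \<le> C * \<rho> y * (1 + norm (x - y) / \<rho> x) ^ N"
    "\<And>x y. \<rho> y \<le> C * (\<rho> x + norm (x - y))"
proof -
  obtain C0 N0 where pos: "\<And>x. 0 < \<rho> x" and C0: "C0 > 0" "N0 \<ge> (1::real)"
    and lo: "\<And>x y. inverse C0 * \<rho> x * (1 + norm (x - y) / \<rho> x) powr (- N0) \<le> \<rho> y"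
    and up: "\<And>x y. \<rho> y \<le> C0 * \<rho> x * (1 + norm (x - y) / \<rho> x) powr (N0 / (N0 + 1))"
    using assms unfolding critical_radius_def by blast
  define C where "C = max C0 1"
  define N where "N = nat \<lceil>N0\<rceil>"
  have N: "N0 \<le> real N" unfolding N_def by linarith
  show ?thesis
  proof (rule that[of C N])
    show "1 \<le> C" by (simp add: C_def)
    show "0 < \<rho> x" for x by (rule pos)
    fix x y
    define z where "z = 1 + norm (x - y) / \<rho> x"
    have z: "1 \<le> z" using pos[of x] by (simp add: z_def)
    have "\<rho> x = C0 * (inverse C0 * \<rho> x * z powr (- N0)) * z powr N0"
      using C0 z by (simp add: powr_minus field_simps)
    also have "\<dots> \<le> C0 * \<rho> y * z powr N0"
      using lo[of x y] C0 unfolding z_def[symmetric] by (intro mult_right_mono mult_left_mono) auto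
    also have "\<dots> \<le> C * \<rho> y * z ^ N"
    proof (rule mult_mono)
      have "z powr N0 \<le> z powr real N" using N z by (rule powr_mono)
      then show "z powr N0 \<le> z ^ N" using z by (simp add: powr_realpow)
      show "C0 * \<rho> y \<le> C * \<rho> y" using pos[of y] by (intro mult_right_mono) (auto simp: C_def)
    qed (use pos[of y] in \<open>auto simp: C_def\<close>)
    finally show "\<rho> x \<le> C * \<rho> y * (1 + norm (x - y) / \<rho> x) ^ N" by (simp add: z_def)
    have "z powr (N0 / (N0 + 1)) \<le> z powr 1" using C0 z by (intro powr_mono) auto
    then have le: "z powr (N0 / (N0 + 1)) \<le> z" using z by simp
    have "\<rho> y \<le> C0 * \<rho> x * z powr (N0 / (N0 + 1))" using up[of y x] by (simp add: z_def)
    also have "\<dots> \<le> C * \<rho> x * z"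
      using le pos[of x] C0 by (intro mult_mono mult_nonneg_nonneg) (auto simp: C_def)
    also have "\<dots> = C * (\<rho> x + norm (x - y))" using pos[of x] by (simp add: z_def field_simps)
    finally show "\<rho> y \<le> C * (\<rho> x + norm (x - y))" .
  qed
qed

text \<open>A critical radius function need not be measurable, but it is comparable to a Lipschitz function.\<close>
lemma lipschitz_regularization:
  fixes \<rho> :: "'a::euclidean_space \<Rightarrow> real"
  assumes C: "1 \<le> C" and pos: "\<And>x. 0 < \<rho> x" and up: "\<And>x y. \<rho> y \<le> C * (\<rho> x + norm (x - y))"
  obtains \<rho>' :: "'a \<Rightarrow> real" where "continuous_on UNIV \<rho>'" "\<And>x. 0 < \<rho>' x" "\<And>x. \<rho>' x \<le> \<rho> x" "\<And>x. \<rho> x \<le> C * \<rho>' x"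
proof -
  \<comment> \<open>Inf-convolution with the norm, the largest 1-Lipschitz minorant of
    \<open>\<rho>\<close>; the linear bound \<open>up\<close> keeps it above
    \<open>\<rho> / C\<close>.\<close>
  define r where "r y = (INF z. \<rho> z + norm (z - y))" for y
  have bdd: "bdd_below (range (\<lambda>z. \<rho> z + norm (z - y)))" for y
    using pos by (intro bdd_belowI[of _ 0]) (auto simp: add_nonneg_nonneg less_imp_le)
  have le: "r y \<le> \<rho> z + norm (z - y)" for y z
    unfolding r_def by (rule cINF_lower[OF bdd]) simp
  have low: "\<rho> y / C \<le> r y" for y
    unfolding r_def using up C by (intro cINF_greatest) (auto simp: field_simps)
  have lip: "r y \<le> r y' + norm (y - y')" for y y'
  proof -
    have "r y - norm (y - y') \<le> \<rho> z + norm (z - y')" for z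
      using le[of y z] norm_triangle_ineq[of "z - y'" "y' - y"] by (simp add: norm_minus_commute)
    then have "r y - norm (y - y') \<le> r y'" unfolding r_def[of y'] by (intro cINF_greatest) auto
    then show ?thesis by simp
  qed
  show ?thesis
  proof (rule that[of r])
    have "\<bar>r y - r y'\<bar> \<le> norm (y - y')" for y y'
      using lip[of y y'] lip[of y' y] by (simp add: norm_minus_commute abs_le_iff)
    then show "continuous_on UNIV r"
      unfolding continuous_on_iff dist_norm real_norm_def by (meson le_less_trans)
    show "0 < r x" for x using low[of x] pos[of x] C by (meson divide_pos_pos less_le_trans zero_less_one)
    show "r x \<le> \<rho> x" for x using le[of x x] by simp
    show "\<rho> x \<le> C * r x" for x using low[of x] C by (simp add: field_simps)
  qed
qed

section \<open>Geometry of cubes and balls\<close>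

lemma mem_cube_iff:
  fixes x :: "'a::euclidean_space"
  shows "y \<in> cube x r \<longleftrightarrow> (\<forall>b\<in>Basis. \<bar>(y - x) \<bullet> b\<bar> \<le> r / sqrt (real DIM('a)))"
  unfolding cube_def mem_box by (intro ball_cong refl) (auto simp: inner_add_left inner_diff_left abs_le_iff)

text \<open>The radius of a cube is half its diagonal, so the cube lies in the ball of that
  radius.\<close>

lemma norm_le_cube:
  fixes x :: "'a::euclidean_space"
  assumes "y \<in> cube x r" "0 < r"
  shows "norm (y - x) \<le> r"
proof -
  have "(norm (y - x))\<^sup>2 = (y - x) \<bullet> (y - x)" by (rule power2_norm_eq_inner)
  also have "\<dots> = (\<Sum>b\<in>Basis. ((y - x) \<bullet> b) * ((y - x) \<bullet> b))" by (rule euclidean_inner)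
  also have "\<dots> = (\<Sum>b\<in>Basis. ((y - x) \<bullet> b)\<^sup>2)" by (simp only: power2_eq_square)
  also have "\<dots> \<le> (\<Sum>b\<in>(Basis::'a set). (r / sqrt (real DIM('a)))\<^sup>2)"
  proof (rule sum_mono)
    fix b :: 'a assume "b \<in> Basis"
    then have "\<bar>(y - x) \<bullet> b\<bar> \<le> r / sqrt (real DIM('a))" using assms(1) by (simp add: mem_cube_iff)
    then have "\<bar>(y - x) \<bullet> b\<bar>\<^sup>2 \<le> (r / sqrt (real DIM('a)))\<^sup>2" by (intro power_mono) auto
    then show "((y - x) \<bullet> b)\<^sup>2 \<le> (r / sqrt (real DIM('a)))\<^sup>2" by simp
  qed
  also have "\<dots> = r\<^sup>2" by (simp add: power_divide)
  finally show ?thesis by (rule power2_le_imp_le) (use assms(2) in simp)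
qed

lemma cball_subset_cube:
  fixes x :: "'a::euclidean_space"
  assumes "sqrt (real DIM('a)) * (R + norm (y - x)) \<le> r"
  shows "cball y R \<subseteq> cube x r"
proof
  fix z assume "z \<in> cball y R"
  then have "norm (z - y) \<le> R" by (simp add: dist_norm norm_minus_commute)
  then have n: "norm (z - x) \<le> R + norm (y - x)"
    using norm_triangle_ineq[of "z - y" "y - x"] by simp
  have "R + norm (y - x) \<le> r / sqrt (real DIM('a))"
    using assms dim_pos[where 'a='a] by (simp add: field_simps)
  then show "z \<in> cube x r"
    unfolding mem_cube_iff using n Basis_le_norm[of _ "z - x"] by (meson order_trans)
qed

lemma emeasure_cube:
  fixes x :: "'a::euclidean_space"
  assumes "0 < r"
  shows "emeasure lebesgue (cube x r) = ennreal ((2 * (r / sqrt (real DIM('a)))) ^ DIM('a))"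
proof -
  have "(2 * (r / sqrt (real DIM('a)))) = (x + (r / sqrt (real DIM('a))) *\<^sub>R One - (x - (r / sqrt (real DIM('a))) *\<^sub>R One)) \<bullet> b"
    if "b \<in> Basis" for b :: 'a
    using that by (simp add: inner_add_left inner_diff_left)
  then show ?thesis
    using assms unfolding cube_def
    by (subst emeasure_completion) (auto simp: emeasure_lborel_cbox_eq inner_add_left inner_diff_left)
qed

text \<open>The exponent \<open>\<theta>\<close> is absorbed into a natural exponent, and the ball is compared with one
  of countably many cubes so that a single null set suffices.\<close>
lemma A1_pointwise:
  fixes \<rho> \<rho>' u :: "'a::euclidean_space \<Rightarrow> real"
  assumes C: "1 \<le> C" and pos: "\<And>x. 0 < \<rho> x"
    and lower: "\<And>x y. \<rho> x \<le> C * \<rho> y * (1 + norm (x - y) / \<rho> x) ^ N"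
    and \<rho>': "\<And>x. 0 < \<rho>' x" "\<And>x. \<rho>' x \<le> \<rho> x"
    and u: "u \<in> A1_rho_theta \<rho> \<theta>" and T: "\<theta> \<le> real T"
  obtains B where "0 < B" "AE y in lebesgue. \<forall>R\<ge>\<rho>' y.
      emeasure (wmeas u) (cball y R) \<le> ennreal (B * R ^ DIM('a) * (R / \<rho>' y) ^ T * u y)"
proof -
  have w: "weight u" using u by (simp add: A1_rho_theta_def)
  have nonneg: "0 \<le> u x" for x using w by (simp add: weight_def)
  obtain A where A: "\<And>x r. 0 < r \<Longrightarrow> AE y in lebesgue. y \<in> cube x r \<longrightarrow>
      avg (cube x r) u \<le> A * (1 + r / \<rho> x) powr \<theta> * u y"
    using u unfolding A1_rho_theta_def by blast
  define A' where "A' = max A 1"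
  obtain S :: "'a set" where S: "countable S" "\<And>U. open U \<Longrightarrow> U \<noteq> {} \<Longrightarrow> \<exists>d\<in>S. d \<in> U"
    using countable_dense_setE by blast
  let ?d = "sqrt (real DIM('a))"
  have d: "0 < ?d" "1 \<le> ?d" using dim_pos[where 'a='a] by (auto simp: Suc_leI)
  \<comment> \<open>From \<open>r \<le> 4 * ?d * R\<close>,
    \<open>\<rho>' y \<le> C * 2 ^ N * \<rho> q\<close> and \<open>1 \<le> R / \<rho>' y\<close>; it
    bounds \<open>1 + r / \<rho> q\<close> by a multiple of \<open>R / \<rho>' y\<close>.\<close>
  define E where "E = 1 + 4 * ?d * (C * 2 ^ N)"
  have E: "0 < E" using d C by (simp add: E_def add_pos_nonneg)
  define B where "B = A' * E ^ T * 8 ^ DIM('a)"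
  have "AE y in lebesgue. \<forall>p\<in>S \<times> (UNIV::int set). y \<in> cube (fst p) (2 powi snd p) \<longrightarrow>
      avg (cube (fst p) (2 powi snd p)) u \<le> A * (1 + 2 powi snd p / \<rho> (fst p)) powr \<theta> * u y"
    using S(1) by (subst AE_ball_countable) (auto intro!: A countable_SIGMA)
  then have "AE y in lebesgue. \<forall>R\<ge>\<rho>' y.
      emeasure (wmeas u) (cball y R) \<le> ennreal (B * R ^ DIM('a) * (R / \<rho>' y) ^ T * u y)"
  proof eventually_elim
    case (elim y)
    show ?case
    proof (intro allI impI)
      fix R assume R: "\<rho>' y \<le> R"
      then have R0: "0 < R" using \<rho>'(1)[of y] by linarith
      obtain q where q: "q \<in> S" "q \<in> ball y (\<rho>' y)"
        using S(2)[OF open_ball, of y "\<rho>' y"] \<rho>'(1)[of y] by auto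
      then have nq: "norm (y - q) < \<rho>' y" by (simp add: dist_norm)
      \<comment> \<open>The centre \<open>q\<close> is within \<open>\<rho>' y \<le> R\<close> of
        \<open>y\<close>, so half-side \<open>2 * R\<close> is enough to contain the ball; rounding
        the radius up to a power of 2 keeps the cubes countable.\<close>
      have "0 < 2 * ?d * R" using d R0 by simp
      then obtain k :: int where k: "2 powi k < 2 * ?d * R" "2 * ?d * R \<le> 2 powi (k + 1)"
        using ex_power_int_between[of 2 "2 * ?d * R"] by auto
      define r where "r = (2::real) powi (k + 1)"
      have "r = 2 * 2 powi k" by (simp add: r_def power_int_add)
      then have r: "2 * ?d * R \<le> r" "r \<le> 4 * ?d * R" "0 < r"
        using k unfolding r_def[symmetric] by (simp, linarith, simp)
      have sub: "cball y R \<subseteq> cube q r"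
      proof (rule cball_subset_cube)
        have "?d * (R + norm (y - q)) \<le> ?d * (R + R)" using nq R d by (intro mult_left_mono) auto
        also have "\<dots> = 2 * ?d * R" by simp
        also note r(1)
        finally show "?d * (R + norm (y - q)) \<le> r" .
      qed
      then have yq: "y \<in> cube q r" using R0 by (meson centre_in_cball less_imp_le subsetD)
      have "(q, k + 1) \<in> S \<times> UNIV" using q by simp
      from bspec[OF elim this] yq
      have av: "avg (cube q r) u \<le> A * (1 + r / \<rho> q) powr \<theta> * u y" by (simp add: r_def)
      have rq: "1 + r / \<rho> q \<le> E * (R / \<rho>' y)"
      proof -
        have "norm (y - q) / \<rho> y \<le> 1" using nq \<rho>'(2)[of y] pos[of y] by (simp add: field_simps)
        then have "(1 + norm (y - q) / \<rho> y) ^ N \<le> 2 ^ N" using pos[of y] by (intro power_mono) auto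
        then have "C * \<rho> q * (1 + norm (y - q) / \<rho> y) ^ N \<le> C * \<rho> q * 2 ^ N"
          using C pos[of q] by (intro mult_left_mono) auto
        then have "\<rho>' y \<le> C * 2 ^ N * \<rho> q" using lower[of y q] \<rho>'(2)[of y] by (simp add: mult_ac)
        then have "1 / \<rho> q \<le> C * 2 ^ N / \<rho>' y" using pos[of q] \<rho>'(1)[of y] by (simp add: field_simps)
        then have "r * (1 / \<rho> q) \<le> (4 * ?d * R) * (C * 2 ^ N / \<rho>' y)"
          using r pos[of q] d R0 by (intro mult_mono) auto
        moreover have "1 \<le> R / \<rho>' y" using R \<rho>'(1)[of y] by simp
        ultimately show ?thesis by (simp add: E_def algebra_simps)
      qed
      have "(1 + r / \<rho> q) powr \<theta> \<le> (1 + r / \<rho> q) powr real T"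
        using r pos[of q] T by (intro powr_mono) auto
      also have "\<dots> = (1 + r / \<rho> q) ^ T" using r pos[of q] by (intro powr_realpow) (simp add: add_pos_pos)
      also have "\<dots> \<le> (E * (R / \<rho>' y)) ^ T" using rq r pos[of q] by (intro power_mono) auto
      finally have pw: "(1 + r / \<rho> q) powr \<theta> \<le> (E * (R / \<rho>' y)) ^ T" .
      have "avg (cube q r) u \<le> A' * (E * (R / \<rho>' y)) ^ T * u y"
        using av pw nonneg[of y]
        by (elim order_trans) (auto simp: A'_def intro!: mult_right_mono mult_mono)
      moreover have m: "vol (cube q r) = (2 * (r / ?d)) ^ DIM('a)"
        using emeasure_cube[OF r(3), of q] r d by (simp add: measure_def)
      moreover have "0 < (2 * (r / ?d)) ^ DIM('a)" using r d by simp
      ultimately have "wvol u (cube q r) \<le> A' * (E * (R / \<rho>' y)) ^ T * u y * (2 * (r / ?d)) ^ DIM('a)"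
        unfolding avg_def weight_measure[OF w compact_cube] by (simp add: pos_divide_le_eq)
      also have "\<dots> \<le> A' * (E * (R / \<rho>' y)) ^ T * u y * (8 * R) ^ DIM('a)"
      proof (intro mult_left_mono power_mono)
        show "2 * (r / ?d) \<le> 8 * R" using r d by (simp add: field_simps)
        show "0 \<le> A' * (E * (R / \<rho>' y)) ^ T * u y"
          using nonneg[of y] E R0 \<rho>'(1)[of y] by (intro mult_nonneg_nonneg zero_le_power) (auto simp: A'_def)
      qed (use r d in auto)
      also have "\<dots> = B * R ^ DIM('a) * (R / \<rho>' y) ^ T * u y"
        by (simp add: B_def power_mult_distrib mult_ac power_divide)
      finally have le: "wvol u (cube q r) \<le> B * R ^ DIM('a) * (R / \<rho>' y) ^ T * u y" .
      have "emeasure (wmeas u) (cball y R) \<le> emeasure (wmeas u) (cube q r)"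
        using sub by (intro emeasure_mono) (auto simp: cube_def)
      also have "\<dots> = ennreal (wvol u (cube q r))"
        unfolding weight_emeasure[OF w compact_cube] weight_measure[OF w compact_cube] ..
      also have "\<dots> \<le> ennreal (B * R ^ DIM('a) * (R / \<rho>' y) ^ T * u y)" by (rule ennreal_leI[OF le])
      finally show "emeasure (wmeas u) (cball y R) \<le> ennreal (B * R ^ DIM('a) * (R / \<rho>' y) ^ T * u y)" .
    qed
  qed
  moreover have "0 < B" using E by (simp add: B_def A'_def)
  ultimately show ?thesis using that by blast
qed

text \<open>For positive \<open>p\<close> this is comparable to (1 + |x - y| / \<rho>'(y))^(-p)
  divided by \<rho>'(y)^d, with d the dimension. It is written as a series over balls so that the
  bound for the \<open>u\<close>-measure of each ball enters directly.\<close>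

definition big_kernel :: "('a::euclidean_space \<Rightarrow> real) \<Rightarrow> nat \<Rightarrow> 'a \<Rightarrow> 'a \<Rightarrow> ennreal" where
  "big_kernel \<rho>' p x y = (\<Sum>j. ennreal ((1 / 2 ^ p) ^ j / \<rho>' y ^ DIM('a)) * indicator (cball y (2 ^ j * \<rho>' y)) x)"

lemma indicator_cball_measurable:
  fixes f :: "'a::euclidean_space \<Rightarrow> real"
  assumes "continuous_on UNIV f"
  shows "(\<lambda>(x, y). indicator (cball y (f y)) x :: ennreal) \<in> borel_measurable (lebesgue \<Otimes>\<^sub>M lebesgue)"
proof -
  have [measurable]: "f \<in> borel_measurable lebesgue"
    using assms by (intro measurable_completion) (simp add: borel_measurable_continuous_onI)
  have [measurable]: "(\<lambda>x::'a. x) \<in> lebesgue \<rightarrow>\<^sub>M borel" by (intro measurable_completion) simp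
  have "(\<lambda>(x, y). indicator {p. norm (fst p - snd p) \<le> f (snd p)} (x, y) :: ennreal) \<in> borel_measurable (lebesgue \<Otimes>\<^sub>M lebesgue)"
    by measurable
  then show ?thesis
    by (simp add: indicator_def dist_norm norm_minus_commute case_prod_beta)
qed

text \<open>After Tonelli, \<open>u\<close> is integrated against the kernel for fixed
  \<open>y\<close>: the ball with index \<open>j\<close> contributes
  \<open>2 ^ (j * (DIM('a) + T))\<close> against the weight \<open>(1 / 2 ^ p) ^ j\<close>. The
  choice of \<open>p\<close> leaves a geometric series of ratio 1/2, whose sum is the factor
  2.\<close>

lemma big_kernel_bound:
  fixes \<rho>' u g :: "'a::euclidean_space \<Rightarrow> real"
  assumes \<rho>': "continuous_on UNIV \<rho>'" "\<And>x. 0 < \<rho>' x"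
    and u: "u \<in> borel_measurable lebesgue" "\<And>x. 0 \<le> u x" and g: "g \<in> borel_measurable lebesgue" "\<And>x. 0 \<le> g x"
    and B: "0 < B" "AE y in lebesgue. \<forall>R\<ge>\<rho>' y.
      emeasure (wmeas u) (cball y R) \<le> ennreal (B * R ^ DIM('a) * (R / \<rho>' y) ^ T * u y)"
    and p: "p = DIM('a) + T + 1"
  shows "(\<lambda>x. \<integral>\<^sup>+y. ennreal (g y) * big_kernel \<rho>' p x y \<partial>lebesgue) \<in> borel_measurable lebesgue"
    and "(\<integral>\<^sup>+x. ennreal (u x) * (\<integral>\<^sup>+y. ennreal (g y) * big_kernel \<rho>' p x y \<partial>lebesgue) \<partial>lebesgue)
      \<le> ennreal (2 * B) * (\<integral>\<^sup>+y. ennreal (g y * u y) \<partial>lebesgue)"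
proof -
  interpret L: sigma_finite_measure "lebesgue :: 'a measure" by (rule sigma_finite_lebesgue)
  interpret P: pair_sigma_finite "lebesgue :: 'a measure" "lebesgue :: 'a measure" ..
  note [measurable] = u(1) g(1)
  have [measurable]: "\<rho>' \<in> borel_measurable lebesgue"
    using \<rho>'(1) by (intro measurable_completion) (simp add: borel_measurable_continuous_onI)
  have ind[measurable]: "(\<lambda>(x, y). indicator (cball y (2 ^ j * \<rho>' y)) x :: ennreal) \<in> borel_measurable (lebesgue \<Otimes>\<^sub>M lebesgue)" for j
    by (rule indicator_cball_measurable) (intro continuous_intros \<rho>'(1))
  have kern[measurable]: "(\<lambda>(x, y). big_kernel \<rho>' p x y) \<in> borel_measurable (lebesgue \<Otimes>\<^sub>M lebesgue)"
    unfolding big_kernel_def by measurable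
  show "(\<lambda>x. \<integral>\<^sup>+y. ennreal (g y) * big_kernel \<rho>' p x y \<partial>lebesgue) \<in> borel_measurable lebesgue"
    by measurable
  have "(\<integral>\<^sup>+x. ennreal (u x) * (\<integral>\<^sup>+y. ennreal (g y) * big_kernel \<rho>' p x y \<partial>lebesgue) \<partial>lebesgue)
      = (\<integral>\<^sup>+x. \<integral>\<^sup>+y. ennreal (u x) * (ennreal (g y) * big_kernel \<rho>' p x y) \<partial>lebesgue \<partial>lebesgue)"
    by (intro nn_integral_cong nn_integral_cmult[symmetric]) measurable
  also have "\<dots> = (\<integral>\<^sup>+y. \<integral>\<^sup>+x. ennreal (u x) * (ennreal (g y) * big_kernel \<rho>' p x y) \<partial>lebesgue \<partial>lebesgue)"
    by (rule P.Fubini'[symmetric]) measurable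
  also have "\<dots> \<le> (\<integral>\<^sup>+y. ennreal (2 * B) * ennreal (g y * u y) \<partial>lebesgue)"
  proof (rule nn_integral_mono_AE)
    show "AE y in lebesgue. (\<integral>\<^sup>+x. ennreal (u x) * (ennreal (g y) * big_kernel \<rho>' p x y) \<partial>lebesgue)
        \<le> ennreal (2 * B) * ennreal (g y * u y)"
      using B(2)
    proof eventually_elim
      case (elim y)
      have r: "0 < \<rho>' y" by (rule \<rho>'(2))
      let ?c = "\<lambda>j. (1 / 2 ^ p) ^ j / \<rho>' y ^ DIM('a)"
      have "(\<integral>\<^sup>+x. ennreal (u x) * big_kernel \<rho>' p x y \<partial>lebesgue)
          = (\<integral>\<^sup>+x. (\<Sum>j. ennreal (?c j) * (ennreal (u x) * indicator (cball y (2 ^ j * \<rho>' y)) x)) \<partial>lebesgue)"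
        unfolding big_kernel_def by (subst ennreal_suminf_cmult[symmetric]) (simp add: mult_ac)
      also have "\<dots> = (\<Sum>j. \<integral>\<^sup>+x. ennreal (?c j) * (ennreal (u x) * indicator (cball y (2 ^ j * \<rho>' y)) x) \<partial>lebesgue)"
        by (rule nn_integral_suminf) measurable
      also have "\<dots> = (\<Sum>j. ennreal (?c j) * emeasure (wmeas u) (cball y (2 ^ j * \<rho>' y)))"
      proof (rule suminf_cong)
        fix j
        have "(\<integral>\<^sup>+x. ennreal (?c j) * (ennreal (u x) * indicator (cball y (2 ^ j * \<rho>' y)) x) \<partial>lebesgue)
            = ennreal (?c j) * (\<integral>\<^sup>+x. ennreal (u x) * indicator (cball y (2 ^ j * \<rho>' y)) x \<partial>lebesgue)"
          by (rule nn_integral_cmult) measurable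
        then show "(\<integral>\<^sup>+x. ennreal (?c j) * (ennreal (u x) * indicator (cball y (2 ^ j * \<rho>' y)) x) \<partial>lebesgue)
            = ennreal (?c j) * emeasure (wmeas u) (cball y (2 ^ j * \<rho>' y))"
          by (subst emeasure_density) auto
      qed
      also have "\<dots> \<le> (\<Sum>j. ennreal (B * u y) * ennreal ((1/2) ^ j))"
      proof (intro suminf_le summableI)
        fix j
        have "\<rho>' y \<le> 2 ^ j * \<rho>' y" using r by simp
        with elim have "emeasure (wmeas u) (cball y (2 ^ j * \<rho>' y))
            \<le> ennreal (B * (2 ^ j * \<rho>' y) ^ DIM('a) * (2 ^ j * \<rho>' y / \<rho>' y) ^ T * u y)" by blast
        then have "ennreal (?c j) * emeasure (wmeas u) (cball y (2 ^ j * \<rho>' y))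
            \<le> ennreal (?c j) * ennreal (B * (2 ^ j * \<rho>' y) ^ DIM('a) * (2 ^ j * \<rho>' y / \<rho>' y) ^ T * u y)"
          by (intro mult_left_mono) auto
        also have "\<dots> = ennreal (?c j * (B * (2 ^ j * \<rho>' y) ^ DIM('a) * (2 ^ j * \<rho>' y / \<rho>' y) ^ T * u y))"
          using r B(1) u(2) by (intro ennreal_mult[symmetric]) auto
        also have "?c j * (B * (2 ^ j * \<rho>' y) ^ DIM('a) * (2 ^ j * \<rho>' y / \<rho>' y) ^ T * u y) = B * u y * (1/2) ^ j"
        proof -
          define e where "e = (2::real) ^ j"
          have e: "0 < e" by (simp add: e_def)
          have "((2::real) ^ p) ^ j = e ^ p" unfolding e_def by (simp add: power_mult[symmetric] mult.commute)
          also have "\<dots> = e ^ DIM('a) * e ^ T * e" by (simp add: p power_add)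
          finally have 1: "(1 / 2 ^ p) ^ j = 1 / (e ^ DIM('a) * e ^ T * e)" by (simp add: power_divide)
          have 2: "2 ^ j * \<rho>' y / \<rho>' y = e" "2 ^ j * \<rho>' y = e * \<rho>' y" "(1/2) ^ j = 1 / e"
            using r by (simp_all add: e_def power_divide)
          show ?thesis unfolding 1 2(1) unfolding 2 power_mult_distrib using r e by (simp add: field_simps)
        qed
        also have "ennreal (B * u y * (1/2) ^ j) = ennreal (B * u y) * ennreal ((1/2) ^ j)"
          using B(1) u(2) by (intro ennreal_mult) auto
        finally show "ennreal (?c j) * emeasure (wmeas u) (cball y (2 ^ j * \<rho>' y)) \<le> ennreal (B * u y) * ennreal ((1/2) ^ j)" .
      qed
      also have "\<dots> = ennreal (B * u y) * (\<Sum>j. ennreal ((1/2) ^ j))" by (rule ennreal_suminf_cmult)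
      also have "(\<Sum>j. ennreal ((1/2) ^ j)) = ennreal (1 / (1 - 1/2))"
        by (rule nn_integral_geometric[unfolded nn_integral_count_space_nat]) auto
      finally have *: "(\<integral>\<^sup>+x. ennreal (u x) * big_kernel \<rho>' p x y \<partial>lebesgue) \<le> ennreal (B * u y) * ennreal (1 / (1 - 1/2))" .
      have "(\<integral>\<^sup>+x. ennreal (u x) * (ennreal (g y) * big_kernel \<rho>' p x y) \<partial>lebesgue)
          = (\<integral>\<^sup>+x. ennreal (g y) * (ennreal (u x) * big_kernel \<rho>' p x y) \<partial>lebesgue)"
        by (simp only: mult.left_commute)
      also have "\<dots> = ennreal (g y) * (\<integral>\<^sup>+x. ennreal (u x) * big_kernel \<rho>' p x y \<partial>lebesgue)"
        by (rule nn_integral_cmult) measurable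
      also have "\<dots> \<le> ennreal (g y) * (ennreal (B * u y) * ennreal (1 / (1 - 1/2)))"
        using * by (intro mult_left_mono) auto
      also have "\<dots> = ennreal (2 * B) * ennreal (g y * u y)"
        using B(1) u(2) g(2) by (simp add: ennreal_mult[symmetric] mult_ac del: ennreal_numeral)
      finally show ?case .
    qed
  qed
  also have "\<dots> = ennreal (2 * B) * (\<integral>\<^sup>+y. ennreal (g y * u y) \<partial>lebesgue)"
    by (rule nn_integral_cmult) measurable
  finally show "(\<integral>\<^sup>+x. ennreal (u x) * (\<integral>\<^sup>+y. ennreal (g y) * big_kernel \<rho>' p x y \<partial>lebesgue) \<partial>lebesgue)
      \<le> ennreal (2 * B) * (\<integral>\<^sup>+y. ennreal (g y * u y) \<partial>lebesgue)" .
qed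

text \<open>The decay exponent \<open>(N + 1) p\<close> compensates the possible growth \<open>z ^ (N + 1)\<close> of
  \<open>|x - y| / \<rho> y\<close> in terms of \<open>z = 1 + r / \<rho> x\<^sub>0\<close>.\<close>
lemma big_cube_kernel:
  fixes \<rho> \<rho>' :: "'a::euclidean_space \<Rightarrow> real"
  assumes C: "1 \<le> C" and pos: "\<And>x. 0 < \<rho> x"
    and lower: "\<And>x y. \<rho> x \<le> C * \<rho> y * (1 + norm (x - y) / \<rho> x) ^ N"
    and upper: "\<And>x y. \<rho> y \<le> C * (\<rho> x + norm (x - y))"
    and \<rho>': "\<And>x. 0 < \<rho>' x" "\<And>x. \<rho>' x \<le> \<rho> x" "\<And>x. \<rho> x \<le> C * \<rho>' x"
    and c: "0 < c"
  obtains K where "0 < K" "\<And>x x\<^sub>0 y r. 0 < r \<Longrightarrow> x \<in> cube x\<^sub>0 r \<Longrightarrow> y \<in> cube x\<^sub>0 r \<Longrightarrow> c * \<rho> x\<^sub>0 \<le> r \<Longrightarrow>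
    ennreal ((1 + r / \<rho> x\<^sub>0) powr (- real ((N + 1) * p)) / (2 * (r / sqrt (real DIM('a)))) ^ DIM('a))
      \<le> ennreal K * big_kernel \<rho>' p x y"
proof -
  let ?d = "sqrt (real DIM('a))"
  have d: "0 < ?d" by (rule dim_pos)
  \<comment> \<open>\<open>A\<close> stems from the power \<open>(2 * X) ^ p\<close> below, and
    \<open>H\<close> from \<open>\<rho>' y \<le> H * r\<close>, where it enters that the cube is
    large.\<close>
  define A where "A = 4 * C * C"
  define H where "H = C * (1 / c + 1)"
  have AH: "0 < A" "0 < H" using C c by (auto simp: A_def H_def add_pos_pos)
  define K where "K = A ^ p * (?d / 2 * H) ^ DIM('a)"
  have K: "0 < K" using AH d by (simp add: K_def)
  show ?thesis
  proof (rule that[OF K])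
    fix x x\<^sub>0 y :: 'a and r
    assume r: "0 < r" and x: "x \<in> cube x\<^sub>0 r" and y: "y \<in> cube x\<^sub>0 r" and big: "c * \<rho> x\<^sub>0 \<le> r"
    define z where "z = 1 + r / \<rho> x\<^sub>0"
    have z: "1 \<le> z" using r pos[of x\<^sub>0] by (simp add: z_def)
    have nx: "norm (x - x\<^sub>0) \<le> r" and ny: "norm (x\<^sub>0 - y) \<le> r"
      using norm_le_cube[OF x r] norm_le_cube[OF y r] by (auto simp: norm_minus_commute)
    have nxy: "norm (x - y) \<le> 2 * r" using norm_triangle_ineq[of "x - x\<^sub>0" "x\<^sub>0 - y"] nx ny by simp
    have l: "\<rho> x\<^sub>0 \<le> C * C * z ^ N * \<rho>' y"
    proof -
      have "\<rho> x\<^sub>0 \<le> C * \<rho> y * (1 + norm (x\<^sub>0 - y) / \<rho> x\<^sub>0) ^ N" by (rule lower)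
      also have "\<dots> \<le> C * \<rho> y * z ^ N"
        using ny pos[of x\<^sub>0] pos[of y] C unfolding z_def
        by (intro mult_left_mono power_mono add_left_mono divide_right_mono) auto
      also have "\<dots> \<le> C * (C * \<rho>' y) * z ^ N"
        using \<rho>'(3)[of y] C z by (intro mult_right_mono mult_left_mono) auto
      finally show ?thesis by (simp add: mult_ac)
    qed
    \<comment> \<open>\<open>X\<close> bounds \<open>norm (x - y) / \<rho>' y\<close>: one factor
      \<open>z\<close> comes from \<open>r / \<rho> x\<^sub>0\<close>, and \<open>N\<close> more
      from comparing \<open>\<rho> x\<^sub>0\<close> with \<open>\<rho>' y\<close>.\<close>
    define X where "X = 2 * C * C * z ^ (N + 1)"
    have X: "1 \<le> X"
    proof -
      have "1 * 1 \<le> C * C" using C by (intro mult_mono) auto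
      moreover have "1 \<le> z ^ (N + 1)" using z by (rule one_le_power)
      ultimately have "1 * 1 \<le> (2 * (C * C)) * z ^ (N + 1)" by (intro mult_mono) auto
      then show ?thesis by (simp add: X_def mult_ac)
    qed
    have xyX: "norm (x - y) \<le> X * \<rho>' y"
    proof -
      have "2 * r \<le> 2 * (z * \<rho> x\<^sub>0)" using pos[of x\<^sub>0] by (simp add: z_def field_simps)
      also have "\<dots> \<le> 2 * (z * (C * C * z ^ N * \<rho>' y))" using l z by (intro mult_left_mono) auto
      finally show ?thesis using nxy by (simp add: X_def mult_ac)
    qed
    obtain k :: int where k: "2 powi k < X" "X \<le> 2 powi (k + 1)"
      using ex_power_int_between[of 2 X] X by auto
    have "0 \<le> k + 1"
    proof (rule ccontr)
      assume "\<not> 0 \<le> k + 1"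
      then have "(2::real) powi (k + 1) < 2 powi 0" by (intro power_int_strict_increasing) auto
      with k(2) X show False by simp
    qed
    \<comment> \<open>The ball belonging to a power of 2 between \<open>X\<close> and
      \<open>2 * X\<close> contains \<open>x\<close>, so a single term of the series suffices;
      \<open>X \<ge> 1\<close> makes the exponent a natural number.\<close>
    define j where "j = nat (k + 1)"
    have j: "X \<le> 2 ^ j" "2 ^ j \<le> 2 * X"
    proof -
      have "(2::real) powi (k + 1) = 2 powi (int j)" using \<open>0 \<le> k + 1\<close> by (simp add: j_def)
      then have e: "(2::real) powi (k + 1) = 2 ^ j" by simp
      show "X \<le> 2 ^ j" using k(2) e by simp
      have "(2::real) powi (k + 1) = 2 powi k * 2" by (simp add: power_int_add)
      then show "2 ^ j \<le> 2 * X" using k(1) e by simp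
    qed
    have "norm (x - y) \<le> 2 ^ j * \<rho>' y"
      by (rule order_trans[OF xyX mult_right_mono[OF j(1)]]) (use \<rho>'(1)[of y] in simp)
    then have mem: "x \<in> cball y (2 ^ j * \<rho>' y)" by (simp add: dist_norm norm_minus_commute)
    have up: "\<rho>' y \<le> H * r"
    proof -
      have "\<rho> y \<le> C * (\<rho> x\<^sub>0 + norm (x\<^sub>0 - y))" by (rule upper)
      also have "\<dots> \<le> C * (r / c + r)"
        using ny big c C by (intro mult_left_mono add_mono) (auto simp: field_simps)
      also have "\<dots> = H * r" by (simp add: H_def algebra_simps)
      finally show ?thesis using \<rho>'(2)[of y] by simp
    qed
    have main: "z powr (- real ((N + 1) * p)) / (2 * (r / ?d)) ^ DIM('a) \<le> K * ((1 / 2 ^ p) ^ j / \<rho>' y ^ DIM('a))"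
    proof -
      have "(2 ^ p) ^ j = (2 ^ j :: real) ^ p" by (simp add: power_mult[symmetric] mult.commute)
      also have "\<dots> \<le> (2 * X) ^ p" using j(2) by (intro power_mono) auto
      also have "\<dots> = A ^ p * z ^ ((N + 1) * p)"
        unfolding X_def A_def power_mult power_mult_distrib[symmetric] by (simp add: mult_ac)
      finally have 1: "(2 ^ p) ^ j \<le> A ^ p * z ^ ((N + 1) * p)" .
      have "z powr (- real ((N + 1) * p)) = 1 / z ^ ((N + 1) * p)"
        using z by (simp only: powr_minus powr_realpow) (simp add: powr_realpow[symmetric] powr_minus divide_inverse)
      also have "\<dots> \<le> A ^ p * (1 / 2 ^ p) ^ j"
        using 1 z by (simp add: power_divide field_simps)
      finally have 2: "z powr (- real ((N + 1) * p)) \<le> A ^ p * (1 / 2 ^ p) ^ j" .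
      have "\<rho>' y ^ DIM('a) \<le> (H * r) ^ DIM('a)" using up \<rho>'(1)[of y] by (intro power_mono) auto
      also have "\<dots> = (?d / 2 * H) ^ DIM('a) * (2 * (r / ?d)) ^ DIM('a)"
        unfolding power_mult_distrib[symmetric] using d by (simp add: field_simps)
      finally have 3: "1 / (2 * (r / ?d)) ^ DIM('a) \<le> (?d / 2 * H) ^ DIM('a) / \<rho>' y ^ DIM('a)"
        using r d \<rho>'(1)[of y] by (simp only: divide_le_eq le_divide_eq zero_less_power) (simp add: field_simps)
      have "z powr (- real ((N + 1) * p)) * (1 / (2 * (r / ?d)) ^ DIM('a))
          \<le> (A ^ p * (1 / 2 ^ p) ^ j) * ((?d / 2 * H) ^ DIM('a) / \<rho>' y ^ DIM('a))"
        using 2 3 r d AH by (intro mult_mono) auto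
      then show ?thesis by (simp add: K_def mult_ac)
    qed
    have "ennreal (z powr (- real ((N + 1) * p)) / (2 * (r / ?d)) ^ DIM('a))
        \<le> ennreal K * ennreal ((1 / 2 ^ p) ^ j / \<rho>' y ^ DIM('a))"
      using main K \<rho>'(1)[of y] by (subst ennreal_mult[symmetric]) (auto intro: ennreal_leI)
    also have "\<dots> \<le> ennreal K * big_kernel \<rho>' p x y"
    proof (rule mult_left_mono)
      define F :: "nat \<Rightarrow> ennreal"
        where "F = (\<lambda>j. ennreal ((1 / 2 ^ p) ^ j / \<rho>' y ^ DIM('a)) * indicator (cball y (2 ^ j * \<rho>' y)) x)"
      have "sum F {j} \<le> suminf F" by (rule sum_le_suminf) auto
      then have "F j \<le> suminf F" by simp
      moreover have "F j = ennreal ((1 / 2 ^ p) ^ j / \<rho>' y ^ DIM('a))" unfolding F_def using mem by simp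
      ultimately show "ennreal ((1 / 2 ^ p) ^ j / \<rho>' y ^ DIM('a)) \<le> big_kernel \<rho>' p x y"
        unfolding big_kernel_def F_def by simp
    qed simp
    finally show "ennreal ((1 + r / \<rho> x\<^sub>0) powr (- real ((N + 1) * p)) / (2 * (r / ?d)) ^ DIM('a))
      \<le> ennreal K * big_kernel \<rho>' p x y" unfolding z_def .
  qed
qed

section \<open>The mixed weak type inequality\<close>

text \<open>A cell of side between \<open>6 * h\<close> and \<open>12 * h\<close> contains the cube
  by the one-third trick. Its points stay within a fixed multiple of \<open>\<rho> x\<close> of
  \<open>x\<close>, where \<open>\<rho>\<close> drops at most by the factor \<open>A\<close>; thus
  \<open>c = 1 / (12 * A)\<close> keeps the side below \<open>\<rho>\<close>.\<close>

lemma small_cube_in_local_grid: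
  fixes \<rho> :: "'a::euclidean_space \<Rightarrow> real"
  assumes C: "1 \<le> C" and pos: "\<And>x. 0 < \<rho> x"
    and lower: "\<And>x y. \<rho> x \<le> C * \<rho> y * (1 + norm (x - y) / \<rho> x) ^ N"
  obtains c where "0 < c" "\<And>x r. 0 < r \<Longrightarrow> r \<le> c * \<rho> x \<Longrightarrow>
    \<exists>\<tau>\<subseteq>Basis. \<exists>I\<in>local_grid \<rho> \<tau>. cube x r \<subseteq> I \<and>
      vol I \<le> 6 ^ DIM('a) * (2 * (r / sqrt (real DIM('a)))) ^ DIM('a)"
proof -
  let ?d = "real DIM('a)"
  have d: "1 \<le> ?d" "0 < sqrt ?d" "1 \<le> sqrt ?d" using dim_pos[where 'a='a] by (auto simp: Suc_leI)
  define A where "A = C * (1 + 12 * ?d) ^ N"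
  have A: "1 \<le> A"
  proof -
    have "1 * 1 \<le> C * (1 + 12 * ?d) ^ N" using C d by (intro mult_mono one_le_power) auto
    then show ?thesis by (simp add: A_def)
  qed
  define c where "c = 1 / (12 * A)"
  have c: "0 < c" "c \<le> 1" using A by (auto simp: c_def field_simps)
  show ?thesis
  proof (rule that[OF c(1)])
    fix x :: 'a and r assume r: "0 < r" "r \<le> c * \<rho> x"
    define h where "h = r / sqrt ?d"
    have h: "0 < h" "h \<le> r" using r d by (auto simp: h_def divide_le_eq)
    obtain k :: int where k: "2 powi k < 12 * h" "12 * h \<le> 2 powi (k + 1)"
      using ex_power_int_between[of 2 "12 * h"] h by auto
    have e: "(2::real) powi (k + 1) = 2 * 2 powi k" by (simp add: power_int_add)
    \<comment> \<open>The strict lower bound fails for \<open>2 powi k\<close> only if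
      \<open>12 * h\<close> equals \<open>2 powi (k + 1)\<close>, and then that larger power is
      admissible. Levels count downwards in size, hence the signs.\<close>
    obtain n :: int where n: "6 * h < 2 powi (-n)" "2 powi (-n) \<le> 12 * h"
    proof (cases "6 * h < 2 powi k")
      case True
      then show ?thesis using that[of "-k"] k by simp
    next
      case False
      then have "12 * h = 2 powi (k + 1)" using k(2) e by simp
      then have "6 * h < 2 powi (- (- (k + 1)))" "2 powi (- (- (k + 1))) \<le> 12 * h"
        unfolding minus_minus using h by linarith+
      then show ?thesis by (rule that)
    qed
    obtain \<tau> where \<tau>: "\<tau> \<subseteq> Basis" "cbox (x - h *\<^sub>R One) (x + h *\<^sub>R One) \<subseteq> cell \<tau> n x"
      using cbox_subset_shifted_cell[OF h(1) n(1)] .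
    have "cube x r = cbox (x - h *\<^sub>R One) (x + h *\<^sub>R One)" by (simp add: cube_def h_def)
    then have sub: "cube x r \<subseteq> cell \<tau> n x" using \<tau> by simp
    have "2 powi (-n) \<le> \<rho> y" if y: "y \<in> cell \<tau> n x" for y
    proof -
      have "norm (x - y) \<le> ?d * 2 powi (-n)" using y cell_refl by (intro cell_diameter)
      also have "\<dots> \<le> ?d * (12 * r)" using n h by (intro mult_left_mono) auto
      also have "\<dots> \<le> ?d * (12 * (c * \<rho> x))" using r by (intro mult_left_mono) auto
      also have "\<dots> \<le> ?d * (12 * (1 * \<rho> x))" using c pos[of x] by (intro mult_left_mono mult_right_mono) auto
      finally have "norm (x - y) / \<rho> x \<le> 12 * ?d" using pos[of x] by (simp add: field_simps)
      then have "(1 + norm (x - y) / \<rho> x) ^ N \<le> (1 + 12 * ?d) ^ N" using pos[of x] by (intro power_mono) auto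
      then have "C * \<rho> y * (1 + norm (x - y) / \<rho> x) ^ N \<le> C * \<rho> y * (1 + 12 * ?d) ^ N"
        using C pos[of y] by (intro mult_left_mono) auto
      with lower[of x y] have "\<rho> x \<le> A * \<rho> y" by (simp add: A_def mult_ac)
      have "2 powi (-n) \<le> 12 * r" using n h by simp
      also have "\<dots> \<le> 12 * (c * \<rho> x)" using r by simp
      also have "\<dots> = \<rho> x / A" using A by (simp add: c_def)
      also have "\<dots> \<le> \<rho> y" using \<open>\<rho> x \<le> A * \<rho> y\<close> A by (simp add: divide_le_eq mult.commute)
      finally show ?thesis .
    qed
    then have I: "cell \<tau> n x \<in> local_grid \<rho> \<tau>" by (rule local_gridI)
    have "vol (cell \<tau> n x) \<le> (6 * (2 * h)) ^ DIM('a)"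
      unfolding measure_cell using n by (intro power_mono) auto
    also have "\<dots> = 6 ^ DIM('a) * (2 * h) ^ DIM('a)" by (rule power_mult_distrib)
    finally show "\<exists>\<tau>\<subseteq>Basis. \<exists>I\<in>local_grid \<rho> \<tau>. cube x r \<subseteq> I \<and>
      vol I \<le> 6 ^ DIM('a) * (2 * (r / sqrt ?d)) ^ DIM('a)"
      unfolding h_def[symmetric] using \<tau>(1) sub I by blast
  qed
qed

lemma borel_measurable_if_locally_integrable:
  fixes f :: "'a::euclidean_space \<Rightarrow> real"
  assumes "\<And>K. compact K \<Longrightarrow> set_integrable lebesgue K f"
  shows "f \<in> borel_measurable lebesgue"
proof (rule borel_measurable_LIMSEQ_real)
  show "(\<lambda>x. indicator (cball 0 (real n)) x *\<^sub>R f x) \<in> borel_measurable lebesgue" for n :: nat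
    using assms[OF compact_cball, of 0 "real n"] unfolding set_integrable_def by (rule borel_measurable_integrable)
  fix x :: 'a
  obtain m :: nat where m: "norm x \<le> real m" using real_arch_simple by blast
  have "\<forall>\<^sub>F n :: nat in sequentially. indicator (cball 0 (real n)) x *\<^sub>R f x = f x"
    using eventually_ge_at_top[of m] by eventually_elim (use m in \<open>auto simp: indicator_def\<close>)
  then show "(\<lambda>n::nat. indicator (cball 0 (real n)) x *\<^sub>R f x) \<longlonglongrightarrow> f x" by (rule tendsto_eventually)
qed

theorem theorem1p2:
  fixes \<rho> u v :: "'a::euclidean_space \<Rightarrow> real"
  assumes "critical_radius \<rho>"
    and "u \<in> A1_rho \<rho>"
    and "v \<in> Ainf_rho \<rho>"
  shows "\<exists>\<sigma> C. 0 \<le> \<sigma> \<and> 0 < C \<and>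
    (\<forall>t f. 0 < t \<longrightarrow> (\<forall>K. compact K \<longrightarrow> set_integrable lebesgue K (\<lambda>x. f x * v x)) \<longrightarrow>
      (\<integral>\<^sup>+ x\<in>{x. M_rho \<rho> \<sigma> (\<lambda>y. f y * v y) x / ennreal (v x) > ennreal t}.
          ennreal (u x * v x) \<partial>lebesgue)
      \<le> ennreal (C / t) * (\<integral>\<^sup>+ x. ennreal (\<bar>f x\<bar> * u x * v x) \<partial>lebesgue))"
proof -
  obtain \<theta> where \<theta>: "0 \<le> \<theta>" and u: "u \<in> A1_rho_theta \<rho> \<theta>" using assms(2) unfolding A1_rho_def by blast
  obtain \<theta>' where \<theta>': "0 \<le> \<theta>'" and v: "v \<in> Ainf_rho_theta \<rho> \<theta>'" using assms(3) unfolding Ainf_rho_def by blast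
  have wu: "weight u" and wv: "weight v" using u v by (simp_all add: A1_rho_theta_def Ainf_rho_theta_def)
  have um[measurable]: "u \<in> borel_measurable lebesgue" and vm[measurable]: "v \<in> borel_measurable lebesgue"
    and u0: "\<And>x. 0 \<le> u x" and v0: "\<And>x. 0 \<le> v x" and vpos: "AE x in lebesgue. 0 < v x"
    using wu wv unfolding weight_def by auto
  obtain C :: real and N :: nat where C: "1 \<le> C" and pos: "\<And>x. 0 < \<rho> x"
    and lower: "\<And>x y. \<rho> x \<le> C * \<rho> y * (1 + norm (x - y) / \<rho> x) ^ N"
    and upper: "\<And>x y. \<rho> y \<le> C * (\<rho> x + norm (x - y))"
    by (rule critical_radius_bounds[OF assms(1)], rule that)
  obtain \<rho>' :: "'a \<Rightarrow> real" where \<rho>': "continuous_on UNIV \<rho>'" "\<And>x. 0 < \<rho>' x" "\<And>x. \<rho>' x \<le> \<rho> x" "\<And>x. \<rho> x \<le> C * \<rho>' x"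
    by (rule lipschitz_regularization[OF C pos upper], rule that)
  obtain c where c: "0 < c" and small: "\<And>x r. 0 < r \<Longrightarrow> r \<le> c * \<rho> x \<Longrightarrow>
    \<exists>\<tau>\<subseteq>Basis. \<exists>I\<in>local_grid \<rho> \<tau>. cube x r \<subseteq> I \<and>
      vol I \<le> 6 ^ DIM('a) * (2 * (r / sqrt (real DIM('a)))) ^ DIM('a)"
    by (rule small_cube_in_local_grid[OF C pos lower], rule that)
  define T where "T = nat \<lceil>\<theta>\<rceil>"
  have T: "\<theta> \<le> real T" unfolding T_def by linarith
  define p where "p = DIM('a) + T + 1"
  obtain K where K: "0 < K" and kernel: "\<And>x x\<^sub>0 y r. 0 < r \<Longrightarrow> x \<in> cube x\<^sub>0 r \<Longrightarrow> y \<in> cube x\<^sub>0 r \<Longrightarrow> c * \<rho> x\<^sub>0 \<le> r \<Longrightarrow>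
    ennreal ((1 + r / \<rho> x\<^sub>0) powr (- real ((N + 1) * p)) / (2 * (r / sqrt (real DIM('a)))) ^ DIM('a))
      \<le> ennreal K * big_kernel \<rho>' p x y"
    by (rule big_cube_kernel[OF C pos lower upper \<rho>'(2-4) c], rule that)
  obtain B where B: "0 < B" "AE y in lebesgue. \<forall>R\<ge>\<rho>' y.
      emeasure (wmeas u) (cball y R) \<le> ennreal (B * R ^ DIM('a) * (R / \<rho>' y) ^ T * u y)"
    by (rule A1_pointwise[OF C pos lower \<rho>'(2,3) u T], rule that)
  obtain C\<^sub>1 where C\<^sub>1: "0 < C\<^sub>1" "\<And>I \<tau>. I \<in> local_grid \<rho> \<tau> \<Longrightarrow>
    AE x in lebesgue. x \<in> I \<longrightarrow> wvol u I \<le> C\<^sub>1 * u x * vol I"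
    by (rule A1_local_grid[OF pos u \<theta>], rule that)
  define level where "level \<tau> g = {x. 0 < v x \<and> (\<exists>I\<in>local_grid \<rho> \<tau>. x \<in> I \<and> v x * vol I < wvol g I)}"
    for \<tau> and g :: "'a \<Rightarrow> real"
  \<comment> \<open>Packed into a predicate so that a constant can be chosen for each
    \<open>\<tau>\<close>.\<close>
  define weak where "weak \<tau> D \<longleftrightarrow> 0 < D \<and> (\<forall>g. g \<in> borel_measurable lebesgue \<longrightarrow> (\<forall>x. 0 \<le> g x) \<longrightarrow>
      (\<forall>I\<in>local_grid \<rho> \<tau>. emeasure (wmeas g) I < \<infinity>) \<longrightarrow>
      (\<integral>\<^sup>+x\<in>level \<tau> g. ennreal (u x * v x) \<partial>lebesgue) \<le> ennreal D * (\<integral>\<^sup>+x. ennreal (g x * u x) \<partial>lebesgue))" for \<tau> D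
  have "\<exists>D. weak \<tau> D" for \<tau>
  proof -
    interpret dyadic_family "local_grid \<rho> \<tau>" "2 ^ DIM('a)" by (rule dyadic_family_local_grid[OF pos])
    show ?thesis
      by (rule mixed_weak_type[OF A1_imp_local_Ainf[OF pos u \<theta>] u0 Ainf_imp_local_Ainf[OF pos v \<theta>'] v0 C\<^sub>1])
        (auto simp: level_def weak_def)
  qed
  then obtain D where weak: "\<And>\<tau>. weak \<tau> (D \<tau>)" by metis
  then have D: "\<And>\<tau>. 0 < D \<tau>" "\<And>\<tau> g. g \<in> borel_measurable lebesgue \<Longrightarrow> (\<And>x. 0 \<le> g x) \<Longrightarrow>
      (\<And>I. I \<in> local_grid \<rho> \<tau> \<Longrightarrow> emeasure (wmeas g) I < \<infinity>) \<Longrightarrow>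
      (\<integral>\<^sup>+x\<in>level \<tau> g. ennreal (u x * v x) \<partial>lebesgue) \<le> ennreal (D \<tau>) * (\<integral>\<^sup>+x. ennreal (g x * u x) \<partial>lebesgue)"
    unfolding weak_def by blast+
  \<comment> \<open>The damping for which the averages over large cubes are dominated by the
    kernel.\<close>
  define \<sigma> where "\<sigma> = real ((N + 1) * p)"
  have \<sigma>0: "0 \<le> \<sigma>" by (simp add: \<sigma>_def)
  define D' where "D' = (\<Sum>\<tau>\<in>Pow (Basis :: 'a set). D \<tau>)"
  have D': "0 \<le> D'" unfolding D'_def using D(1) by (intro sum_nonneg) (simp add: less_imp_le)
  define M where "M = D' * 6 ^ DIM('a) + K * (2 * B)"
  have M: "0 < M" using D' K B(1) by (simp add: M_def add_nonneg_pos)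
  have main: "(\<integral>\<^sup>+ x\<in>{x. M_rho \<rho> \<sigma> (\<lambda>y. f y * v y) x / ennreal (v x) > ennreal t}. ennreal (u x * v x) \<partial>lebesgue)
      \<le> ennreal (M / t) * (\<integral>\<^sup>+ x. ennreal (\<bar>f x\<bar> * u x * v x) \<partial>lebesgue)"
    if t: "0 < t" and int: "\<And>K. compact K \<Longrightarrow> set_integrable lebesgue K (\<lambda>x. f x * v x)" for t f
  proof -
    define g where "g x = \<bar>f x * v x\<bar>" for x
    have fv: "(\<lambda>x. f x * v x) \<in> borel_measurable lebesgue" by (rule borel_measurable_if_locally_integrable[OF int])
    have gm[measurable]: "g \<in> borel_measurable lebesgue" unfolding g_def using fv by measurable
    have g0: "0 \<le> g x" for x by (simp add: g_def)
    \<comment> \<open>A cell exceeds its cube in volume by the factor \<open>6 ^ DIM('a)\<close> at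
      most. Scaling \<open>g\<close> by \<open>b\<close> thus turns a cube average above
      \<open>t * v x\<close> into a cell mean of \<open>b * g\<close> above
      \<open>v x\<close>.\<close>
    define b where "b = 6 ^ DIM('a) / t"
    have b: "0 < b" using t by (simp add: b_def)
    define R where "R = (\<integral>\<^sup>+x. ennreal (g x * u x) \<partial>lebesgue)"
    define H where "H x = (\<integral>\<^sup>+y. ennreal (g y) * big_kernel \<rho>' p x y \<partial>lebesgue)" for x
    note KB = big_kernel_bound[OF \<rho>'(1,2) um u0 gm g0 B p_def, folded H_def R_def]
    note [measurable] = KB(1)
    have gcb: "emeasure (wmeas (\<lambda>x. b * g x)) X < \<infinity>" if X: "X \<in> sets lebesgue" "X \<subseteq> cball 0 r" for X r
    proof -
      have i: "set_integrable lebesgue (cball 0 r) (\<lambda>x. b * g x)"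
        unfolding g_def by (intro set_integrable_mult_right set_integrable_abs int compact_cball)
      have "emeasure (wmeas (\<lambda>x. b * g x)) X \<le> emeasure (wmeas (\<lambda>x. b * g x)) (cball 0 r)"
        using X by (intro emeasure_mono) auto
      also have "\<dots> = (\<integral>\<^sup>+x. ennreal (b * g x) * indicator (cball 0 r) x \<partial>lebesgue)"
        by (subst emeasure_density) auto
      also have "\<dots> = (\<integral>\<^sup>+x. ennreal (indicator (cball 0 r) x *\<^sub>R (b * g x)) \<partial>lebesgue)"
        by (intro nn_integral_cong) (auto simp: indicator_def)
      also have "\<dots> = ennreal (\<integral>x. indicator (cball 0 r) x *\<^sub>R (b * g x) \<partial>lebesgue)"
        using i b g0 unfolding set_integrable_def by (intro nn_integral_eq_integral) (auto simp: indicator_def)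
      finally show ?thesis by (auto simp: less_top[symmetric] top_unique)
    qed
    have cell_fin: "emeasure (wmeas (\<lambda>x. b * g x)) I < \<infinity>" if Ig: "I \<in> local_grid \<rho> \<tau>" for I \<tau>
    proof -
      obtain n x where I: "I = cell \<tau> n x" using Ig unfolding local_grid_def by blast
      have "bounded I" unfolding I by (rule bounded_subset[OF bounded_cbox cell_subset_cbox])
      then obtain r where "\<And>x. x \<in> I \<Longrightarrow> norm x \<le> r" unfolding bounded_iff by auto
      then have "I \<subseteq> cball 0 r" by auto
      then show ?thesis by (intro gcb[of I r]) (simp_all only: I cell_sets_lebesgue)
    qed
    have W: "emeasure (wmeas (\<lambda>x. b * g x)) X = ennreal b * (\<integral>\<^sup>+y\<in>X. ennreal (g y) \<partial>lebesgue)"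
      if [measurable]: "X \<in> sets lebesgue" for X
    proof -
      have "emeasure (wmeas (\<lambda>x. b * g x)) X = (\<integral>\<^sup>+y. ennreal b * (ennreal (g y) * indicator X y) \<partial>lebesgue)"
        using b g0 by (subst emeasure_density) (auto simp: ennreal_mult mult.assoc)
      then show ?thesis by (simp add: nn_integral_cmult)
    qed
    \<comment> \<open>A single cube witnesses the supremum, and its radius relative to
      \<open>\<rho>\<close> at its centre decides the alternative. The second alternative is a
      pointwise inequality, ready for the strong type bound.\<close>
    have cover: "(\<exists>\<tau>\<in>Pow Basis. x \<in> level \<tau> (\<lambda>x. b * g x)) \<or> ennreal t * ennreal (v x) \<le> ennreal K * H x"
      if vx: "0 < v x" and lt: "M_rho \<rho> \<sigma> (\<lambda>y. f y * v y) x / ennreal (v x) > ennreal t" for x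
    proof -
      have "ennreal t * ennreal (v x) < M_rho \<rho> \<sigma> (\<lambda>y. f y * v y) x"
      proof (rule ccontr)
        assume "\<not> ennreal t * ennreal (v x) < M_rho \<rho> \<sigma> (\<lambda>y. f y * v y) x"
        then have "M_rho \<rho> \<sigma> (\<lambda>y. f y * v y) x / ennreal (v x) \<le> (ennreal t * ennreal (v x)) / ennreal (v x)"
          by (intro divide_right_mono_ennreal) simp
        also have "\<dots> = ennreal t" using vx by (simp add: ennreal_mult_divide_eq)
        finally show False using lt by simp
      qed
      then obtain x0 r where r: "0 < r" "x \<in> cube x0 r" and
        lt': "ennreal t * ennreal (v x) < ennreal ((1 + r / \<rho> x0) powr (- \<sigma>)) *
          ((\<integral>\<^sup>+ y\<in>cube x0 r. ennreal (g y) \<partial>lebesgue) / emeasure lebesgue (cube x0 r))"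
        unfolding M_rho_def less_SUP_iff g_def[symmetric] by auto
      define q where "q = (2 * (r / sqrt (real DIM('a)))) ^ DIM('a)"
      have q: "0 < q" using r dim_pos[where 'a='a] by (simp add: q_def)
      have eq: "emeasure lebesgue (cube x0 r) = ennreal q" unfolding q_def by (rule emeasure_cube[OF r(1)])
      have Qs[measurable]: "cube x0 r \<in> sets lebesgue" by (simp add: cube_def)
      define z where "z = (1 + r / \<rho> x0) powr (- \<sigma>)"
      define J where "J = (\<integral>\<^sup>+ y\<in>cube x0 r. ennreal (g y) \<partial>lebesgue)"
      have z: "0 \<le> z" by (simp add: z_def)
      have lt'': "ennreal t * ennreal (v x) < ennreal (z / q) * J"
      proof -
        have "ennreal z * (J / ennreal q) = ennreal (z / q) * J"
          using z q by (simp add: divide_ennreal_def ennreal_mult divide_inverse inverse_ennreal mult_ac)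
        then show ?thesis using lt' unfolding eq z_def J_def by simp
      qed
      show ?thesis
      proof (cases "r \<le> c * \<rho> x0")
        case True
        obtain \<tau> I where \<tau>: "\<tau> \<subseteq> Basis" and I: "I \<in> local_grid \<rho> \<tau>" "cube x0 r \<subseteq> I"
          and mI: "vol I \<le> 6 ^ DIM('a) * q"
          using small[OF r(1) True] unfolding q_def by blast
        have Is[measurable]: "I \<in> sets lebesgue" using I(1) cell_sets_lebesgue unfolding local_grid_def by blast
        define G where "G = measure (wmeas (\<lambda>x. b * g x)) I"
        have eG: "ennreal G = ennreal b * (\<integral>\<^sup>+y\<in>I. ennreal (g y) \<partial>lebesgue)"
          using cell_fin[OF I(1)] unfolding W[OF Is, symmetric] G_def
          by (intro emeasure_eq_ennreal_measure[symmetric]) auto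
        \<comment> \<open>For small cubes the damping factor is discarded.\<close>
        have "z \<le> 1"
        proof -
          have "1 \<le> 1 + r / \<rho> x0" using r(1) pos[of x0] by simp
          then have "z \<le> (1 + r / \<rho> x0) powr 0" unfolding z_def using \<sigma>0 by (intro powr_mono) auto
          then show ?thesis using \<open>1 \<le> 1 + r / \<rho> x0\<close> by simp
        qed
        then have "z / q \<le> 1 / q" using q by (simp add: divide_right_mono)
        then have "ennreal (z / q) * J \<le> ennreal (1 / q) * J" by (intro mult_right_mono ennreal_leI) auto
        also have "J \<le> (\<integral>\<^sup>+y\<in>I. ennreal (g y) \<partial>lebesgue)"
          unfolding J_def using I(2) by (intro nn_integral_mono) (auto simp: indicator_def)
        finally have "ennreal t * ennreal (v x) < ennreal (1 / q) * (\<integral>\<^sup>+y\<in>I. ennreal (g y) \<partial>lebesgue)"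
          using lt'' by (auto simp: mult_left_mono)
        then have "ennreal (b * q) * (ennreal t * ennreal (v x)) < ennreal (b * q) * (ennreal (1 / q) * (\<integral>\<^sup>+y\<in>I. ennreal (g y) \<partial>lebesgue))"
          using b q by (intro ennreal_mult_strict_left_mono) auto
        also have "\<dots> = ennreal G"
          unfolding eG using b q by (simp add: mult.assoc[symmetric] ennreal_mult[symmetric])
        also have "ennreal (b * q) * (ennreal t * ennreal (v x)) = ennreal (6 ^ DIM('a) * q * v x)"
          using b q t v0[of x] by (simp add: ennreal_mult[symmetric] b_def)
        finally have "6 ^ DIM('a) * q * v x < G"
          using v0[of x] q by (subst (asm) ennreal_less_iff) auto
        moreover have "v x * vol I \<le> v x * (6 ^ DIM('a) * q)" using mI v0[of x] by (intro mult_left_mono)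
        ultimately have "v x * vol I < G" by (simp add: mult_ac)
        then have "x \<in> level \<tau> (\<lambda>x. b * g x)" unfolding level_def G_def using vx I r by blast
        then show ?thesis using \<tau> by blast
      next
        case False
        have "ennreal (z / q) * J = (\<integral>\<^sup>+y. ennreal (z / q) * (ennreal (g y) * indicator (cube x0 r) y) \<partial>lebesgue)"
          unfolding J_def by (rule nn_integral_cmult[symmetric]) measurable
        also have "\<dots> \<le> (\<integral>\<^sup>+y. ennreal K * (ennreal (g y) * big_kernel \<rho>' p x y) \<partial>lebesgue)"
        proof (rule nn_integral_mono)
          fix y
          show "ennreal (z / q) * (ennreal (g y) * indicator (cube x0 r) y) \<le> ennreal K * (ennreal (g y) * big_kernel \<rho>' p x y)"
          proof (cases "y \<in> cube x0 r")
            case True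
            have "ennreal (z / q) \<le> ennreal K * big_kernel \<rho>' p x y"
              unfolding z_def q_def \<sigma>_def using False by (intro kernel r True) auto
            then have "ennreal (g y) * ennreal (z / q) \<le> ennreal (g y) * (ennreal K * big_kernel \<rho>' p x y)"
              by (intro mult_left_mono) auto
            then show ?thesis using True by (simp add: mult_ac)
          qed simp
        qed
        also have "\<dots> = ennreal K * H x"
          unfolding H_def
        proof (rule nn_integral_cmult)
          have [measurable]: "\<rho>' \<in> borel_measurable lebesgue"
            using \<rho>'(1) by (intro measurable_completion) (simp add: borel_measurable_continuous_onI)
          have "(\<lambda>y. indicator (cball y (2 ^ j * \<rho>' y)) x :: ennreal) \<in> borel_measurable lebesgue" for j :: nat
          proof -
            have "continuous_on UNIV (\<lambda>y. 2 ^ j * \<rho>' y)" by (intro continuous_intros \<rho>'(1))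
            from measurable_compose_Pair1[OF _ indicator_cball_measurable[OF this], of x] show ?thesis by simp
          qed
          then have [measurable]: "(\<lambda>y. big_kernel \<rho>' p x y) \<in> borel_measurable lebesgue"
            unfolding big_kernel_def by measurable
          show "(\<lambda>y. ennreal (g y) * big_kernel \<rho>' p x y) \<in> borel_measurable lebesgue" by measurable
        qed
        finally show ?thesis using lt'' by auto
      qed
    qed
    let ?E = "{x. M_rho \<rho> \<sigma> (\<lambda>y. f y * v y) x / ennreal (v x) > ennreal t}"
    let ?L = "\<lambda>\<tau>. level \<tau> (\<lambda>x. b * g x)"
    have Hm: "(\<lambda>x. ennreal (K / t) * (ennreal (u x) * H x)) \<in> borel_measurable lebesgue"
      using KB(1) by measurable
    let ?S = "\<lambda>x. \<Sum>\<tau>\<in>Pow Basis. ennreal (u x * v x) * indicator (?L \<tau>) x"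
    have level_sets: "?L \<tau> \<in> sets lebesgue" for \<tau>
    proof -
      interpret dyadic_family "local_grid \<rho> \<tau>" "2 ^ DIM('a)" by (rule dyadic_family_local_grid[OF pos])
      have "?L \<tau> = {x\<in>space lebesgue. 0 < v x} \<inter> (\<Union>I\<in>local_grid \<rho> \<tau>. I \<inter>
          {x\<in>space lebesgue. v x * vol I < measure (wmeas (\<lambda>x. b * g x)) I})"
        unfolding level_def by auto
      also have "\<dots> \<in> sets lebesgue"
      proof (intro sets.Int sets.countable_UN'' countable_family)
        show "{x\<in>space lebesgue. 0 < v x} \<in> sets lebesgue" by measurable
        show "{x\<in>space lebesgue. v x * vol I < measure (wmeas (\<lambda>x. b * g x)) I} \<in> sets lebesgue" for I
          by measurable
      qed (rule cell_sets)
      finally show ?thesis .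
    qed
    have uv: "(\<lambda>x. ennreal (u x * v x)) \<in> borel_measurable lebesgue" by measurable
    have Lm: "(\<lambda>x. ennreal (u x * v x) * indicator (?L \<tau>) x) \<in> borel_measurable lebesgue" for \<tau>
      by (intro borel_measurable_times_ennreal uv borel_measurable_indicator level_sets)
    have Sm: "?S \<in> borel_measurable lebesgue" by (intro borel_measurable_sum Lm)
    have "(\<integral>\<^sup>+ x\<in>?E. ennreal (u x * v x) \<partial>lebesgue)
        \<le> (\<integral>\<^sup>+x. ?S x +
            ennreal (K / t) * (ennreal (u x) * H x) \<partial>lebesgue)"
    proof (rule nn_integral_mono_AE)
      show "AE x in lebesgue. ennreal (u x * v x) * indicator ?E x
        \<le> ?S x + ennreal (K / t) * (ennreal (u x) * H x)"
        using vpos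
      proof eventually_elim
        case (elim x)
        show ?case
        proof (cases "M_rho \<rho> \<sigma> (\<lambda>y. f y * v y) x / ennreal (v x) > ennreal t")
          case True
          from cover[OF elim True] show ?thesis
          proof
            assume "\<exists>\<tau>\<in>Pow Basis. x \<in> ?L \<tau>"
            then obtain \<tau> where \<tau>: "\<tau> \<in> Pow Basis" "x \<in> ?L \<tau>" by blast
            have "ennreal (u x * v x) * indicator (?L \<tau>) x
                \<le> ?S x"
              using \<tau>(1) by (intro member_le_sum) auto
            then show ?thesis using True \<tau>(2) by (simp add: add_increasing2)
          next
            assume le: "ennreal t * ennreal (v x) \<le> ennreal K * H x"
            \<comment> \<open>Here \<open>v\<close> is traded for \<open>H\<close> through
              \<open>le\<close>, after which only the integral of \<open>u\<close> times
              \<open>H\<close> remains.\<close>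
            have "ennreal (u x * v x) = ennreal (u x / t) * (ennreal t * ennreal (v x))"
              using t u0[of x] v0[of x] by (simp add: ennreal_mult[symmetric])
            also have "\<dots> \<le> ennreal (u x / t) * (ennreal K * H x)" using le by (intro mult_left_mono) auto
            also have "\<dots> = ennreal (K / t) * (ennreal (u x) * H x)"
            proof -
              have "ennreal (u x / t) * ennreal K = ennreal (K / t) * ennreal (u x)"
                using t u0[of x] K by (simp add: ennreal_mult[symmetric] mult.commute)
              then show ?thesis by (simp only: mult.assoc[symmetric])
            qed
            finally show ?thesis using True by (simp add: add_increasing)
          qed
        qed simp
      qed
    qed
    also have "\<dots> = (\<integral>\<^sup>+x. ?S x \<partial>lebesgue)
        + (\<integral>\<^sup>+x. ennreal (K / t) * (ennreal (u x) * H x) \<partial>lebesgue)"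
      by (rule nn_integral_add[OF Sm Hm])
    also have "(\<integral>\<^sup>+x. ?S x \<partial>lebesgue)
        = (\<Sum>\<tau>\<in>Pow Basis. \<integral>\<^sup>+x\<in>?L \<tau>. ennreal (u x * v x) \<partial>lebesgue)"
      by (rule nn_integral_sum[OF Lm])
    also have "\<dots> \<le> (\<Sum>\<tau>\<in>Pow Basis. ennreal (D \<tau>) * (ennreal b * R))"
    proof (rule sum_mono)
      fix \<tau> :: "'a set"
      have "(\<integral>\<^sup>+x\<in>?L \<tau>. ennreal (u x * v x) \<partial>lebesgue)
          \<le> ennreal (D \<tau>) * (\<integral>\<^sup>+x. ennreal (b * g x * u x) \<partial>lebesgue)"
        using b g0 cell_fin by (intro D(2)) auto
      also have "(\<integral>\<^sup>+x. ennreal (b * g x * u x) \<partial>lebesgue) = (\<integral>\<^sup>+x. ennreal b * ennreal (g x * u x) \<partial>lebesgue)"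
        using b g0 u0 by (intro nn_integral_cong) (simp add: ennreal_mult[symmetric] mult.assoc)
      also have "\<dots> = ennreal b * R" unfolding R_def by (rule nn_integral_cmult) measurable
      finally show "(\<integral>\<^sup>+x\<in>?L \<tau>. ennreal (u x * v x) \<partial>lebesgue) \<le> ennreal (D \<tau>) * (ennreal b * R)" .
    qed
    also have "(\<Sum>\<tau>\<in>Pow Basis. ennreal (D \<tau>) * (ennreal b * R)) = ennreal (D' * b) * R"
    proof -
      have "(\<Sum>\<tau>\<in>Pow Basis. ennreal (D \<tau>)) = ennreal D'"
        unfolding D'_def using D(1) by (intro sum_ennreal) (simp add: less_imp_le)
      then show ?thesis using D' b by (simp add: sum_distrib_right[symmetric] ennreal_mult mult.assoc)
    qed
    also have "(\<integral>\<^sup>+x. ennreal (K / t) * (ennreal (u x) * H x) \<partial>lebesgue) = ennreal (K / t) * (\<integral>\<^sup>+x. ennreal (u x) * H x \<partial>lebesgue)"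
      by (rule nn_integral_cmult) measurable
    also have "\<dots> \<le> ennreal (K / t) * (ennreal (2 * B) * R)" by (intro mult_left_mono KB(2)) simp
    also have "\<dots> = ennreal (K / t * (2 * B)) * R"
    proof -
      have "ennreal (K / t * (2 * B)) = ennreal (K / t) * ennreal (2 * B)"
        using K t B(1) by (intro ennreal_mult) auto
      then show ?thesis by (simp only: mult.assoc)
    qed
    also have "ennreal (D' * b) * R + ennreal (K / t * (2 * B)) * R = ennreal (M / t) * R"
    proof -
      have "D' * b + K / t * (2 * B) = M / t" by (simp add: M_def b_def add_divide_distrib)
      then show ?thesis using D' b K t B(1) by (simp add: distrib_right[symmetric] ennreal_plus[symmetric] del: ennreal_plus)
    qed
    also have "R = (\<integral>\<^sup>+ x. ennreal (\<bar>f x\<bar> * u x * v x) \<partial>lebesgue)"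
      unfolding R_def g_def using v0 by (intro nn_integral_cong) (simp add: abs_mult mult_ac)
    finally show ?thesis by (simp add: add_mono)
  qed
  show ?thesis
    by (intro exI[of _ \<sigma>] exI[of _ M] conjI allI impI \<sigma>0 M main) auto
qed

end
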